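(* Let $(k,l)$ be a pair of relatively prime integers such that $k>l>0$. Then the interior Fraser-Sargent surface $IFS_{k,l}$ satisfies $$\mathrm{Ind}(IFS_{k,l})\le\begin{cases}8(k+l)-7,&k\text{ odd},\\4(k+l)-7,&k\text{ even}.\end{cases}$$
   Context: Notation: $\mathbb B^4$ is the closed unit ball in Euclidean space $\mathbb E^4$. For relatively prime integers $k>l>0$ let $T_{k,l}$ be the unique positive solution of $k\tanh(kt)=l\coth(lt)$, let $r=\sqrt{k^2\sinh^2(lT_{k,l})+l^2\cosh^2(kT_{k,l})}$, and let $$u(t,\theta)=\tfrac1r\,(k\sinh lt\cos l\theta,\;k\sinh lt\sin l\theta,\;l\cosh kt\cos k\theta,\;l\cosh kt\sin k\theta),\quad t\in[-T_{k,l},T_{k,l}],\ \theta\in\mathbb R/2\pi\mathbb Z,$$ a conformal minimal immersion into $\mathbb B^4$ meeting $\partial\mathbb B^4$ orthogonally along $t=\pm T_{k,l}$. If $k$ is odd, $IFS_{k,l}$ is the annulus $[-T_{k,l},T_{k,l}]\times(\mathbb R/2\pi\mathbb Z)$ immersed by $u$. If $k$ is even, $u$ is invariant under the fixed-point-free involution $(t,\theta)\mapsto(-t,\theta+\pi)$ and $IFS_{k,l}$ is the quotient Möbius band immersed by the induced map. It is a free boundary minimal surface in $\mathbb B^4$. For a compact free boundary minimal surface $\Sigma$ in $\mathbb B^n$ with normal bundle $N\Sigma$, second fundamental form $b_{ij}=(\nabla_{e_i}e_j)^\bot$ and $\mathcal B(X)=\sum_{i,j}\langle b_{ij},X\rangle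 b_{ij}$, the index $\mathrm{Ind}(\Sigma)$ is the maximal dimension of a subspace of $\Gamma(N\Sigma)$ on which $$\delta^2A(X)=\int_\Sigma(|\nabla^\bot X|^2-\langle\mathcal B(X),X\rangle)\,dA-\int_{\partial\Sigma}|X|^2\,dL$$ is negative definite (no boundary condition is imposed on $X$). *)

theory Defs
  imports "HOL-Analysis.Analysis" "HOL-Library.Function_Algebras"
begin

text \<open>
  Annuli and Moebius bands are described on the closed strip
  \<open>[-T, T] \<times> \<real>\<close>, with coordinates \<open>(t, \<theta>)\<close>, which is their universal cover: fields on the
  surface are the fields on the strip that are invariant under the deck group.  The deck group is
  generated by \<open>(t, \<theta>) \<mapsto> (t, \<theta> + 2\<pi>)\<close> for the annulus, and by
  \<open>(t, \<theta>) \<mapsto> (-t, \<theta> + \<pi>)\<close> for the Moebius band.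
  The type \<open>2\<close> indexes the coordinates: \<open>1\<close> stands for \<open>t\<close> and \<open>2\<close> for \<open>\<theta>\<close>.
\<close>

definition strip :: "real \<Rightarrow> (real \<times> real) set" where
  "strip T = {-T..T} \<times> UNIV"

text \<open>The \<open>t\<close>-derivative is one-sided on the boundary lines \<open>t = \<plusminus>T\<close>.\<close>

definition pd :: "real \<Rightarrow> 2 \<Rightarrow> (real \<times> real \<Rightarrow> 'a::real_normed_vector) \<Rightarrow> real \<times> real \<Rightarrow> 'a" where
  "pd T i X p =
     (if i = 1 then vector_derivative (\<lambda>s. X (s, snd p)) (at (fst p) within {-T..T})
      else vector_derivative (\<lambda>s. X (fst p, s)) (at (snd p)))"

text \<open>Smoothness up to the boundary; \<open>D i j\<close> is the partial derivative of order \<open>i\<close> in \<open>t\<close>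
  and order \<open>j\<close> in \<open>\<theta>\<close>.\<close>

definition smooth_on_strip :: "real \<Rightarrow> (real \<times> real \<Rightarrow> 'a::real_normed_vector) \<Rightarrow> bool" where
  "smooth_on_strip T X \<longleftrightarrow>
     (\<exists>D :: nat \<Rightarrow> nat \<Rightarrow> real \<times> real \<Rightarrow> 'a.
        (\<forall>p\<in>strip T. D 0 0 p = X p) \<and>
        (\<forall>i j. \<forall>p\<in>strip T.
           (D i j has_derivative (\<lambda>h. fst h *\<^sub>R D (Suc i) j p + snd h *\<^sub>R D i (Suc j) p))
             (at p within strip T)))"

definition metric :: "real \<Rightarrow> (real \<times> real \<Rightarrow> 'a::euclidean_space) \<Rightarrow> real \<times> real \<Rightarrow> real^2^2" where
  "metric T u p = (\<chi> i j. pd T i u p \<bullet> pd T j u p)"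

abbreviation cometric :: "real \<Rightarrow> (real \<times> real \<Rightarrow> 'a::euclidean_space) \<Rightarrow> real \<times> real \<Rightarrow> real^2^2" where
  "cometric T u p \<equiv> matrix_inv (metric T u p)"

definition normal_part ::
  "real \<Rightarrow> (real \<times> real \<Rightarrow> 'a::euclidean_space) \<Rightarrow> real \<times> real \<Rightarrow> 'a \<Rightarrow> 'a" where
  "normal_part T u p v =
     v - (\<Sum>i\<in>UNIV. \<Sum>j\<in>UNIV. (cometric T u p $ i $ j * (v \<bullet> pd T j u p)) *\<^sub>R pd T i u p)"

definition second_ff ::
  "real \<Rightarrow> (real \<times> real \<Rightarrow> 'a::euclidean_space) \<Rightarrow> 2 \<Rightarrow> 2 \<Rightarrow> real \<times> real \<Rightarrow> 'a" where
  "second_ff T u i j p = normal_part T u p (pd T i (pd T j u) p)"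

definition normal_connection ::
  "real \<Rightarrow> (real \<times> real \<Rightarrow> 'a::euclidean_space) \<Rightarrow> 2 \<Rightarrow> (real \<times> real \<Rightarrow> 'a) \<Rightarrow> real \<times> real \<Rightarrow> 'a" where
  "normal_connection T u i X p = normal_part T u p (pd T i X p)"

text \<open>Sums over a local orthonormal tangent frame are written in coordinates, as contractions with
  the inverse metric.\<close>

definition norm_sq_normal_gradient ::
  "real \<Rightarrow> (real \<times> real \<Rightarrow> 'a::euclidean_space) \<Rightarrow> (real \<times> real \<Rightarrow> 'a) \<Rightarrow> real \<times> real \<Rightarrow> real" where
  "norm_sq_normal_gradient T u X p =
     (\<Sum>i\<in>UNIV. \<Sum>j\<in>UNIV. cometric T u p $ i $ j *
        (normal_connection T u i X p \<bullet> normal_connection T u j X p))"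

definition simons_op ::
  "real \<Rightarrow> (real \<times> real \<Rightarrow> 'a::euclidean_space) \<Rightarrow> (real \<times> real \<Rightarrow> 'a) \<Rightarrow> real \<times> real \<Rightarrow> 'a" where
  "simons_op T u X p =
     (\<Sum>i\<in>UNIV. \<Sum>j\<in>UNIV. \<Sum>a\<in>UNIV. \<Sum>b\<in>UNIV.
        (cometric T u p $ i $ a * cometric T u p $ j $ b * (second_ff T u i j p \<bullet> X p))
          *\<^sub>R second_ff T u a b p)"

text \<open>\<open>F\<close> is a fundamental domain of the deck group on the strip, and \<open>E\<close> the set of those
  \<open>t\<close> for which the circles \<open>{t} \<times> \<real>/2\<pi>\<int>\<close> are the boundary components of the
  surface, each listed once.  The factors are the area and length densities of \<open>u\<close>.\<close>

definition second_variation ::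
  "(real \<times> real) set \<Rightarrow> real set \<Rightarrow> real \<Rightarrow> (real \<times> real \<Rightarrow> 'a::euclidean_space) \<Rightarrow>
   (real \<times> real \<Rightarrow> 'a) \<Rightarrow> real" where
  "second_variation F E T u X =
     integral F (\<lambda>p. (norm_sq_normal_gradient T u X p - simons_op T u X p \<bullet> X p)
                     * sqrt (det (metric T u p)))
     - (\<Sum>t\<in>E. integral {0..2 * pi} (\<lambda>\<theta>. (norm (X (t, \<theta>)))\<^sup>2 * norm (pd T 2 u (t, \<theta>))))"

text \<open>Fields are set to zero off the strip, so that distinct functions are distinct sections.\<close>

definition annulus_normal_fields ::
  "real \<Rightarrow> (real \<times> real \<Rightarrow> 'a::euclidean_space) \<Rightarrow> (real \<times> real \<Rightarrow> 'a) set" where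
  "annulus_normal_fields T u =
     {X. smooth_on_strip T X \<and>
         (\<forall>p. p \<notin> strip T \<longrightarrow> X p = 0) \<and>
         (\<forall>t \<theta>. X (t, \<theta> + 2 * pi) = X (t, \<theta>)) \<and>
         (\<forall>p\<in>strip T. \<forall>i. X p \<bullet> pd T i u p = 0)}"

definition moebius_normal_fields ::
  "real \<Rightarrow> (real \<times> real \<Rightarrow> 'a::euclidean_space) \<Rightarrow> (real \<times> real \<Rightarrow> 'a) set" where
  "moebius_normal_fields T u =
     {X \<in> annulus_normal_fields T u. \<forall>t \<theta>. X (- t, \<theta> + pi) = X (t, \<theta>)}"

interpretation fun_vs: vector_space "\<lambda>(c::real) (X :: 'b \<Rightarrow> 'a::real_vector) p. c *\<^sub>R X p"
  by unfold_locales (auto simp: fun_eq_iff scaleR_add_right scaleR_add_left)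

text \<open>Dimension of a subspace \<open>V\<close>, in contrast to \<open>dim\<close> with value \<open>\<infinity>\<close>
  in the infinite-dimensional case.\<close>

definition edim :: "('b \<Rightarrow> 'a::real_vector) set \<Rightarrow> enat" where
  "edim V = (if \<exists>B. finite B \<and> fun_vs.span B = V then enat (fun_vs.dim V) else \<infinity>)"

definition form_index :: "('b \<Rightarrow> 'a::real_vector) set \<Rightarrow> (('b \<Rightarrow> 'a) \<Rightarrow> real) \<Rightarrow> enat" where
  "form_index \<Gamma> Q =
     (SUP V \<in> {V. fun_vs.subspace V \<and> V \<subseteq> \<Gamma> \<and> (\<forall>X\<in>V. X \<noteq> 0 \<longrightarrow> Q X < 0)}. edim V)"

definition annulus_index :: "real \<Rightarrow> (real \<times> real \<Rightarrow> 'a::euclidean_space) \<Rightarrow> enat" where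
  "annulus_index T u =
     form_index (annulus_normal_fields T u)
       (second_variation ({-T..T} \<times> {0..2 * pi}) {-T, T} T u)"

definition moebius_index :: "real \<Rightarrow> (real \<times> real \<Rightarrow> 'a::euclidean_space) \<Rightarrow> enat" where
  "moebius_index T u =
     form_index (moebius_normal_fields T u)
       (second_variation ({0..T} \<times> {0..2 * pi}) {T} T u)"

definition fs_T :: "int \<Rightarrow> int \<Rightarrow> real" where
  "fs_T k l =
     (THE t. t > 0 \<and>
        real_of_int k * tanh (real_of_int k * t) =
        real_of_int l * (cosh (real_of_int l * t) / sinh (real_of_int l * t)))"

definition fs_r :: "int \<Rightarrow> int \<Rightarrow> real" where
  "fs_r k l =
     sqrt ((real_of_int k)\<^sup>2 * (sinh (real_of_int l * fs_T k l))\<^sup>2 +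
           (real_of_int l)\<^sup>2 * (cosh (real_of_int k * fs_T k l))\<^sup>2)"

definition fs_u :: "int \<Rightarrow> int \<Rightarrow> real \<times> real \<Rightarrow> real^4" where
  "fs_u k l = (\<lambda>(t, \<theta>).
     (1 / fs_r k l) *\<^sub>R vector
       [real_of_int k * sinh (real_of_int l * t) * cos (real_of_int l * \<theta>),
        real_of_int k * sinh (real_of_int l * t) * sin (real_of_int l * \<theta>),
        real_of_int l * cosh (real_of_int k * t) * cos (real_of_int k * \<theta>),
        real_of_int l * cosh (real_of_int k * t) * sin (real_of_int k * \<theta>)])"

definition Ind_IFS :: "int \<Rightarrow> int \<Rightarrow> enat" where
  "Ind_IFS k l =
     (if odd k then annulus_index (fs_T k l) (fs_u k l)
      else moebius_index (fs_T k l) (fs_u k l))"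

end

theory Submission
  imports Defs
begin

text \<open>
  Let \<open>X\<close> be a normal field.  For a tangent field \<open>Y\<close> that is tangent to the boundary and makes
  \<open>V = X + Y\<close> an infinitesimally conformal variation, the second variation of area at \<open>X\<close>
  equals the second variation of energy \<open>\<integral>|\<nabla>V|\<^sup>2 - \<integral>\<^sub>\<partial>|V|\<^sup>2\<close> at \<open>V\<close>.  Such a \<open>Y\<close> solves a Cauchy--Riemann
  system, which on an annulus or Moebius band has a one-dimensional cokernel.  The energy form is
  the Steklov form in each of the four coordinates, hence nonnegative once the components of \<open>V\<close>
  are orthogonal on the boundary to the Steklov eigenfunctions below the critical eigenvalue: in the
  frequency \<open>n\<close>, the even ones for \<open>|n| < k\<close> and the odd ones for \<open>|n| < l\<close>.  On the annulus
  these are \<open>2(k + l) - 2\<close> functions, which gives \<open>4(2(k + l) - 2) + 1\<close> linear conditions on \<open>X\<close>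
  that force a nonnegative second variation; on the Moebius band half of the eigenfunctions survive.
  All of this is done in one Fourier mode in \<open>\<theta>\<close> at a time, where the Cauchy--Riemann system
  is an explicitly solvable ordinary differential equation and only \<open>C\<^sup>1\<close> regularity is needed.
\<close>

section \<open>Linear functionals and dimension\<close>

text \<open>Energy is conformally invariant, so \<open>u\<close> enters the energy form only through
  the constant boundary weight \<open>h\<close>, and the estimates take place on the flat cylinder.
  There the frequency \<open>n\<close> has the Steklov eigenvalue \<open>n * tanh (n * T)\<close> on
  even and \<open>n * coth (n * T)\<close> on odd functions of \<open>t\<close>. The equation for
  \<open>T\<close> says that the even one for \<open>k\<close> equals the odd one for
  \<open>l\<close>; \<open>h\<close> is the common value, hence the thresholds \<open>k\<close> and
  \<open>l\<close>. The conditions concern V on the boundary but are counted as functionals of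
  \<open>X\<close>, so the Cauchy--Riemann system is solved in closed form and Y is visibly linear
  in \<open>X\<close>. In the frame rotating along \<open>u\<close> all coefficients depend on
  \<open>t\<close> alone and the frequencies \<open>m\<close> decouple; mode \<open>m\<close>
  carries the frequencies \<open>l + m\<close>, \<open>l - m\<close>, \<open>k + m\<close>,
  \<open>k - m\<close> of the original coordinates. Reassembling the modes needs no convergent
  series for derivatives of \<open>X\<close>: positive squares are bounded below by Bessel, and the
  negative terms contain \<open>X\<close> undifferentiated, so a Parseval inequality with error
  controlled by the \<open>\<theta>\<close>-derivative suffices.\<close>

lemma sum_fun_apply: "(\<Sum>i\<in>I. g i) x = (\<Sum>i\<in>I. g i x)"
  by (induction I rule: infinite_finite_induct) auto

text \<open>The functionals together embed \<open>V\<close> into a space of dimension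
  \<open>card I\<close>. Linearity is asked on \<open>V\<close> only, because the functionals of the
  application are integrals, which are additive only on fields regular enough to be
  integrable.\<close>

lemma edim_le_card_functionals:
  fixes L :: "'i \<Rightarrow> ('b \<Rightarrow> 'a::real_vector) \<Rightarrow> real"
  assumes I: "finite I" and V: "fun_vs.subspace V"
    and add: "\<And>i X Y. i \<in> I \<Longrightarrow> X \<in> V \<Longrightarrow> Y \<in> V \<Longrightarrow> L i (X + Y) = L i X + L i Y"
    and scale: "\<And>i c X. i \<in> I \<Longrightarrow> X \<in> V \<Longrightarrow> L i (\<lambda>p. c *\<^sub>R X p) = c * L i X"
    and inj: "\<And>X. X \<in> V \<Longrightarrow> (\<And>i. i \<in> I \<Longrightarrow> L i X = 0) \<Longrightarrow> X = 0"
  shows "edim V \<le> enat (card I)"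
proof -
  let ?sV = "\<lambda>(c::real) (X :: 'b \<Rightarrow> 'a) p. c *\<^sub>R X p"
  let ?sI = "\<lambda>(c::real) (X :: 'i \<Rightarrow> real) p. c *\<^sub>R X p"
  interpret vp: vector_space_pair ?sV ?sI ..
  define \<Phi> where "\<Phi> X = (\<lambda>i. if i \<in> I then L i X else 0)" for X
  obtain B where B: "B \<subseteq> V" "fun_vs.independent B" "V \<subseteq> fun_vs.span B"
    by (rule fun_vs.maximal_independent_subset)
  have span: "fun_vs.span B = V"
    using B V by (metis fun_vs.span_minimal subset_antisym)
  \<comment> \<open>\<open>\<Phi>\<close> is linear only on \<open>V\<close>. Extending its values
    on the basis \<open>B\<close> gives a map that is linear on the whole function space and agrees
    with \<open>\<Phi>\<close> on \<open>V\<close>.\<close>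
  define f where "f = vp.construct B \<Phi>"
  have lin: "Vector_Spaces.linear ?sV ?sI f"
    unfolding f_def by (rule vp.linear_construct[OF B(2)])
  interpret f: Vector_Spaces.linear ?sV ?sI f by (rule lin)
  have f\<Phi>: "f X = \<Phi> X \<and> X \<in> V" if "X \<in> fun_vs.span B" for X
    using that
  proof (induction rule: fun_vs.span_induct_alt)
    case base
    have "L i 0 = 0" if "i \<in> I" for i
      using scale[OF that fun_vs.subspace_0[OF V], of 0] by (simp add: zero_fun_def)
    then have "\<Phi> 0 = 0" by (auto simp: \<Phi>_def zero_fun_def)
    then show ?case using fun_vs.subspace_0[OF V] f.zero by metis
  next
    case (step c x y)
    have x: "x \<in> V" using step B by auto
    then have cx: "(\<lambda>p. c *\<^sub>R x p) \<in> V" using fun_vs.subspace_scale[OF V] by auto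
    have "f x = \<Phi> x" unfolding f_def by (rule vp.construct_basis[OF B(2) step(1)])
    then have "f ((\<lambda>p. c *\<^sub>R x p) + y) = \<Phi> ((\<lambda>p. c *\<^sub>R x p) + y)"
      using step x cx by (auto simp: f.add f.scale \<Phi>_def add scale fun_eq_iff)
    moreover have "(\<lambda>p. c *\<^sub>R x p) + y \<in> V"
      using fun_vs.subspace_add[OF V cx] step by auto
    ultimately show ?case by blast
  qed
  have "inj_on f (fun_vs.span B)"
  proof (subst f.inj_on_iff_eq_0[OF fun_vs.subspace_span], intro ballI impI)
    fix X assume X: "X \<in> fun_vs.span B" "f X = 0"
    then have "\<Phi> X = 0" using f\<Phi> by auto
    then have "L i X = 0" if "i \<in> I" for i
      using that unfolding \<Phi>_def fun_eq_iff by (metis zero_fun_apply)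
    then show "X = 0" using inj X span by auto
  qed
  then have ind: "fun_vs.independent (f ` B)" and injB: "inj_on f B"
    using f.independent_injective_image[OF B(2)] fun_vs.span_superset inj_on_subset by blast+
  define U where "U = (\<lambda>i j. if j = i then 1 else 0 :: real) ` I"
  have \<Phi>U: "\<Phi> X \<in> fun_vs.span U" for X
  proof -
    have "\<Phi> X = (\<Sum>i\<in>I. (\<lambda>j. L i X *\<^sub>R (if j = i then 1 else 0)))"
      using I by (auto simp: \<Phi>_def fun_eq_iff sum_fun_apply if_distrib cong: if_cong)
    also have "\<dots> \<in> fun_vs.span U"
      by (intro fun_vs.span_sum fun_vs.span_scale fun_vs.span_base) (auto simp: U_def)
    finally show ?thesis .
  qed
  have "f ` B \<subseteq> fun_vs.span U"
  proof (rule image_subsetI)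
    fix x assume "x \<in> B"
    then have "f x = \<Phi> x" using f\<Phi>[OF fun_vs.span_base] by blast
    then show "f x \<in> fun_vs.span U" using \<Phi>U by (simp only:)
  qed
  \<comment> \<open>Finiteness of \<open>B\<close> comes out here: its injective image is
    independent inside the span of the finite set \<open>U\<close>.\<close>
  then have "finite (f ` B) \<and> card (f ` B) \<le> card U"
    by (intro fun_vs.independent_span_bound[OF _ ind]) (simp_all add: U_def I)
  then have "finite B" "card B \<le> card I"
    using injB card_image_le[OF I] finite_imageD
    by (auto simp: card_image U_def intro: order_trans)
  then show ?thesis
    using span fun_vs.dim_span_eq_card_independent[OF B(2)] unfolding edim_def by auto
qed

section \<open>Fourier coefficients and Parseval with remainder\<close>

definition cos_coeff :: "nat \<Rightarrow> (real \<Rightarrow> real) \<Rightarrow> real" where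
  "cos_coeff m F = integral {0..2 * pi} (\<lambda>\<theta>. F \<theta> * cos (real m * \<theta>))"

definition sin_coeff :: "nat \<Rightarrow> (real \<Rightarrow> real) \<Rightarrow> real" where
  "sin_coeff m F = integral {0..2 * pi} (\<lambda>\<theta>. F \<theta> * sin (real m * \<theta>))"

text \<open>The reciprocal of the integral of the squared cosine over a period. The coefficients are
  unnormalised integrals, so this weight enters every Parseval sum.\<close>

definition coeff_weight :: "nat \<Rightarrow> real" where
  "coeff_weight m = (if m = 0 then 1 / (2 * pi) else 1 / pi)"

definition fourier_sum :: "nat \<Rightarrow> (real \<Rightarrow> real) \<Rightarrow> real \<Rightarrow> real" where
  "fourier_sum N F \<theta> = (\<Sum>m<N. coeff_weight m *
     (cos_coeff m F * cos (real m * \<theta>) + sin_coeff m F * sin (real m * \<theta>)))"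

lemma has_integral_FTC:
  fixes g :: "real \<Rightarrow> real"
  assumes "a \<le> b" "\<And>t. t \<in> {a..b} \<Longrightarrow> (g has_real_derivative g' t) (at t within {a..b})"
  shows "(g' has_integral (g b - g a)) {a..b}"
  using assms by (intro fundamental_theorem_of_calculus)
    (auto simp: has_real_derivative_iff_has_vector_derivative)

lemma sin_coeff_0 [simp]: "sin_coeff 0 F = 0"
  by (simp add: sin_coeff_def)

lemma coeff_weight_pos: "coeff_weight m > 0"
  by (simp add: coeff_weight_def)

lemma sin_int_2pi: "sin (real_of_int j * (2 * pi)) = 0"
  by (metis mult.commute mult.left_commute sin_int_2pin)

lemma cos_int_2pi: "cos (real_of_int j * (2 * pi)) = 1"
  by (metis mult.commute mult.left_commute cos_int_2pin)

lemma has_integral_cos_period: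
  "((\<lambda>\<theta>. cos (real_of_int j * \<theta>)) has_integral (if j = 0 then 2 * pi else 0)) {0..2 * pi}"
proof (cases "j = 0")
  case True
  then show ?thesis using has_integral_const_real[of "1::real" 0 "2 * pi"] by simp
next
  case False
  have "((\<lambda>\<theta>. cos (real_of_int j * \<theta>)) has_integral
      (sin (real_of_int j * (2 * pi)) / real_of_int j - sin (real_of_int j * 0) / real_of_int j)) {0..2 * pi}"
    using False by (intro has_integral_FTC) (auto intro!: derivative_eq_intros)
  then show ?thesis using False by (simp add: sin_int_2pi)
qed

lemma has_integral_sin_period:
  "((\<lambda>\<theta>. sin (real_of_int j * \<theta>)) has_integral 0) {0..2 * pi}"
proof (cases "j = 0")
  case False
  have "((\<lambda>\<theta>. sin (real_of_int j * \<theta>)) has_integral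
      (- cos (real_of_int j * (2 * pi)) / real_of_int j - - cos (real_of_int j * 0) / real_of_int j)) {0..2 * pi}"
    using False by (intro has_integral_FTC) (auto intro!: derivative_eq_intros)
  then show ?thesis using False by (simp add: cos_int_2pi)
qed simp

lemma has_integral_cos_cos:
  "((\<lambda>\<theta>. cos (real m * \<theta>) * cos (real n * \<theta>)) has_integral
     (if m = n then (if m = 0 then 2 * pi else pi) else 0)) {0..2 * pi}"
proof -
  have e: "(\<lambda>\<theta>. cos (real m * \<theta>) * cos (real n * \<theta>)) =
      (\<lambda>\<theta>. (1/2) * (cos (real_of_int (int m - int n) * \<theta>) + cos (real_of_int (int m + int n) * \<theta>)))"
    by (auto simp: cos_times_cos algebra_simps)
  show ?thesis unfolding e
    by (rule has_integral_eq_rhs, rule has_integral_mult_right,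
        rule has_integral_add[OF has_integral_cos_period has_integral_cos_period]) auto
qed

lemma has_integral_sin_sin:
  "((\<lambda>\<theta>. sin (real m * \<theta>) * sin (real n * \<theta>)) has_integral
     (if m = n \<and> m \<noteq> 0 then pi else 0)) {0..2 * pi}"
proof -
  have e: "(\<lambda>\<theta>. sin (real m * \<theta>) * sin (real n * \<theta>)) =
      (\<lambda>\<theta>. (1/2) * (cos (real_of_int (int m - int n) * \<theta>) - cos (real_of_int (int m + int n) * \<theta>)))"
    by (auto simp: sin_times_sin algebra_simps diff_divide_distrib)
  show ?thesis unfolding e
    by (rule has_integral_eq_rhs, rule has_integral_mult_right,
        rule has_integral_diff[OF has_integral_cos_period has_integral_cos_period]) auto
qed

lemma has_integral_cos_sin:
  "((\<lambda>\<theta>. cos (real m * \<theta>) * sin (real n * \<theta>)) has_integral 0) {0..2 * pi}"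
proof -
  have e: "(\<lambda>\<theta>. cos (real m * \<theta>) * sin (real n * \<theta>)) =
      (\<lambda>\<theta>. (1/2) * (sin (real_of_int (int m + int n) * \<theta>) - sin (real_of_int (int m - int n) * \<theta>)))"
    by (auto simp: cos_times_sin algebra_simps diff_divide_distrib)
  show ?thesis unfolding e
    by (rule has_integral_eq_rhs, rule has_integral_mult_right,
        rule has_integral_diff[OF has_integral_sin_period has_integral_sin_period]) auto
qed

lemma continuous_fourier_sum [continuous_intros]: "continuous_on S (fourier_sum N F)"
  unfolding fourier_sum_def by (intro continuous_intros)

lemma has_integral_cos_coeff:
  "continuous_on {0..2 * pi} F \<Longrightarrow>
    ((\<lambda>\<theta>. F \<theta> * cos (real m * \<theta>)) has_integral cos_coeff m F) {0..2 * pi}"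
  unfolding cos_coeff_def
  by (intro integrable_integral integrable_continuous_real continuous_intros)

lemma has_integral_sin_coeff:
  "continuous_on {0..2 * pi} F \<Longrightarrow>
    ((\<lambda>\<theta>. F \<theta> * sin (real m * \<theta>)) has_integral sin_coeff m F) {0..2 * pi}"
  unfolding sin_coeff_def
  by (intro integrable_integral integrable_continuous_real continuous_intros)

lemma fourier_sum_orthogonal_cos:
  assumes "N \<le> n"
  shows "((\<lambda>\<theta>. fourier_sum N F \<theta> * cos (real n * \<theta>)) has_integral 0) {0..2 * pi}"
proof -
  have "((\<lambda>\<theta>. \<Sum>m<N. coeff_weight m *
      (cos_coeff m F * (cos (real m * \<theta>) * cos (real n * \<theta>)) +
       sin_coeff m F * (cos (real n * \<theta>) * sin (real m * \<theta>)))) has_integral (\<Sum>m<N. 0)) {0..2 * pi}"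
  proof (intro has_integral_sum)
    fix m assume "m \<in> {..<N}"
    then have "m \<noteq> n" using assms by auto
    then show "((\<lambda>\<theta>. coeff_weight m *
      (cos_coeff m F * (cos (real m * \<theta>) * cos (real n * \<theta>)) +
       sin_coeff m F * (cos (real n * \<theta>) * sin (real m * \<theta>)))) has_integral 0) {0..2 * pi}"
      by (intro has_integral_eq_rhs[OF has_integral_mult_right[OF has_integral_add[OF
            has_integral_mult_right[OF has_integral_cos_cos] has_integral_mult_right[OF has_integral_cos_sin]]]])
         auto
  qed auto
  then show ?thesis
    by (rule has_integral_eq_rhs[OF has_integral_eq, rotated 1])
       (auto simp: fourier_sum_def sum_distrib_left sum_distrib_right algebra_simps intro!: sum.cong)
qed

lemma fourier_sum_orthogonal_sin:
  assumes "N \<le> n"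
  shows "((\<lambda>\<theta>. fourier_sum N F \<theta> * sin (real n * \<theta>)) has_integral 0) {0..2 * pi}"
proof -
  have "((\<lambda>\<theta>. \<Sum>m<N. coeff_weight m *
      (cos_coeff m F * (cos (real m * \<theta>) * sin (real n * \<theta>)) +
       sin_coeff m F * (sin (real m * \<theta>) * sin (real n * \<theta>)))) has_integral (\<Sum>m<N. 0)) {0..2 * pi}"
  proof (intro has_integral_sum)
    fix m assume "m \<in> {..<N}"
    then have "m \<noteq> n" using assms by auto
    then show "((\<lambda>\<theta>. coeff_weight m *
      (cos_coeff m F * (cos (real m * \<theta>) * sin (real n * \<theta>)) +
       sin_coeff m F * (sin (real m * \<theta>) * sin (real n * \<theta>)))) has_integral 0) {0..2 * pi}"
      by (intro has_integral_eq_rhs[OF has_integral_mult_right[OF has_integral_add[OF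
            has_integral_mult_right[OF has_integral_cos_sin] has_integral_mult_right[OF has_integral_sin_sin]]]])
         auto
  qed auto
  then show ?thesis
    by (rule has_integral_eq_rhs[OF has_integral_eq, rotated 1])
       (auto simp: fourier_sum_def sum_distrib_left sum_distrib_right algebra_simps intro!: sum.cong)
qed

text \<open>Induction on \<open>N\<close>: the partial sum is orthogonal to the frequency
  \<open>N\<close>, so the remainder still has the coefficients of \<open>F\<close> at that
  frequency, and removing them lowers the squared norm by the \<open>N\<close>-th summand.\<close>

lemma fourier_defect:
  assumes F: "continuous_on {0..2 * pi} F"
  shows "((\<lambda>\<theta>. (F \<theta> - fourier_sum N F \<theta>)\<^sup>2) has_integral
     (integral {0..2 * pi} (\<lambda>\<theta>. (F \<theta>)\<^sup>2) -
      (\<Sum>m<N. coeff_weight m * ((cos_coeff m F)\<^sup>2 + (sin_coeff m F)\<^sup>2)))) {0..2 * pi}"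
proof (induction N)
  case 0
  then show ?case
    by (auto simp: fourier_sum_def intro!: integrable_integral integrable_continuous_real continuous_intros F)
next
  case (Suc N)
  let ?R = "\<lambda>\<theta>. F \<theta> - fourier_sum N F \<theta>"
  let ?w = "coeff_weight N" and ?c = "cos_coeff N F" and ?s = "sin_coeff N F"
  let ?S = "\<Sum>m<N. coeff_weight m * ((cos_coeff m F)\<^sup>2 + (sin_coeff m F)\<^sup>2)"
  have Rc: "((\<lambda>\<theta>. ?R \<theta> * cos (real N * \<theta>)) has_integral ?c) {0..2 * pi}"
    using has_integral_diff[OF has_integral_cos_coeff[OF F, of N] fourier_sum_orthogonal_cos[of N N F]]
    by (simp add: left_diff_distrib)
  have Rs: "((\<lambda>\<theta>. ?R \<theta> * sin (real N * \<theta>)) has_integral ?s) {0..2 * pi}"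
    using has_integral_diff[OF has_integral_sin_coeff[OF F, of N] fourier_sum_orthogonal_sin[of N N F]]
    by (simp add: left_diff_distrib)
  note h = has_integral_add[OF has_integral_diff[OF Suc.IH
      has_integral_mult_right[OF has_integral_add[OF
        has_integral_mult_right[OF Rc, of ?c] has_integral_mult_right[OF Rs, of ?s]], of "2 * ?w"]]
      has_integral_mult_right[OF has_integral_add[OF has_integral_add[OF
        has_integral_mult_right[OF has_integral_cos_cos[of N N], of "?c\<^sup>2"]
        has_integral_mult_right[OF has_integral_sin_sin[of N N], of "?s\<^sup>2"]]
        has_integral_mult_right[OF has_integral_cos_sin[of N N], of "2 * ?c * ?s"]], of "?w\<^sup>2"]]
  have "?w\<^sup>2 * (?c\<^sup>2 * (if N = 0 then 2 * pi else pi) + ?s\<^sup>2 * (if N \<noteq> 0 then pi else 0)) =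
      ?w * (?c\<^sup>2 + ?s\<^sup>2)"
    by (auto simp: coeff_weight_def power2_eq_square field_simps)
  then show ?case
    by (intro has_integral_eq_rhs[OF has_integral_eq[OF _ h]])
       (auto simp: fourier_sum_def power2_eq_square algebra_simps)
qed

lemma bessel:
  assumes F: "continuous_on {0..2 * pi} F"
  shows "(\<Sum>m<N. coeff_weight m * ((cos_coeff m F)\<^sup>2 + (sin_coeff m F)\<^sup>2))
    \<le> integral {0..2 * pi} (\<lambda>\<theta>. (F \<theta>)\<^sup>2)"
  using has_integral_nonneg[OF fourier_defect[OF F, of N]] by simp

section \<open>Quantitative Fourier remainder of a periodic C1 function\<close>

lemma integral_Cauchy_Schwarz:
  fixes f g :: "real \<Rightarrow> real"
  assumes f: "continuous_on {a..b} f" and g: "continuous_on {a..b} g"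
  shows "(integral {a..b} (\<lambda>x. f x * g x))\<^sup>2 \<le>
    integral {a..b} (\<lambda>x. (f x)\<^sup>2) * integral {a..b} (\<lambda>x. (g x)\<^sup>2)"
proof -
  define A B C where "A = integral {a..b} (\<lambda>x. (f x)\<^sup>2)"
    and "B = integral {a..b} (\<lambda>x. f x * g x)" and "C = integral {a..b} (\<lambda>x. (g x)\<^sup>2)"
  have "((\<lambda>x. (f x)\<^sup>2) has_integral A) {a..b}" "((\<lambda>x. f x * g x) has_integral B) {a..b}"
    "((\<lambda>x. (g x)\<^sup>2) has_integral C) {a..b}"
    unfolding A_def B_def C_def
    by (intro integrable_integral integrable_continuous_real continuous_intros f g)+
  note h = has_integral_add[OF has_integral_diff[OF this(3) has_integral_mult_right[OF this(2)]]
      has_integral_mult_right[OF this(1)]]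
  have q: "0 \<le> C - 2 * c * B + c\<^sup>2 * A" for c
  proof -
    have "((\<lambda>x. (g x - c * f x)\<^sup>2) has_integral (C - 2 * c * B + c\<^sup>2 * A)) {a..b}"
      by (rule has_integral_eq[OF _ h]) (auto simp: power2_eq_square algebra_simps)
    then show ?thesis by (rule has_integral_nonneg) auto
  qed
  have A: "A \<ge> 0" unfolding A_def by (rule integral_nonneg) (auto intro!: integrable_continuous_real continuous_intros f)
  show ?thesis
  proof (cases "A = 0")
    case True
    have "B = 0"
    proof (rule ccontr)
      assume "B \<noteq> 0"
      \<comment> \<open>For \<open>A = 0\<close> the quadratic is affine in \<open>c\<close>, and
        this \<open>c\<close> gives it the value -1.\<close>
      then show False using q[of "(C + 1) / (2 * B)"] True by simp
    qed
    then show ?thesis using True by (simp add: A_def B_def)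
  next
    case False
    then have "B\<^sup>2 \<le> A * C" using q[of "B / A"] A by (simp add: field_simps power2_eq_square)
    then show ?thesis by (simp add: A_def B_def C_def)
  qed
qed

lemma integral_periodic_shift:
  fixes f :: "real \<Rightarrow> real"
  assumes f: "continuous_on UNIV f" and per: "\<And>x. f (x + p) = f x" and a: "0 \<le> a" "a \<le> p"
  shows "integral {0..p} (\<lambda>x. f (x + a)) = integral {0..p} f"
proof -
  have c: "continuous_on S f" for S using f continuous_on_subset by blast
  have i: "f integrable_on {x..y}" for x y by (intro integrable_continuous_real c)
  have "integral {0..p} (\<lambda>x. f (x + a)) = integral {a..p + a} f"
    using integral_shift[OF c, of 0 p a] by (simp add: o_def)
  also have "\<dots> = integral {a..p} f + integral {p..p + a} f"
    using Henstock_Kurzweil_Integration.integral_combine[of a p "p + a" f] a i by simp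
  also have "integral {p..p + a} f = integral {0..a} f"
    using integral_shift[OF c, of 0 a p] by (simp add: o_def per add.commute)
  also have "integral {a..p} f + integral {0..a} f = integral {0..p} f"
    using Henstock_Kurzweil_Integration.integral_combine[of 0 a p f] a i by simp
  finally show ?thesis .
qed

lemma coeff_linear_kernel:
  "cos_coeff m (\<lambda>s. s - pi) = 0" "m \<noteq> 0 \<Longrightarrow> sin_coeff m (\<lambda>s. s - pi) = - (2 * pi) / real m"
proof -
  have s: "sin (real m * (2 * pi)) = 0" and c: "cos (real m * (2 * pi)) = 1"
    using sin_int_2pi[of "int m"] cos_int_2pi[of "int m"] by auto
  show sc: "sin_coeff m (\<lambda>s. s - pi) = - (2 * pi) / real m" if m: "m \<noteq> 0"
  proof -
    let ?G = "\<lambda>x. sin (real m * x) / (real m)\<^sup>2 - (x - pi) * cos (real m * x) / real m"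
    have "((\<lambda>x. (x - pi) * sin (real m * x)) has_integral (?G (2 * pi) - ?G 0)) {0..2 * pi}"
      using m by (intro has_integral_FTC)
        (auto intro!: derivative_eq_intros simp: field_simps power2_eq_square)
    then show ?thesis using m s c by (simp add: sin_coeff_def integral_unique field_simps)
  qed
  show "cos_coeff m (\<lambda>s. s - pi) = 0"
  proof (cases "m = 0")
    case True
    have "((\<lambda>x. x - pi) has_integral ((2 * pi)\<^sup>2 / 2 - pi * (2 * pi) - (0\<^sup>2 / 2 - pi * 0))) {0..2 * pi}"
      by (intro has_integral_FTC) (auto intro!: derivative_eq_intros)
    then show ?thesis using True by (simp add: cos_coeff_def integral_unique power2_eq_square)
  next
    case False
    let ?G = "\<lambda>x. cos (real m * x) / (real m)\<^sup>2 + (x - pi) * sin (real m * x) / real m"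
    have "((\<lambda>x. (x - pi) * cos (real m * x)) has_integral (?G (2 * pi) - ?G 0)) {0..2 * pi}"
      using False by (intro has_integral_FTC)
        (auto intro!: derivative_eq_intros simp: field_simps power2_eq_square)
    then show ?thesis using False s c by (simp add: cos_coeff_def integral_unique)
  qed
qed

definition saw_kernel :: "nat \<Rightarrow> real \<Rightarrow> real" where
  "saw_kernel N s = s - pi - fourier_sum N (\<lambda>s. s - pi) s"

lemma continuous_saw_kernel [continuous_intros]: "continuous_on S (saw_kernel N)"
  unfolding saw_kernel_def by (intro continuous_intros)

text \<open>By \<open>fourier_defect\<close> the squared norm is the number
  \<open>2 * pi ^ 3 / 3\<close> minus \<open>4 * pi\<close> times a partial sum of the inverse
  squares, and Euler's value of that series makes the limit zero. This one explicit function takes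
  the place of completeness of the trigonometric system.\<close>

lemma saw_kernel_tendsto_0:
  "(\<lambda>N. integral {0..2 * pi} (\<lambda>s. (saw_kernel N s)\<^sup>2)) \<longlonglongrightarrow> 0"
proof -
  have e: "integral {0..2 * pi} (\<lambda>s. (saw_kernel (Suc N) s)\<^sup>2) =
      2 * pi ^ 3 / 3 - 4 * pi * (\<Sum>m<N. 1 / (real m + 1)\<^sup>2)" for N
  proof -
    have 1: "integral {0..2 * pi} (\<lambda>s. (s - pi)\<^sup>2) = 2 * pi ^ 3 / 3"
    proof -
      have "((\<lambda>x. (x - pi)\<^sup>2) has_integral ((2 * pi - pi) ^ 3 / 3 - (0 - pi) ^ 3 / 3)) {0..2 * pi}"
        by (intro has_integral_FTC) (auto intro!: derivative_eq_intros)
      then show ?thesis by (simp add: integral_unique)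
    qed
    have 2: "(\<Sum>m<Suc N. coeff_weight m * ((cos_coeff m (\<lambda>s. s - pi))\<^sup>2 + (sin_coeff m (\<lambda>s. s - pi))\<^sup>2))
       = 4 * pi * (\<Sum>m<N. 1 / (real m + 1)\<^sup>2)"
      unfolding sum.lessThan_Suc_shift sum_distrib_left
      by (auto simp: coeff_linear_kernel coeff_weight_def power2_eq_square field_simps intro!: sum.cong)
    show ?thesis
      using fourier_defect[of "\<lambda>s. s - pi" "Suc N"] 1 2
      by (simp add: saw_kernel_def integral_unique continuous_intros)
  qed
  have "(\<lambda>N. 2 * pi ^ 3 / 3 - 4 * pi * (\<Sum>m<N. 1 / (real m + 1)\<^sup>2)) \<longlonglongrightarrow>
     2 * pi ^ 3 / 3 - 4 * pi * (pi\<^sup>2 / 6)"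
    using inverse_squares_sums by (intro tendsto_intros) (simp add: sums_def add.commute)
  also have "2 * pi ^ 3 / 3 - 4 * pi * (pi\<^sup>2 / 6) = 0" by (simp add: power3_eq_cube power2_eq_square)
  finally show ?thesis unfolding e[symmetric] by (rule LIMSEQ_imp_Suc)
qed

text \<open>Integration by parts against the sawtooth \<open>s - \<pi>\<close>, whose jump reproduces \<open>f\<close>.\<close>

lemma fourier_remainder:
  assumes N: "N > 0" and f: "\<And>x. (f has_real_derivative f' x) (at x)"
    and f': "continuous_on UNIV f'" and per: "\<And>x. f (x + 2 * pi) = f x"
    and \<theta>: "\<theta> \<in> {0..2 * pi}"
  shows "2 * pi * (f \<theta> - fourier_sum N f \<theta>) =
    integral {0..2 * pi} (\<lambda>s. saw_kernel N s * f' (s + \<theta>))"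
proof -
  \<comment> \<open>The Dirichlet kernel, which is the derivative of \<open>saw_kernel N\<close>.
    Its constant term 1 comes from \<open>N > 0\<close> and matches the slope of the
    sawtooth.\<close>
  define D where "D s = (\<Sum>m<N. 2 * pi * coeff_weight m * cos (real m * s))" for s
  have cf: "continuous_on S f" for S
    using f by (meson DERIV_isCont continuous_at_imp_continuous_on)
  have cf': "continuous_on S f'" for S using f' continuous_on_subset by blast
  have cD: "continuous_on S D" for S unfolding D_def by (intro continuous_intros)
  have K: "saw_kernel N s = s - pi + (\<Sum>m\<in>{..<N} - {0}. 2 / real m * sin (real m * s))" for s
  proof -
    have "fourier_sum N (\<lambda>s. s - pi) s = (\<Sum>m<N. if m = 0 then 0 else - (2 / real m * sin (real m * s)))"
      unfolding fourier_sum_def by (intro sum.cong) (auto simp: coeff_linear_kernel coeff_weight_def)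
    also have "\<dots> = - (\<Sum>m\<in>{..<N} - {0}. 2 / real m * sin (real m * s))"
      unfolding sum_negf[symmetric] by (rule sum.mono_neutral_cong_right) auto
    finally show ?thesis by (simp add: saw_kernel_def)
  qed
  have D: "D s = 1 + (\<Sum>m\<in>{..<N} - {0}. 2 * cos (real m * s))" for s
    unfolding D_def by (subst sum.remove[of _ 0]) (auto simp: N coeff_weight_def intro!: sum.cong)
  have dK: "(saw_kernel N has_real_derivative D s) (at s)" for s
    unfolding K[abs_def] D by (auto intro!: derivative_eq_intros sum.cong)
  have df: "((\<lambda>s. f (s + \<theta>)) has_real_derivative f' (s + \<theta>)) (at s)" for s
    using f[of "s + \<theta>"] by (simp add: DERIV_shift)
  have "((\<lambda>s. D s * f (s + \<theta>) + saw_kernel N s * f' (s + \<theta>)) has_integral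
      (saw_kernel N (2 * pi) * f (2 * pi + \<theta>) - saw_kernel N 0 * f (0 + \<theta>))) {0..2 * pi}"
    by (intro has_integral_FTC)
       (auto intro!: derivative_eq_intros DERIV_subset[OF dK] DERIV_subset[OF df])
  moreover have "saw_kernel N (2 * pi) = pi" "saw_kernel N 0 = - pi"
    using sin_int_2pi[of "int _"] by (auto simp: K)
  ultimately have "((\<lambda>s. D s * f (s + \<theta>) + saw_kernel N s * f' (s + \<theta>)) has_integral 2 * pi * f \<theta>) {0..2 * pi}"
    using per[of \<theta>] by (simp add: add.commute mult.assoc)
  moreover have iD: "(\<lambda>s. D s * f (s + \<theta>)) integrable_on {0..2 * pi}"
    by (intro integrable_continuous_real continuous_intros cD continuous_on_compose2[OF cf[of UNIV]]) auto
  ultimately have 1: "integral {0..2 * pi} (\<lambda>s. saw_kernel N s * f' (s + \<theta>)) =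
      2 * pi * f \<theta> - integral {0..2 * pi} (\<lambda>s. D s * f (s + \<theta>))"
    using has_integral_diff[OF _ integrable_integral[OF iD]] by (fastforce simp: integral_unique)
  have perD: "D (s + 2 * pi) = D s" for s
    unfolding D_def using sin_int_2pi[of "int _"] cos_int_2pi[of "int _"]
    by (auto simp: distrib_left cos_add intro!: sum.cong)
  have "integral {0..2 * pi} (\<lambda>s. D s * f (s + \<theta>)) = integral {0..2 * pi} (\<lambda>s. D (s - \<theta>) * f s)"
    using integral_periodic_shift[of "\<lambda>s. D (s - \<theta>) * f s" "2 * pi" \<theta>] \<theta> perD[of "_ - \<theta>"] per
    by (simp add: continuous_intros cf continuous_on_compose2[OF cD[of UNIV]] algebra_simps)
  also have "\<dots> = 2 * pi * fourier_sum N f \<theta>"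
  proof -
    have "((\<lambda>s. \<Sum>m<N. 2 * pi * coeff_weight m * (cos (real m * \<theta>) * (f s * cos (real m * s)) +
        sin (real m * \<theta>) * (f s * sin (real m * s)))) has_integral
       (\<Sum>m<N. 2 * pi * coeff_weight m * (cos (real m * \<theta>) * cos_coeff m f + sin (real m * \<theta>) * sin_coeff m f)))
       {0..2 * pi}"
      by (intro has_integral_sum has_integral_mult_right has_integral_add has_integral_cos_coeff
          has_integral_sin_coeff cf) auto
    moreover have "(\<Sum>m<N. 2 * pi * coeff_weight m * (cos (real m * \<theta>) * (f s * cos (real m * s)) +
        sin (real m * \<theta>) * (f s * sin (real m * s)))) = D (s - \<theta>) * f s" for s
      unfolding D_def sum_distrib_right
      by (intro sum.cong) (auto simp: right_diff_distrib cos_diff algebra_simps)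
    ultimately have "integral {0..2 * pi} (\<lambda>s. D (s - \<theta>) * f s) =
      (\<Sum>m<N. 2 * pi * coeff_weight m * (cos (real m * \<theta>) * cos_coeff m f + sin (real m * \<theta>) * sin_coeff m f))"
      by (simp add: integral_unique)
    then show ?thesis by (simp add: fourier_sum_def sum_distrib_left algebra_simps)
  qed
  finally show ?thesis using 1 by (simp add: algebra_simps)
qed

text \<open>Cauchy--Schwarz in the remainder formula bounds the squared remainder pointwise with the
  factor \<open>1 / (2 * pi)\<^sup>2\<close>; integrating over a period cancels one
  \<open>2 * pi\<close>.\<close>

definition fourier_tail :: "nat \<Rightarrow> real" where
  "fourier_tail N = integral {0..2 * pi} (\<lambda>s. (saw_kernel N s)\<^sup>2) / (2 * pi)"

lemma fourier_tail_tendsto_0: "fourier_tail \<longlonglongrightarrow> 0"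
  using tendsto_divide[OF saw_kernel_tendsto_0 tendsto_const, of "2 * pi"]
  by (simp add: fourier_tail_def[abs_def])

text \<open>Serves the terms that enter the second variation with a negative sign, where Bessel
  points the wrong way. The error depends on \<open>f\<close> only through the norm of
  \<open>f'\<close>, so it is controlled on all slices of the strip at once.\<close>

lemma parseval_upper:
  assumes N: "N > 0" and f: "\<And>x. (f has_real_derivative f' x) (at x)"
    and f': "continuous_on UNIV f'" and per: "\<And>x. f (x + 2 * pi) = f x"
  shows "integral {0..2 * pi} (\<lambda>x. (f x)\<^sup>2) \<le>
    (\<Sum>m<N. coeff_weight m * ((cos_coeff m f)\<^sup>2 + (sin_coeff m f)\<^sup>2)) +
    fourier_tail N * integral {0..2 * pi} (\<lambda>x. (f' x)\<^sup>2)"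
proof -
  define A where "A = integral {0..2 * pi} (\<lambda>s. (saw_kernel N s)\<^sup>2)"
  define B where "B = integral {0..2 * pi} (\<lambda>x. (f' x)\<^sup>2)"
  have cf: "continuous_on S f" for S
    using f by (meson DERIV_isCont continuous_at_imp_continuous_on)
  have cf': "continuous_on S f'" for S using f' continuous_on_subset by blast
  have per': "f' (x + 2 * pi) = f' x" for x
  proof (rule DERIV_unique)
    show "(f has_real_derivative f' x) (at x)" by (rule f)
    have "((\<lambda>x. f (x + 2 * pi)) has_real_derivative f' (x + 2 * pi)) (at x)"
      using f[of "x + 2 * pi"] by (simp add: DERIV_shift)
    then show "(f has_real_derivative f' (x + 2 * pi)) (at x)" by (simp add: per)
  qed
  have bd: "(f \<theta> - fourier_sum N f \<theta>)\<^sup>2 \<le> A * B / (2 * pi)\<^sup>2" if \<theta>: "\<theta> \<in> {0..2 * pi}" for \<theta>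
  proof -
    have "(2 * pi * (f \<theta> - fourier_sum N f \<theta>))\<^sup>2 \<le> A * integral {0..2 * pi} (\<lambda>s. (f' (s + \<theta>))\<^sup>2)"
      unfolding A_def fourier_remainder[OF N f f' per \<theta>]
      by (intro integral_Cauchy_Schwarz continuous_intros continuous_on_compose2[OF cf'[of UNIV]]) auto
    also have "integral {0..2 * pi} (\<lambda>s. (f' (s + \<theta>))\<^sup>2) = B"
      unfolding B_def using \<theta> per'
      by (intro integral_periodic_shift[of "\<lambda>s. (f' s)\<^sup>2"]) (auto intro!: continuous_intros cf')
    finally show ?thesis
      unfolding power_mult_distrib[of "2 * pi"] by (simp add: pos_le_divide_eq mult.commute)
  qed
  have "integral {0..2 * pi} (\<lambda>\<theta>. (f \<theta> - fourier_sum N f \<theta>)\<^sup>2) \<le> integral {0..2 * pi} (\<lambda>\<theta>. A * B / (2 * pi)\<^sup>2)"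
    using bd by (intro integral_le integrable_continuous_real continuous_intros cf) auto
  also have "\<dots> = fourier_tail N * B"
    by (simp add: fourier_tail_def A_def power2_eq_square)
  finally show ?thesis
    using integral_unique[OF fourier_defect[OF cf, of N]] by (simp add: B_def)
qed

section \<open>A single Fourier mode\<close>

text \<open>In the frame rotating with the circle action, the field with components
  \<open>x1 cos m\<theta> + i x2 sin m\<theta>\<close> and \<open>y1 cos m\<theta> + i y2 sin m\<theta>\<close> has this energy density, up to
  the factor coming from averaging over \<open>\<theta>\<close>.\<close>

definition mode_dens ::
  "real \<Rightarrow> real \<Rightarrow> real \<Rightarrow> real \<Rightarrow> real \<Rightarrow> real \<Rightarrow> real \<Rightarrow> real \<Rightarrow> real \<Rightarrow> real \<Rightarrow> real \<Rightarrow> real" where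
  "mode_dens L K m x1 x2 y1 y2 x1' x2' y1' y2' =
     x1'\<^sup>2 + x2'\<^sup>2 + y1'\<^sup>2 + y2'\<^sup>2 + (m * x1 + L * x2)\<^sup>2 + (m * x2 + L * x1)\<^sup>2
     + (m * y1 + K * y2)\<^sup>2 + (m * y2 + K * y1)\<^sup>2"

text \<open>Undoing the rotation, \<open>x1 cos m\<theta> + i x2 sin m\<theta>\<close> times
  \<open>exp (i L \<theta>)\<close> has amplitude \<open>(x1 + x2) / 2\<close> at the frequency
  \<open>L + m\<close> and \<open>(x1 - x2) / 2\<close> at \<open>L - m\<close>; likewise for
  \<open>K\<close>. The energy is diagonal in these amplitudes.\<close>

lemma mode_dens_split:
  "mode_dens L K m x1 x2 y1 y2 x1' x2' y1' y2' =
    (((x1' + x2')\<^sup>2 + (L + m)\<^sup>2 * (x1 + x2)\<^sup>2) + ((x1' - x2')\<^sup>2 + (L - m)\<^sup>2 * (x1 - x2)\<^sup>2)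
   + ((y1' + y2')\<^sup>2 + (K + m)\<^sup>2 * (y1 + y2)\<^sup>2) + ((y1' - y2')\<^sup>2 + (K - m)\<^sup>2 * (y1 - y2)\<^sup>2)) / 2"
  by (simp add: mode_dens_def power2_eq_square algebra_simps)

text \<open>Pointwise core of the comparison of area and energy. Here \<open>a\<close>,
  \<open>b\<close>, \<open>c\<close>, \<open>d\<close> stand for \<open>cosh (L * t)\<close>,
  \<open>sinh (L * t)\<close>, \<open>cosh (K * t)\<close>, \<open>sinh (K * t)\<close>; up to a
  common factor, \<open>(a, d)\<close> is the \<open>t\<close>-derivative of the immersion,
  \<open>(b, c)\<close> its \<open>\<theta>\<close>-derivative, and \<open>p\<close>,
  \<open>q\<close> are the products of X with its derivatives of type \<open>tt\<close> and
  \<open>t\<theta>\<close>. The field is corrected by \<open>f\<close> and \<open>s\<close> along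
  the two tangent directions. The last bracket is a total \<open>t\<close>-derivative, so energy and
  area differ only by a boundary flux.\<close>

lemma mode_flux_identity:
  fixes a b c d :: real
  assumes M: "M = a\<^sup>2 + d\<^sup>2" "M = b\<^sup>2 + c\<^sup>2"
    and p: "p = L * x1 * b + K * y1 * c" and q: "q = L * x2 * a + K * y2 * d"
    and n: "x1 * a + y1 * d = 0" "x2 * b + y2 * c = 0"
    and n': "x1' * a + y1' * d = - p" "x2' * b + y2' * c = - q"
    and F: "F * M = 2 * p" and G: "G * M = 2 * q"
    and f': "f' = m * s + F" and s': "s' = m * f + G"
    and \<kappa>: "\<kappa> = L * a * b + K * c * d"
  shows "mode_dens L K m (x1 + f * a) (x2 + s * b) (y1 + f * d) (y2 + s * c)
      (x1' + (f' * a + f * (L * b))) (x2' + (s' * b + s * (L * a)))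
      (y1' + (f' * d + f * (K * c))) (y2' + (s' * c + s * (K * d))) =
    mode_dens L K m x1 x2 y1 y2 x1' x2' y1' y2' - M * (F\<^sup>2 + G\<^sup>2) +
    (2 * (f' * p + f * (L * x1' * b + K * y1' * c + L\<^sup>2 * x1 * a + K\<^sup>2 * y1 * d) +
          s' * q + s * (L * x2' * a + K * y2' * d + L\<^sup>2 * x2 * b + K\<^sup>2 * y2 * c))
     + (L\<^sup>2 * (a\<^sup>2 + b\<^sup>2) + K\<^sup>2 * (c\<^sup>2 + d\<^sup>2)) * (f\<^sup>2 + s\<^sup>2) + 2 * \<kappa> * (f * f' + s * s')
     + 2 * m * (2 * \<kappa> * f * s + M * f' * s + M * f * s'))"
proof -
  have "mode_dens L K m (x1 + f * a) (x2 + s * b) (y1 + f * d) (y2 + s * c)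
      (x1' + (f' * a + f * (L * b))) (x2' + (s' * b + s * (L * a)))
      (y1' + (f' * d + f * (K * c))) (y2' + (s' * c + s * (K * d))) =
    mode_dens L K m x1 x2 y1 y2 x1' x2' y1' y2' +
    2 * (f' * (x1' * a + y1' * d) + s' * (x2' * b + y2' * c) + m\<^sup>2 * f * (x1 * a + y1 * d)
      + m\<^sup>2 * s * (x2 * b + y2 * c) + f * (L * x1' * b + K * y1' * c + L\<^sup>2 * x1 * a + K\<^sup>2 * y1 * d)
      + s * (L * x2' * a + K * y2' * d + L\<^sup>2 * x2 * b + K\<^sup>2 * y2 * c)
      + 2 * m * (s * (L * x1 * b + K * y1 * c) + f * (L * x2 * a + K * y2 * d)))
    + ((a\<^sup>2 + d\<^sup>2) * (f'\<^sup>2 + m\<^sup>2 * f\<^sup>2) + (b\<^sup>2 + c\<^sup>2) * (s'\<^sup>2 + m\<^sup>2 * s\<^sup>2)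
      + (L\<^sup>2 * (a\<^sup>2 + b\<^sup>2) + K\<^sup>2 * (c\<^sup>2 + d\<^sup>2)) * (f\<^sup>2 + s\<^sup>2)
      + 2 * (L * a * b + K * c * d) * (f * f' + s * s') + 4 * m * (L * a * b + K * c * d) * f * s)"
    unfolding mode_dens_def by (simp add: power2_eq_square algebra_simps)
  also have "\<dots> = mode_dens L K m x1 x2 y1 y2 x1' x2' y1' y2' +
    2 * (- f' * p - s' * q + f * (L * x1' * b + K * y1' * c + L\<^sup>2 * x1 * a + K\<^sup>2 * y1 * d)
      + s * (L * x2' * a + K * y2' * d + L\<^sup>2 * x2 * b + K\<^sup>2 * y2 * c) + 2 * m * (s * p + f * q))
    + (M * (f'\<^sup>2 + m\<^sup>2 * f\<^sup>2) + M * (s'\<^sup>2 + m\<^sup>2 * s\<^sup>2)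
      + (L\<^sup>2 * (a\<^sup>2 + b\<^sup>2) + K\<^sup>2 * (c\<^sup>2 + d\<^sup>2)) * (f\<^sup>2 + s\<^sup>2)
      + 2 * \<kappa> * (f * f' + s * s') + 4 * m * \<kappa> * f * s)"
    unfolding n n' M(1)[symmetric] M(2)[symmetric] p[symmetric] q[symmetric] \<kappa>[symmetric] by simp
  \<comment> \<open>The Cauchy--Riemann equations remove \<open>m\<close>:
    \<open>m * s = f' - F\<close> gives \<open>f'\<^sup>2 + m\<^sup>2 * s\<^sup>2 = F\<^sup>2 + 2 *
    m * s * f'\<close>, and similarly for \<open>G\<close>. With \<open>2 * p = F * M\<close> and
    \<open>2 * q = G * M\<close> the source terms then add up to
    \<open>- M * (F\<^sup>2 + G\<^sup>2)\<close>.\<close>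
  also have "\<dots> = mode_dens L K m x1 x2 y1 y2 x1' x2' y1' y2' - 2 * ((2 * p) * F + (2 * q) * G) + M * (F\<^sup>2 + G\<^sup>2) +
    (2 * (f' * p + f * (L * x1' * b + K * y1' * c + L\<^sup>2 * x1 * a + K\<^sup>2 * y1 * d) +
          s' * q + s * (L * x2' * a + K * y2' * d + L\<^sup>2 * x2 * b + K\<^sup>2 * y2 * c))
     + (L\<^sup>2 * (a\<^sup>2 + b\<^sup>2) + K\<^sup>2 * (c\<^sup>2 + d\<^sup>2)) * (f\<^sup>2 + s\<^sup>2) + 2 * \<kappa> * (f * f' + s * s')
     + 2 * m * (2 * \<kappa> * f * s + M * f' * s + M * f * s'))"
    unfolding f' s' by (simp add: power2_eq_square algebra_simps)
  finally show ?thesis unfolding F[symmetric] G[symmetric] by (simp add: power2_eq_square algebra_simps)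
qed

text \<open>\<open>Even1p\<close> and \<open>Even1m\<close> say that the even part in \<open>t\<close> of the first complex component of \<open>V\<close>
  vanishes on the boundary in the frequencies \<open>l + m\<close> and \<open>l - m\<close>, \<open>Even2m\<close> that of the second component in the frequency \<open>k - m\<close>,
  and \<open>Odd1m\<close>, \<open>Odd2m\<close> the odd parts; \<open>Solv\<close> is the solvability condition of the Cauchy--Riemann
  system in the mode \<open>m = 0\<close>.\<close>

datatype mode_cond = Solv | Even1p | Even1m | Even2m | Odd1m | Odd2m

text \<open>The two equations, cleared of denominators, say that \<open>h\<close> is both the even
  Steklov eigenvalue of frequency \<open>K\<close> and the odd one of frequency \<open>L\<close>.
  Integrality of the frequencies is kept out, since the analysis of a single mode is insensitive to
  it.\<close>

locale fs_data =
  fixes L K T h :: real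
  assumes L_pos: "0 < L" and L_less_K: "L < K" and T_pos: "0 < T"
    and hL: "L * cosh (L * T) = h * sinh (L * T)" and hK: "K * sinh (K * T) = h * cosh (K * T)"
begin

section \<open>The Steklov inequality on a single frequency of the cylinder\<close>

lemma K_pos: "0 < K" using L_pos L_less_K by simp

lemma hyp_pos: "sinh (L * T) > 0" "sinh (K * T) > 0"
  using L_pos K_pos T_pos by simp_all

lemma h_pos: "h > 0"
proof -
  have "0 < h * cosh (K * T)" unfolding hK[symmetric] using K_pos hyp_pos by simp
  then show ?thesis using cosh_real_pos zero_less_mult_pos2 by blast
qed

text \<open>The solution \<open>w\<close> of \<open>w'' = c\<^sup>2 * w\<close> with the boundary
  values of \<open>v\<close> minimises the integral, and its even and odd parts contribute
  separately.\<close>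

lemma harmonic_lower:
  fixes v v' :: "real \<Rightarrow> real"
  assumes c: "c > 0"
    and dv: "\<And>t. t \<in> {-T..T} \<Longrightarrow> (v has_real_derivative v' t) (at t within {-T..T})"
    and cv': "continuous_on {-T..T} v'"
  shows "2 * c * (((v T + v (-T)) / 2)\<^sup>2 * sinh (c * T) / cosh (c * T)
      + ((v T - v (-T)) / 2)\<^sup>2 * cosh (c * T) / sinh (c * T))
    \<le> integral {-T..T} (\<lambda>t. (v' t)\<^sup>2 + c\<^sup>2 * (v t)\<^sup>2)"
proof -
  define A B where "A = (v T + v (-T)) / 2" and "B = (v T - v (-T)) / 2"
  define \<alpha> \<beta> where "\<alpha> = A / cosh (c * T)" and "\<beta> = B / sinh (c * T)"
  have pos: "cosh (c * T) > 0" "sinh (c * T) > 0" using c T_pos by auto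
  define w where "w t = \<alpha> * cosh (c * t) + \<beta> * sinh (c * t)" for t
  define w' where "w' t = c * (\<alpha> * sinh (c * t) + \<beta> * cosh (c * t))" for t
  have dw: "(w has_real_derivative w' t) (at t within S)" for t S
    unfolding w_def[abs_def] w'_def by (auto intro!: derivative_eq_intros simp: algebra_simps)
  have dw': "(w' has_real_derivative c\<^sup>2 * w t) (at t within S)" for t S
    unfolding w_def w'_def[abs_def] by (auto intro!: derivative_eq_intros simp: algebra_simps power2_eq_square)
  have cv: "continuous_on {-T..T} v" using dv by (rule DERIV_continuous_on)
  have vT: "v T = A + B" "v (-T) = A - B" by (auto simp: A_def B_def field_simps)
  have wT: "w T = A + B" "w (-T) = A - B"
    using pos by (auto simp: w_def \<alpha>_def \<beta>_def)
  \<comment> \<open>Twice the cross term minus the energy density of \<open>w\<close> is the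
    derivative of \<open>(2 * v - w) * w'\<close>. Only \<open>w\<close> is differentiated twice, so
    \<open>v\<close> may be merely C1.\<close>
  have "((\<lambda>t. 2 * (v' t * w' t + v t * (c\<^sup>2 * w t)) - (w' t * w' t + w t * (c\<^sup>2 * w t))) has_integral
     ((2 * v T - w T) * w' T - (2 * v (-T) - w (-T)) * w' (-T))) {-T..T}"
    using T_pos by (intro has_integral_FTC) (auto intro!: derivative_eq_intros dv dw dw' simp: algebra_simps)
  then have "(2 * v T - w T) * w' T - (2 * v (-T) - w (-T)) * w' (-T) \<le>
      integral {-T..T} (\<lambda>t. (v' t)\<^sup>2 + c\<^sup>2 * (v t)\<^sup>2)"
  proof (rule has_integral_le[OF _ integrable_integral])
    show "(\<lambda>t. (v' t)\<^sup>2 + c\<^sup>2 * (v t)\<^sup>2) integrable_on {-T..T}"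
      by (intro integrable_continuous_real continuous_intros cv cv')
    fix t
    have "0 \<le> (v' t - w' t)\<^sup>2 + c\<^sup>2 * (v t - w t)\<^sup>2" by simp
    then show "2 * (v' t * w' t + v t * (c\<^sup>2 * w t)) - (w' t * w' t + w t * (c\<^sup>2 * w t))
        \<le> (v' t)\<^sup>2 + c\<^sup>2 * (v t)\<^sup>2"
      by (simp add: power2_eq_square algebra_simps)
  qed
  moreover have "(2 * v T - w T) * w' T - (2 * v (-T) - w (-T)) * w' (-T) =
      2 * c * (A\<^sup>2 * sinh (c * T) / cosh (c * T) + B\<^sup>2 * cosh (c * T) / sinh (c * T))"
    unfolding vT wT by (simp add: w'_def \<alpha>_def \<beta>_def power2_eq_square algebra_simps add_divide_distrib diff_divide_distrib)
  ultimately show ?thesis by (simp add: A_def B_def)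
qed

text \<open>Below its threshold the even or odd part vanishes on the boundary by assumption;
  otherwise \<open>|n|\<close> may be lowered to \<open>K\<close> or \<open>L\<close>, which only
  decreases the integral and makes \<open>harmonic_lower\<close> produce exactly
  \<open>h\<close>.\<close>

lemma steklov_1d:
  fixes v v' :: "real \<Rightarrow> real"
  assumes dv: "\<And>t. t \<in> {-T..T} \<Longrightarrow> (v has_real_derivative v' t) (at t within {-T..T})"
    and cv': "continuous_on {-T..T} v'"
    and even: "\<bar>n\<bar> < K \<Longrightarrow> v T + v (-T) = 0" and odd: "\<bar>n\<bar> < L \<Longrightarrow> v T - v (-T) = 0"
  shows "h * ((v T)\<^sup>2 + (v (-T))\<^sup>2) \<le> integral {-T..T} (\<lambda>t. (v' t)\<^sup>2 + n\<^sup>2 * (v t)\<^sup>2)"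
proof -
  have cv: "continuous_on {-T..T} v" using dv by (rule DERIV_continuous_on)
  have i: "(\<lambda>t. (v' t)\<^sup>2 + c * (v t)\<^sup>2) integrable_on {-T..T}" for c
    by (intro integrable_continuous_real continuous_intros cv cv')
  have mono: "integral {-T..T} (\<lambda>t. (v' t)\<^sup>2 + c\<^sup>2 * (v t)\<^sup>2) \<le>
      integral {-T..T} (\<lambda>t. (v' t)\<^sup>2 + n\<^sup>2 * (v t)\<^sup>2)" if "0 < c" "c \<le> \<bar>n\<bar>" for c
  proof (intro integral_le i)
    have "c\<^sup>2 \<le> n\<^sup>2" using that by (simp add: abs_le_square_iff[symmetric])
    then show "(v' t)\<^sup>2 + c\<^sup>2 * (v t)\<^sup>2 \<le> (v' t)\<^sup>2 + n\<^sup>2 * (v t)\<^sup>2" for t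
      by (simp add: mult_right_mono)
  qed
  define A B where "A = (v T + v (-T)) / 2" and "B = (v T - v (-T)) / 2"
  have e: "h * ((v T)\<^sup>2 + (v (-T))\<^sup>2) = 2 * (A\<^sup>2 * h + B\<^sup>2 * h)"
    by (simp add: A_def B_def power2_eq_square field_simps)
  consider "K \<le> \<bar>n\<bar>" | "L \<le> \<bar>n\<bar>" "\<bar>n\<bar> < K" | "\<bar>n\<bar> < L" by linarith
  then show ?thesis
  proof cases
    \<comment> \<open>At frequency \<open>K\<close> the even part gives \<open>h\<close> itself, and
      the odd part gives more because tanh is at most coth.\<close>
    case 1
    have hK': "h = K * sinh (K * T) / cosh (K * T)"
      using hK cosh_real_nonzero[of "K * T"] by (simp add: field_simps)
    have "(sinh (K * T))\<^sup>2 \<le> (cosh (K * T))\<^sup>2" by (simp add: cosh_square_eq)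
    then have "h \<le> K * cosh (K * T) / sinh (K * T)"
      unfolding hK' using hyp_pos K_pos by (simp add: field_simps power2_eq_square)
    then have "B\<^sup>2 * h \<le> B\<^sup>2 * (K * cosh (K * T) / sinh (K * T))" by (intro mult_left_mono) auto
    then have "2 * (A\<^sup>2 * h + B\<^sup>2 * h) \<le> 2 * (A\<^sup>2 * (K * sinh (K * T) / cosh (K * T)) + B\<^sup>2 * (K * cosh (K * T) / sinh (K * T)))"
      unfolding hK'[symmetric] by (rule mult_left_mono[OF add_left_mono]) simp
    also have "\<dots> \<le> integral {-T..T} (\<lambda>t. (v' t)\<^sup>2 + K\<^sup>2 * (v t)\<^sup>2)"
      using harmonic_lower[OF K_pos dv cv'] by (simp add: A_def B_def algebra_simps)
    finally show ?thesis using mono[OF K_pos 1] e by simp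
  next
    case 2
    have hL': "h = L * cosh (L * T) / sinh (L * T)"
      using hL hyp_pos(1) by (metis less_irrefl nonzero_mult_div_cancel_right)
    have "A = 0" using even 2 by (simp add: A_def)
    then have "2 * (A\<^sup>2 * h + B\<^sup>2 * h) = 2 * L * (A\<^sup>2 * sinh (L * T) / cosh (L * T) + B\<^sup>2 * cosh (L * T) / sinh (L * T))"
      by (simp add: hL')
    also have "\<dots> \<le> integral {-T..T} (\<lambda>t. (v' t)\<^sup>2 + L\<^sup>2 * (v t)\<^sup>2)"
      using harmonic_lower[OF L_pos dv cv'] by (simp add: A_def B_def)
    finally show ?thesis using mono[OF L_pos 2(1)] e by simp
  next
    case 3
    then have "A = 0" "B = 0" using even odd L_less_K by (auto simp: A_def B_def)
    moreover have "0 \<le> integral {-T..T} (\<lambda>t. (v' t)\<^sup>2 + n\<^sup>2 * (v t)\<^sup>2)"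
      by (intro integral_nonneg i) auto
    ultimately show ?thesis unfolding e by simp
  qed
qed

section \<open>The conformal correction and the second variation in one mode\<close>

definition mu2 :: "real \<Rightarrow> real" where
  "mu2 t = (cosh (L * t))\<^sup>2 + (sinh (K * t))\<^sup>2"

text \<open>Conformality of the immersion: up to a common constant, \<open>mu2_def\<close> is the
  squared length of its \<open>t\<close>-derivative and this expression that of its
  \<open>\<theta>\<close>-derivative.\<close>

lemma mu2_alt: "mu2 t = (sinh (L * t))\<^sup>2 + (cosh (K * t))\<^sup>2"
  by (simp add: mu2_def cosh_square_eq)

lemma mu2_pos: "mu2 t > 0"
  unfolding mu2_def by (intro add_pos_nonneg) auto

lemma mu2_nz [simp]: "mu2 t \<noteq> 0" using mu2_pos[of t] by simp

lemma continuous_mu2 [continuous_intros]: "continuous_on S mu2"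
  unfolding mu2_def[abs_def] by (intro continuous_intros)

text \<open>Source of the Cauchy--Riemann system. Conformality of X plus a tangent field asks the
  tangent coefficients to compensate the failure of X, which by normality is twice the product of X
  with the second derivative of type \<open>tt\<close>, here divided by the conformal factor;
  \<open>srcG\<close> is the same for type \<open>t\<theta>\<close>.\<close>

definition srcF :: "(real \<Rightarrow> real) \<Rightarrow> (real \<Rightarrow> real) \<Rightarrow> real \<Rightarrow> real" where
  "srcF x1 y1 t = 2 * (L * x1 t * sinh (L * t) + K * y1 t * cosh (K * t)) / mu2 t"

definition srcG :: "(real \<Rightarrow> real) \<Rightarrow> (real \<Rightarrow> real) \<Rightarrow> real \<Rightarrow> real" where
  "srcG x2 y2 t = 2 * (L * x2 t * cosh (L * t) + K * y2 t * sinh (K * t)) / mu2 t"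

lemma continuous_src:
  "continuous_on S x1 \<Longrightarrow> continuous_on S y1 \<Longrightarrow> continuous_on S (srcF x1 y1)"
  "continuous_on S x2 \<Longrightarrow> continuous_on S y2 \<Longrightarrow> continuous_on S (srcG x2 y2)"
  unfolding srcF_def[abs_def] srcG_def[abs_def] by (auto intro!: continuous_intros)

text \<open>The integrals in the variation of constants formulas for \<open>\<phi> + \<psi>\<close>
  and \<open>\<phi> - \<psi>\<close>. The boundary values of the correction depend on the sources
  only through these two numbers.\<close>

definition moment_p :: "real \<Rightarrow> (real \<Rightarrow> real) \<Rightarrow> (real \<Rightarrow> real) \<Rightarrow> real" where
  "moment_p m F G = integral {-T..T} (\<lambda>t. exp (- m * t) * (F t + G t))"

definition moment_m :: "real \<Rightarrow> (real \<Rightarrow> real) \<Rightarrow> (real \<Rightarrow> real) \<Rightarrow> real" where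
  "moment_m m F G = integral {-T..T} (\<lambda>t. exp (m * t) * (F t - G t))"

text \<open>For \<open>m = 0\<close> the denominator vanishes and the constant is \<open>0\<close>, which is an
  admissible choice.\<close>

definition cr_const :: "real \<Rightarrow> real \<Rightarrow> real \<Rightarrow> real" where
  "cr_const m I J = - (exp (m * T) * I + exp (- m * T) * J) / (exp (m * T) - exp (- 3 * m * T))"

definition psi_left :: "real \<Rightarrow> real \<Rightarrow> real \<Rightarrow> real" where
  "psi_left m I J = exp (- m * T) * cr_const m I J"

definition psi_right :: "real \<Rightarrow> real \<Rightarrow> real \<Rightarrow> real" where
  "psi_right m I J = exp (m * T) * (cr_const m I J + I)"

text \<open>The tangential correction: a Cauchy--Riemann system, diagonalised by \<open>\<phi> \<plusminus> \<psi>\<close>.\<close>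

lemma cauchy_riemann_mode:
  assumes F: "continuous_on {-T..T} F" and G: "continuous_on {-T..T} G" and m: "0 \<le> m"
    and I: "I = moment_p m F G" and J: "J = moment_m m F G"
    and solv: "m = 0 \<Longrightarrow> I + J = 0"
  obtains \<phi> \<psi> where
    "\<And>t. t \<in> {-T..T} \<Longrightarrow> (\<phi> has_real_derivative (m * \<psi> t + F t)) (at t within {-T..T})"
    "\<And>t. t \<in> {-T..T} \<Longrightarrow> (\<psi> has_real_derivative (m * \<phi> t + G t)) (at t within {-T..T})"
    "\<phi> T = 0" "\<phi> (-T) = 0" "\<psi> T = psi_right m I J" "\<psi> (-T) = psi_left m I J"
proof -
  \<comment> \<open>\<open>\<alpha>\<close> and \<open>\<beta>\<close> are
    \<open>\<phi> + \<psi>\<close> and \<open>\<phi> - \<psi>\<close>. The factor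
    \<open>- exp (- 2 * m * T)\<close> in \<open>\<beta>\<close> makes \<open>\<phi>\<close> vanish
    at \<open>-T\<close>, and the value of \<open>C\<close> is the requirement
    \<open>\<phi> T = 0\<close> solved for it. For \<open>m = 0\<close> that requirement no longer
    contains \<open>C\<close> and becomes \<open>I + J = 0\<close>.\<close>
  define C where "C = cr_const m I J"
  define \<alpha> where "\<alpha> t = exp (m * t) * (C + integral {-T..t} (\<lambda>t. exp (- m * t) * (F t + G t)))" for t
  define \<beta> where "\<beta> t = exp (- m * t) * (- exp (- 2 * m * T) * C + integral {-T..t} (\<lambda>t. exp (m * t) * (F t - G t)))" for t
  have d\<alpha>: "(\<alpha> has_real_derivative (m * \<alpha> t + (F t + G t))) (at t within {-T..T})" if t: "t \<in> {-T..T}" for t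
  proof -
    have "((\<lambda>t. integral {-T..t} (\<lambda>t. exp (- m * t) * (F t + G t))) has_real_derivative
        exp (- m * t) * (F t + G t)) (at t within {-T..T})"
      by (rule integral_has_real_derivative[OF _ t]) (intro continuous_intros F G)
    then show ?thesis unfolding \<alpha>_def[abs_def]
      by (auto intro!: derivative_eq_intros simp: algebra_simps exp_minus)
  qed
  have d\<beta>: "(\<beta> has_real_derivative (- m * \<beta> t + (F t - G t))) (at t within {-T..T})" if t: "t \<in> {-T..T}" for t
  proof -
    have "((\<lambda>t. integral {-T..t} (\<lambda>t. exp (m * t) * (F t - G t))) has_real_derivative
        exp (m * t) * (F t - G t)) (at t within {-T..T})"
      by (rule integral_has_real_derivative[OF _ t]) (intro continuous_intros F G)
    then show ?thesis unfolding \<beta>_def[abs_def]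
      by (auto intro!: derivative_eq_intros simp: algebra_simps exp_minus)
  qed
  have \<alpha>T: "\<alpha> (-T) = psi_left m I J" "\<alpha> T = psi_right m I J"
    by (auto simp: \<alpha>_def psi_left_def psi_right_def C_def I moment_p_def)
  have "\<beta> (-T) = exp (m * T + - 2 * m * T) * - C"
    unfolding exp_add by (simp add: \<beta>_def)
  then have l: "\<beta> (-T) = - \<alpha> (-T)" by (simp add: \<alpha>_def)
  have r: "\<beta> T = - \<alpha> T"
  proof -
    define E where "E = exp (m * T)"
    define e where "e = exp (- m * T)"
    have e: "exp (- 2 * m * T) = e\<^sup>2" "exp (- 3 * m * T) = e ^ 3"
      unfolding e_def using exp_of_nat_mult[of 2 "- m * T"] exp_of_nat_mult[of 3 "- m * T"]
      by (simp_all add: algebra_simps)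
    have \<beta>T: "\<beta> T = e * (- (e\<^sup>2) * C + J)"
      unfolding \<beta>_def J moment_m_def e e_def by simp
    have \<alpha>TE: "\<alpha> T = E * (C + I)" by (simp add: \<alpha>T psi_right_def C_def E_def)
    show ?thesis
    proof (cases "m = 0")
      case True
      then have "C = 0" "E = 1" "e = 1" by (auto simp: C_def cr_const_def E_def e_def)
      then show ?thesis using solv True by (simp add: \<beta>T \<alpha>TE)
    next
      case False
      then have "E > 1" "e < 1" "0 < e" using m T_pos by (simp_all add: E_def e_def)
      then have nz: "E - e ^ 3 \<noteq> 0" using power_le_one[of e 3] by simp
      have "C = - (E * I + e * J) / (E - e ^ 3)"
        unfolding C_def cr_const_def e(2) E_def e_def by (rule refl)
      then have "C * (E - e ^ 3) = - (E * I + e * J)" using nz by simp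
      then show ?thesis unfolding \<beta>T \<alpha>TE by (simp add: algebra_simps power2_eq_square power3_eq_cube)
    qed
  qed
  show ?thesis
  proof (rule that[of "\<lambda>t. (\<alpha> t + \<beta> t) / 2" "\<lambda>t. (\<alpha> t - \<beta> t) / 2"])
    fix t assume t: "t \<in> {-T..T}"
    show "((\<lambda>t. (\<alpha> t + \<beta> t) / 2) has_real_derivative (m * ((\<alpha> t - \<beta> t) / 2) + F t)) (at t within {-T..T})"
      by (auto intro!: derivative_eq_intros d\<alpha>[OF t] d\<beta>[OF t] simp: field_simps)
    show "((\<lambda>t. (\<alpha> t - \<beta> t) / 2) has_real_derivative (m * ((\<alpha> t + \<beta> t) / 2) + G t)) (at t within {-T..T})"
      by (auto intro!: derivative_eq_intros d\<alpha>[OF t] d\<beta>[OF t] simp: field_simps)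
  qed (simp_all add: l r \<alpha>T[symmetric])
qed


text \<open>The remaining combinations need no condition: for \<open>m\<close> nonnegative,
  \<open>K + m\<close> is below neither threshold and \<open>L + m\<close> is not below the odd
  threshold \<open>L\<close>.\<close>

fun cond_active :: "real \<Rightarrow> mode_cond \<Rightarrow> bool" where
  "cond_active m Solv \<longleftrightarrow> m = 0"
| "cond_active m Even1p \<longleftrightarrow> L + m < K"
| "cond_active m Even1m \<longleftrightarrow> \<bar>L - m\<bar> < K"
| "cond_active m Even2m \<longleftrightarrow> \<bar>K - m\<bar> < K"
| "cond_active m Odd1m \<longleftrightarrow> \<bar>L - m\<bar> < L"
| "cond_active m Odd2m \<longleftrightarrow> \<bar>K - m\<bar> < L"

text \<open>\<open>xr\<close>, \<open>xl\<close>, \<open>yr\<close>, \<open>yl\<close> are the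
  second components of the corrected field at \<open>T\<close> and \<open>-T\<close>; the sign in
  \<open>xl\<close> is that of \<open>sinh (- L * T)\<close>. The first components are uncorrected,
  since \<open>\<phi>\<close> vanishes on the boundary.\<close>

definition mode_functional ::
  "real \<Rightarrow> mode_cond \<Rightarrow> (real \<Rightarrow> real) \<Rightarrow> (real \<Rightarrow> real) \<Rightarrow> (real \<Rightarrow> real) \<Rightarrow> (real \<Rightarrow> real) \<Rightarrow> real" where
  "mode_functional m c x1 x2 y1 y2 =
    (let I = moment_p m (srcF x1 y1) (srcG x2 y2); J = moment_m m (srcF x1 y1) (srcG x2 y2);
         xr = x2 T + psi_right m I J * sinh (L * T); xl = x2 (-T) - psi_left m I J * sinh (L * T);
         yr = y2 T + psi_right m I J * cosh (K * T); yl = y2 (-T) + psi_left m I J * cosh (K * T)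
     in case c of Solv \<Rightarrow> I + J
        | Even1p \<Rightarrow> (x1 T + xr) + (x1 (-T) + xl)
        | Even1m \<Rightarrow> (x1 T - xr) + (x1 (-T) - xl)
        | Even2m \<Rightarrow> (y1 T - yr) + (y1 (-T) - yl)
        | Odd1m \<Rightarrow> (x1 T - xr) - (x1 (-T) - xl)
        | Odd2m \<Rightarrow> (y1 T - yr) - (y1 (-T) - yl))"

definition mode_form :: "real \<Rightarrow> (real \<Rightarrow> real) \<Rightarrow> (real \<Rightarrow> real) \<Rightarrow> (real \<Rightarrow> real) \<Rightarrow> (real \<Rightarrow> real)
    \<Rightarrow> (real \<Rightarrow> real) \<Rightarrow> (real \<Rightarrow> real) \<Rightarrow> (real \<Rightarrow> real) \<Rightarrow> (real \<Rightarrow> real) \<Rightarrow> real" where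
  "mode_form m x1 x2 y1 y2 x1' x2' y1' y2' =
     integral {-T..T} (\<lambda>t. mode_dens L K m (x1 t) (x2 t) (y1 t) (y2 t) (x1' t) (x2' t) (y1' t) (y2' t)
       - mu2 t * ((srcF x1 y1 t)\<^sup>2 + (srcG x2 y2 t)\<^sup>2))
     - h * ((x1 T)\<^sup>2 + (x2 T)\<^sup>2 + (y1 T)\<^sup>2 + (y2 T)\<^sup>2
          + (x1 (-T))\<^sup>2 + (x2 (-T))\<^sup>2 + (y1 (-T))\<^sup>2 + (y2 (-T))\<^sup>2)"

text \<open>The bulk part equals the energy of the corrected field minus a boundary flux, and the
  flux is exactly \<open>h\<close> times the gain in squared boundary norm. What remains is the
  Steklov form of the corrected field, which splits into four frequencies.\<close>

lemma mode_form_nonneg: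
  fixes x1 x2 y1 y2 x1' x2' y1' y2' :: "real \<Rightarrow> real"
  assumes m: "0 \<le> m"
    and dx1: "\<And>t. t \<in> {-T..T} \<Longrightarrow> (x1 has_real_derivative x1' t) (at t within {-T..T})"
    and dx2: "\<And>t. t \<in> {-T..T} \<Longrightarrow> (x2 has_real_derivative x2' t) (at t within {-T..T})"
    and dy1: "\<And>t. t \<in> {-T..T} \<Longrightarrow> (y1 has_real_derivative y1' t) (at t within {-T..T})"
    and dy2: "\<And>t. t \<in> {-T..T} \<Longrightarrow> (y2 has_real_derivative y2' t) (at t within {-T..T})"
    and cx1': "continuous_on {-T..T} x1'" and cx2': "continuous_on {-T..T} x2'"
    and cy1': "continuous_on {-T..T} y1'" and cy2': "continuous_on {-T..T} y2'"
    and n1: "\<And>t. t \<in> {-T..T} \<Longrightarrow> x1 t * cosh (L * t) + y1 t * sinh (K * t) = 0"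
    and n2: "\<And>t. t \<in> {-T..T} \<Longrightarrow> x2 t * sinh (L * t) + y2 t * cosh (K * t) = 0"
    and conds: "\<And>c. cond_active m c \<Longrightarrow> mode_functional m c x1 x2 y1 y2 = 0"
  shows "0 \<le> mode_form m x1 x2 y1 y2 x1' x2' y1' y2'"
proof -
  let ?J = "{-T..T}"
  define F G where "F = srcF x1 y1" and "G = srcG x2 y2"
  define p q where "p t = L * x1 t * sinh (L * t) + K * y1 t * cosh (K * t)"
    and "q t = L * x2 t * cosh (L * t) + K * y2 t * sinh (K * t)" for t
  have cx1: "continuous_on ?J x1" using dx1 by (rule DERIV_continuous_on)
  have cx2: "continuous_on ?J x2" using dx2 by (rule DERIV_continuous_on)
  have cy1: "continuous_on ?J y1" using dy1 by (rule DERIV_continuous_on)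
  have cy2: "continuous_on ?J y2" using dy2 by (rule DERIV_continuous_on)
  have cF: "continuous_on ?J F" and cG: "continuous_on ?J G"
    unfolding F_def G_def by (auto intro!: continuous_src cx1 cx2 cy1 cy2)
  have FG: "F t * mu2 t = 2 * p t" "G t * mu2 t = 2 * q t" for t
    by (auto simp: F_def G_def srcF_def srcG_def p_def q_def)
  define I J where "I = moment_p m F G" and "J = moment_m m F G"
  have "I + J = 0" if "m = 0"
    using conds[of Solv] that by (simp add: mode_functional_def I_def J_def F_def G_def)
  from cauchy_riemann_mode[OF cF cG m I_def J_def this]
  obtain \<phi> \<psi> where
    d\<phi>: "\<And>t. t \<in> ?J \<Longrightarrow> (\<phi> has_real_derivative (m * \<psi> t + F t)) (at t within ?J)" and
    d\<psi>: "\<And>t. t \<in> ?J \<Longrightarrow> (\<psi> has_real_derivative (m * \<phi> t + G t)) (at t within ?J)" and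
    \<phi>T: "\<phi> T = 0" "\<phi> (-T) = 0" and \<psi>T: "\<psi> T = psi_right m I J" "\<psi> (-T) = psi_left m I J"
    by blast
  have c\<phi>: "continuous_on ?J \<phi>" using d\<phi> by (rule DERIV_continuous_on)
  have c\<psi>: "continuous_on ?J \<psi>" using d\<psi> by (rule DERIV_continuous_on)
  define \<phi>' \<psi>' where "\<phi>' t = m * \<psi> t + F t" and "\<psi>' t = m * \<phi> t + G t" for t
  have c\<phi>': "continuous_on ?J \<phi>'" and c\<psi>': "continuous_on ?J \<psi>'"
    unfolding \<phi>'_def[abs_def] \<psi>'_def[abs_def] by (intro continuous_intros c\<phi> c\<psi> cF cG)+
  define P1 P2 S1 S2 where "P1 t = x1 t + \<phi> t * cosh (L * t)" and "P2 t = y1 t + \<phi> t * sinh (K * t)"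
    and "S1 t = x2 t + \<psi> t * sinh (L * t)" and "S2 t = y2 t + \<psi> t * cosh (K * t)" for t
  define P1' P2' S1' S2' where "P1' t = x1' t + (\<phi>' t * cosh (L * t) + \<phi> t * (L * sinh (L * t)))"
    and "P2' t = y1' t + (\<phi>' t * sinh (K * t) + \<phi> t * (K * cosh (K * t)))"
    and "S1' t = x2' t + (\<psi>' t * sinh (L * t) + \<psi> t * (L * cosh (L * t)))"
    and "S2' t = y2' t + (\<psi>' t * cosh (K * t) + \<psi> t * (K * sinh (K * t)))" for t
  have cPS': "continuous_on ?J P1'" "continuous_on ?J P2'" "continuous_on ?J S1'" "continuous_on ?J S2'"
    unfolding P1'_def[abs_def] P2'_def[abs_def] S1'_def[abs_def] S2'_def[abs_def]
    by (intro continuous_intros cx1' cx2' cy1' cy2' c\<phi> c\<psi> c\<phi>' c\<psi>')+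
  have dPS: "(P1 has_real_derivative P1' t) (at t within ?J)" "(P2 has_real_derivative P2' t) (at t within ?J)"
    "(S1 has_real_derivative S1' t) (at t within ?J)" "(S2 has_real_derivative S2' t) (at t within ?J)"
    if t: "t \<in> ?J" for t
    unfolding P1_def[abs_def] P2_def[abs_def] S1_def[abs_def] S2_def[abs_def]
      P1'_def P2'_def S1'_def S2'_def \<phi>'_def \<psi>'_def
    by (auto intro!: derivative_eq_intros dx1[OF t] dx2[OF t] dy1[OF t] dy2[OF t] d\<phi>[OF t] d\<psi>[OF t])
  have cPS: "continuous_on ?J P1" "continuous_on ?J P2" "continuous_on ?J S1" "continuous_on ?J S2"
    by (rule DERIV_continuous_on, erule dPS)+
  have n': "x1' t * cosh (L * t) + y1' t * sinh (K * t) = - p t"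
    "x2' t * sinh (L * t) + y2' t * cosh (K * t) = - q t" if t: "t \<in> ?J" for t
  proof -
    have ne: "at t within ?J \<noteq> bot" using t T_pos
      by (simp add: trivial_limit_within islimpt_Icc)
    have "((\<lambda>t. x1 t * cosh (L * t) + y1 t * sinh (K * t)) has_real_derivative
       (x1' t * cosh (L * t) + y1' t * sinh (K * t) + p t)) (at t within ?J)"
      by (auto intro!: derivative_eq_intros dx1[OF t] dy1[OF t] simp: p_def algebra_simps)
    moreover have "((\<lambda>t. x1 t * cosh (L * t) + y1 t * sinh (K * t)) has_real_derivative 0) (at t within ?J)"
      unfolding has_field_derivative_def by (rule has_derivative_transform[OF t n1]) (auto intro: DERIV_const[unfolded has_field_derivative_def])
    ultimately have "x1' t * cosh (L * t) + y1' t * sinh (K * t) + p t = 0"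
      unfolding has_real_derivative_iff_has_vector_derivative by (rule vector_derivative_unique_within[OF ne])
    then show "x1' t * cosh (L * t) + y1' t * sinh (K * t) = - p t" by simp
    have "((\<lambda>t. x2 t * sinh (L * t) + y2 t * cosh (K * t)) has_real_derivative
       (x2' t * sinh (L * t) + y2' t * cosh (K * t) + q t)) (at t within ?J)"
      by (auto intro!: derivative_eq_intros dx2[OF t] dy2[OF t] simp: q_def algebra_simps)
    moreover have "((\<lambda>t. x2 t * sinh (L * t) + y2 t * cosh (K * t)) has_real_derivative 0) (at t within ?J)"
      unfolding has_field_derivative_def by (rule has_derivative_transform[OF t n2]) (auto intro: DERIV_const[unfolded has_field_derivative_def])
    ultimately have "x2' t * sinh (L * t) + y2' t * cosh (K * t) + q t = 0"
      unfolding has_real_derivative_iff_has_vector_derivative by (rule vector_derivative_unique_within[OF ne])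
    then show "x2' t * sinh (L * t) + y2' t * cosh (K * t) = - q t" by simp
  qed
  define \<kappa> where "\<kappa> t = L * cosh (L * t) * sinh (L * t) + K * cosh (K * t) * sinh (K * t)" for t
  \<comment> \<open>Antiderivative of the excess bracket in
    \<open>mode_flux_identity\<close>.\<close>
  define flux where "flux t = 2 * (\<phi> t * p t + \<psi> t * q t) + \<kappa> t * ((\<phi> t)\<^sup>2 + (\<psi> t)\<^sup>2)
      + 2 * m * (mu2 t * \<phi> t * \<psi> t)" for t
  define p' q' where "p' t = L * x1' t * sinh (L * t) + K * y1' t * cosh (K * t)
        + L\<^sup>2 * x1 t * cosh (L * t) + K\<^sup>2 * y1 t * sinh (K * t)"
    and "q' t = L * x2' t * cosh (L * t) + K * y2' t * sinh (K * t)
        + L\<^sup>2 * x2 t * sinh (L * t) + K\<^sup>2 * y2 t * cosh (K * t)" for t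
  define flux' where "flux' t = 2 * (\<phi>' t * p t + \<phi> t * p' t + \<psi>' t * q t + \<psi> t * q' t)
     + (L\<^sup>2 * ((cosh (L * t))\<^sup>2 + (sinh (L * t))\<^sup>2) + K\<^sup>2 * ((cosh (K * t))\<^sup>2 + (sinh (K * t))\<^sup>2)) * ((\<phi> t)\<^sup>2 + (\<psi> t)\<^sup>2)
     + 2 * \<kappa> t * (\<phi> t * \<phi>' t + \<psi> t * \<psi>' t)
     + 2 * m * (2 * \<kappa> t * \<phi> t * \<psi> t + mu2 t * \<phi>' t * \<psi> t + mu2 t * \<phi> t * \<psi>' t)" for t
  have dflux: "(flux has_real_derivative flux' t) (at t within ?J)" if t: "t \<in> ?J" for t
  proof -
    have dp: "(p has_real_derivative p' t) (at t within ?J)"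
      unfolding p_def[abs_def] p'_def
      by (auto intro!: derivative_eq_intros dx1[OF t] dy1[OF t] simp: algebra_simps power2_eq_square)
    have dq: "(q has_real_derivative q' t) (at t within ?J)"
      unfolding q_def[abs_def] q'_def
      by (auto intro!: derivative_eq_intros dx2[OF t] dy2[OF t] simp: algebra_simps power2_eq_square)
    have d\<kappa>: "(\<kappa> has_real_derivative (L\<^sup>2 * ((cosh (L * t))\<^sup>2 + (sinh (L * t))\<^sup>2) + K\<^sup>2 * ((cosh (K * t))\<^sup>2 + (sinh (K * t))\<^sup>2))) (at t within ?J)"
      unfolding \<kappa>_def[abs_def]
      by (auto intro!: derivative_eq_intros simp: algebra_simps power2_eq_square)
    have dmu: "(mu2 has_real_derivative (2 * \<kappa> t)) (at t within ?J)"
      unfolding mu2_def[abs_def] \<kappa>_def by (auto intro!: derivative_eq_intros simp: algebra_simps)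
    show ?thesis unfolding flux_def[abs_def] flux'_def \<phi>'_def \<psi>'_def
      by (rule derivative_eq_intros dp dq d\<kappa> dmu d\<phi>[OF t] d\<psi>[OF t] refl)+ (simp add: algebra_simps power2_eq_square)
  qed
  define dX where "dX t = mode_dens L K m (x1 t) (x2 t) (y1 t) (y2 t) (x1' t) (x2' t) (y1' t) (y2' t)
       - mu2 t * ((srcF x1 y1 t)\<^sup>2 + (srcG x2 y2 t)\<^sup>2)" for t
  define dV where "dV t = mode_dens L K m (P1 t) (S1 t) (P2 t) (S2 t) (P1' t) (S1' t) (P2' t) (S2' t)" for t
  have idX: "dX integrable_on ?J"
    unfolding dX_def[abs_def] mode_dens_def
    by (intro integrable_continuous_real continuous_intros continuous_src cx1 cx2 cy1 cy2 cx1' cx2' cy1' cy2')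
  have dVX: "dV t = dX t + flux' t" if t: "t \<in> ?J" for t
    unfolding dV_def dX_def flux'_def P1_def P2_def S1_def S2_def P1'_def P2'_def S1'_def S2'_def
      p'_def q'_def F_def[symmetric] G_def[symmetric]
    by (rule mode_flux_identity[OF mu2_def mu2_alt p_def q_def n1[OF t] n2[OF t] n'(1)[OF t] n'(2)[OF t]
          FG(1) FG(2) \<phi>'_def \<psi>'_def \<kappa>_def])
  have "(flux' has_integral (flux T - flux (-T))) ?J"
    using T_pos by (intro has_integral_FTC dflux) auto
  then have "((\<lambda>t. dX t + flux' t) has_integral (integral ?J dX + (flux T - flux (-T)))) ?J"
    by (intro has_integral_add integrable_integral idX)
  then have "(dV has_integral (integral ?J dX + (flux T - flux (-T)))) ?J"
    by (rule has_integral_eq[rotated]) (simp add: dVX)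
  then have E1: "integral ?J dV = integral ?J dX + (flux T - flux (-T))" by (rule integral_unique)
  \<comment> \<open>The equations for \<open>h\<close> make the mixed second derivative of the
    immersion a multiple of its \<open>\<theta>\<close>-derivative on the boundary, with factor
    \<open>h\<close> at \<open>T\<close> and \<open>- h\<close> at \<open>-T\<close>; X is
    orthogonal to that derivative.\<close>
  have qT: "q T = 0" "q (-T) = 0"
  proof -
    have "q T = x2 T * (L * cosh (L * T)) + y2 T * (K * sinh (K * T))"
      by (simp add: q_def)
    also have "\<dots> = h * (x2 T * sinh (L * T) + y2 T * cosh (K * T))"
      unfolding hL hK by (simp add: algebra_simps)
    finally show "q T = 0" using n2[of T] T_pos by simp
    have "q (-T) = x2 (-T) * (L * cosh (L * T)) - y2 (-T) * (K * sinh (K * T))"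
      by (simp add: q_def)
    also have "\<dots> = - h * (x2 (-T) * sinh (L * (-T)) + y2 (-T) * cosh (K * (-T)))"
      unfolding hL hK by (simp add: algebra_simps)
    finally show "q (-T) = 0" using n2[of "-T"] T_pos by simp
  qed
  have \<kappa>T: "\<kappa> T = h * mu2 T" "\<kappa> (-T) = - (h * mu2 T)"
    unfolding \<kappa>_def mu2_alt using hL hK by (simp_all add: algebra_simps power2_eq_square)
  \<comment> \<open>Matches the term that \<open>\<psi>\<close> adds to the boundary norm: the cross
    term there vanishes by normality, and the square of the tangent vector gives
    \<open>mu2 T\<close>.\<close>
  have fluxT: "flux T - flux (-T) = h * mu2 T * ((\<psi> T)\<^sup>2 + (\<psi> (-T))\<^sup>2)"
    by (simp add: flux_def \<phi>T qT \<kappa>T algebra_simps)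
  define E where "E n v v' = integral ?J (\<lambda>t. (v' t)\<^sup>2 + n\<^sup>2 * (v t)\<^sup>2)" for n and v v' :: "real \<Rightarrow> real"
  define bd where "bd v = (v T)\<^sup>2 + (v (-T))\<^sup>2" for v :: "real \<Rightarrow> real"
  have E2: "integral ?J dV = (E (L + m) (\<lambda>t. P1 t + S1 t) (\<lambda>t. P1' t + S1' t)
       + E (L - m) (\<lambda>t. P1 t - S1 t) (\<lambda>t. P1' t - S1' t)
       + E (K + m) (\<lambda>t. P2 t + S2 t) (\<lambda>t. P2' t + S2' t)
       + E (K - m) (\<lambda>t. P2 t - S2 t) (\<lambda>t. P2' t - S2' t)) / 2"
    unfolding dV_def[abs_def] mode_dens_split E_def integral_divide
    by (subst integral_add integral_divide; (intro integrable_continuous_real continuous_intros cPS cPS')?)+ simp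
  note bd_conds = conds[unfolded mode_functional_def Let_def, folded F_def G_def, folded I_def J_def, folded \<psi>T]
  have e1: "h * bd (\<lambda>t. P1 t + S1 t) \<le> E (L + m) (\<lambda>t. P1 t + S1 t) (\<lambda>t. P1' t + S1' t)"
    unfolding E_def bd_def
  proof (rule steklov_1d)
    show "P1 T + S1 T + (P1 (-T) + S1 (-T)) = 0" if "\<bar>L + m\<bar> < K"
      using bd_conds[of Even1p] that L_pos m by (simp add: P1_def S1_def \<phi>T)
    show "P1 T + S1 T - (P1 (-T) + S1 (-T)) = 0" if "\<bar>L + m\<bar> < L"
      using that m L_pos by simp
  qed (intro DERIV_add dPS continuous_intros cPS'; simp)+
  have e2: "h * bd (\<lambda>t. P1 t - S1 t) \<le> E (L - m) (\<lambda>t. P1 t - S1 t) (\<lambda>t. P1' t - S1' t)"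
    unfolding E_def bd_def
  proof (rule steklov_1d)
    show "P1 T - S1 T + (P1 (-T) - S1 (-T)) = 0" if "\<bar>L - m\<bar> < K"
      using bd_conds[of Even1m] that by (simp add: P1_def S1_def \<phi>T)
    show "P1 T - S1 T - (P1 (-T) - S1 (-T)) = 0" if "\<bar>L - m\<bar> < L"
      using bd_conds[of Odd1m] that by (simp add: P1_def S1_def \<phi>T)
  qed (intro DERIV_diff dPS continuous_intros cPS'; simp)+
  have e3: "h * bd (\<lambda>t. P2 t + S2 t) \<le> E (K + m) (\<lambda>t. P2 t + S2 t) (\<lambda>t. P2' t + S2' t)"
    unfolding E_def bd_def
  proof (rule steklov_1d)
    show "P2 T + S2 T + (P2 (-T) + S2 (-T)) = 0" if "\<bar>K + m\<bar> < K"
      using that m K_pos by simp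
    show "P2 T + S2 T - (P2 (-T) + S2 (-T)) = 0" if "\<bar>K + m\<bar> < L"
      using that m K_pos L_less_K by simp
  qed (intro DERIV_add dPS continuous_intros cPS'; simp)+
  have e4: "h * bd (\<lambda>t. P2 t - S2 t) \<le> E (K - m) (\<lambda>t. P2 t - S2 t) (\<lambda>t. P2' t - S2' t)"
    unfolding E_def bd_def
  proof (rule steklov_1d)
    show "P2 T - S2 T + (P2 (-T) - S2 (-T)) = 0" if "\<bar>K - m\<bar> < K"
      using bd_conds[of Even2m] that by (simp add: P2_def S2_def \<phi>T)
    show "P2 T - S2 T - (P2 (-T) - S2 (-T)) = 0" if "\<bar>K - m\<bar> < L"
      using bd_conds[of Odd2m] that by (simp add: P2_def S2_def \<phi>T)
  qed (intro DERIV_diff dPS continuous_intros cPS'; simp)+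
  have "h * (bd (\<lambda>t. P1 t + S1 t) + bd (\<lambda>t. P1 t - S1 t) + bd (\<lambda>t. P2 t + S2 t) + bd (\<lambda>t. P2 t - S2 t)) / 2
      \<le> integral ?J dV"
    unfolding E2 distrib_left using e1 e2 e3 e4 by simp
  moreover have "(bd (\<lambda>t. P1 t + S1 t) + bd (\<lambda>t. P1 t - S1 t) + bd (\<lambda>t. P2 t + S2 t) + bd (\<lambda>t. P2 t - S2 t)) / 2
     = bd x1 + bd x2 + bd y1 + bd y2 + mu2 T * ((\<psi> T)\<^sup>2 + (\<psi> (-T))\<^sup>2)"
  proof -
    have P: "P1 T = x1 T" "P1 (-T) = x1 (-T)" "P2 T = y1 T" "P2 (-T) = y1 (-T)"
      by (auto simp: P1_def P2_def \<phi>T)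
    have r: "(S1 T)\<^sup>2 + (S2 T)\<^sup>2 = (x2 T)\<^sup>2 + (y2 T)\<^sup>2 + 2 * \<psi> T * (x2 T * sinh (L * T) + y2 T * cosh (K * T)) + mu2 T * (\<psi> T)\<^sup>2"
      by (simp add: S1_def S2_def mu2_alt power2_eq_square algebra_simps)
    have l: "(S1 (-T))\<^sup>2 + (S2 (-T))\<^sup>2 = (x2 (-T))\<^sup>2 + (y2 (-T))\<^sup>2
        + 2 * \<psi> (-T) * (x2 (-T) * sinh (L * (-T)) + y2 (-T) * cosh (K * (-T))) + mu2 T * (\<psi> (-T))\<^sup>2"
      by (simp add: S1_def S2_def mu2_alt power2_eq_square algebra_simps)
    have "(bd (\<lambda>t. P1 t + S1 t) + bd (\<lambda>t. P1 t - S1 t) + bd (\<lambda>t. P2 t + S2 t) + bd (\<lambda>t. P2 t - S2 t)) / 2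
      = bd P1 + bd P2 + ((S1 T)\<^sup>2 + (S2 T)\<^sup>2) + ((S1 (-T))\<^sup>2 + (S2 (-T))\<^sup>2)"
      by (simp add: bd_def power2_eq_square algebra_simps)
    then show ?thesis
      unfolding r l using n2[of T] n2[of "-T"] T_pos by (simp add: bd_def P algebra_simps)
  qed
  ultimately have "h * (bd x1 + bd x2 + bd y1 + bd y2 + mu2 T * ((\<psi> T)\<^sup>2 + (\<psi> (-T))\<^sup>2)) \<le> integral ?J dV"
    by (simp only: times_divide_eq_right[symmetric])
  then have "h * (bd x1 + bd x2 + bd y1 + bd y2 + mu2 T * ((\<psi> T)\<^sup>2 + (\<psi> (-T))\<^sup>2)) \<le>
      integral ?J dX + h * mu2 T * ((\<psi> T)\<^sup>2 + (\<psi> (-T))\<^sup>2)"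
    unfolding E1 fluxT .
  then show ?thesis
    by (simp add: mode_form_def dX_def[abs_def] bd_def algebra_simps)
qed

end

section \<open>Decomposition into Fourier modes\<close>

text \<open>The two phases of the frequency \<open>m\<close>: \<open>x1\<close>, \<open>y1\<close> are paired with \<open>cos m\<theta>\<close> and \<open>x2\<close>, \<open>y2\<close> with
  \<open>sin m\<theta>\<close>, or with \<open>sin m\<theta>\<close> and \<open>- cos m\<theta>\<close>.\<close>

definition mode_c :: "bool \<Rightarrow> nat \<Rightarrow> (real \<Rightarrow> real) \<Rightarrow> real" where
  "mode_c ph m f = (if ph then cos_coeff m f else sin_coeff m f)"

definition mode_s :: "bool \<Rightarrow> nat \<Rightarrow> (real \<Rightarrow> real) \<Rightarrow> real" where
  "mode_s ph m f = (if ph then sin_coeff m f else - cos_coeff m f)"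

definition modes_sum :: "nat \<Rightarrow> (nat \<Rightarrow> bool \<Rightarrow> real) \<Rightarrow> real" where
  "modes_sum N g = (\<Sum>m<N. \<Sum>ph\<in>UNIV. coeff_weight m * g m ph)"

lemma modes_sum_add: "modes_sum N (\<lambda>m ph. f m ph + g m ph) = modes_sum N f + modes_sum N g"
  and modes_sum_diff: "modes_sum N (\<lambda>m ph. f m ph - g m ph) = modes_sum N f - modes_sum N g"
  and modes_sum_mult: "modes_sum N (\<lambda>m ph. c * f m ph) = c * modes_sum N f"
  by (simp_all add: modes_sum_def sum.distrib sum_subtractf sum_distrib_left algebra_simps)

lemma modes_sum_nonneg: "(\<And>m ph. g m ph \<ge> 0) \<Longrightarrow> modes_sum N g \<ge> 0"
  unfolding modes_sum_def by (intro sum_nonneg mult_nonneg_nonneg less_imp_le[OF coeff_weight_pos])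

lemma modes_sum_sq:
  "modes_sum N (\<lambda>m ph. (mode_c ph m f)\<^sup>2) = (\<Sum>m<N. coeff_weight m * ((cos_coeff m f)\<^sup>2 + (sin_coeff m f)\<^sup>2))"
  "modes_sum N (\<lambda>m ph. (mode_s ph m f)\<^sup>2) = (\<Sum>m<N. coeff_weight m * ((cos_coeff m f)\<^sup>2 + (sin_coeff m f)\<^sup>2))"
  by (auto simp: modes_sum_def mode_c_def mode_s_def UNIV_bool algebra_simps intro!: sum.cong)

lemma coeff_linear:
  assumes "continuous_on {0..2 * pi} f" "continuous_on {0..2 * pi} g"
  shows "mode_c ph m (\<lambda>x. a * f x + b * g x) = a * mode_c ph m f + b * mode_c ph m g"
    and "mode_s ph m (\<lambda>x. a * f x + b * g x) = a * mode_s ph m f + b * mode_s ph m g"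
proof -
  have "((\<lambda>x. a * (f x * cos (real m * x)) + b * (g x * cos (real m * x))) has_integral
      (a * cos_coeff m f + b * cos_coeff m g)) {0..2 * pi}"
    by (intro has_integral_add has_integral_mult_right has_integral_cos_coeff assms)
  then have c: "cos_coeff m (\<lambda>x. a * f x + b * g x) = a * cos_coeff m f + b * cos_coeff m g"
    by (simp add: cos_coeff_def integral_unique algebra_simps)
  have "((\<lambda>x. a * (f x * sin (real m * x)) + b * (g x * sin (real m * x))) has_integral
      (a * sin_coeff m f + b * sin_coeff m g)) {0..2 * pi}"
    by (intro has_integral_add has_integral_mult_right has_integral_sin_coeff assms)
  then have s: "sin_coeff m (\<lambda>x. a * f x + b * g x) = a * sin_coeff m f + b * sin_coeff m g"
    by (simp add: sin_coeff_def integral_unique algebra_simps)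
  show "mode_c ph m (\<lambda>x. a * f x + b * g x) = a * mode_c ph m f + b * mode_c ph m g"
    "mode_s ph m (\<lambda>x. a * f x + b * g x) = a * mode_s ph m f + b * mode_s ph m g"
    by (simp_all add: mode_c_def mode_s_def c s)
qed

text \<open>The sign in \<open>mode_s\<close> is chosen so that both phases obey the same rule and
  lead to the same ordinary differential equations.\<close>

lemma coeff_deriv:
  assumes f: "\<And>x. (f has_real_derivative f' x) (at x)" and f': "continuous_on UNIV f'"
    and per: "\<And>x. f (x + 2 * pi) = f x"
  shows "mode_c ph m f' = real m * mode_s ph m f" "mode_s ph m f' = - real m * mode_c ph m f"
proof -
  have cf: "continuous_on S f" for S
    using f by (meson DERIV_isCont continuous_at_imp_continuous_on)
  have cf': "continuous_on S f'" for S using f' continuous_on_subset by blast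
  have f2: "f (2 * pi) = f 0" using per[of 0] by simp
  have s: "sin (real m * (2 * pi)) = 0" and c: "cos (real m * (2 * pi)) = 1"
    using sin_int_2pi[of "int m"] cos_int_2pi[of "int m"] by auto
  have c1: "((\<lambda>x. f' x * cos (real m * x) - real m * (f x * sin (real m * x))) has_integral
      (f (2 * pi) * cos (real m * (2 * pi)) - f 0 * cos (real m * 0))) {0..2 * pi}"
    by (intro has_integral_FTC) (auto intro!: derivative_eq_intros DERIV_subset[OF f])
  have c2: "((\<lambda>x. f' x * cos (real m * x) - real m * (f x * sin (real m * x))) has_integral
      (cos_coeff m f' - real m * sin_coeff m f)) {0..2 * pi}"
    by (intro has_integral_diff has_integral_mult_right has_integral_sin_coeff has_integral_cos_coeff cf cf')
  have cc: "cos_coeff m f' = real m * sin_coeff m f"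
    using has_integral_unique[OF c2 c1] f2 c by simp
  have s1: "((\<lambda>x. f' x * sin (real m * x) + real m * (f x * cos (real m * x))) has_integral
      (f (2 * pi) * sin (real m * (2 * pi)) - f 0 * sin (real m * 0))) {0..2 * pi}"
    by (intro has_integral_FTC) (auto intro!: derivative_eq_intros DERIV_subset[OF f])
  have s2: "((\<lambda>x. f' x * sin (real m * x) + real m * (f x * cos (real m * x))) has_integral
      (sin_coeff m f' + real m * cos_coeff m f)) {0..2 * pi}"
    by (intro has_integral_add has_integral_mult_right has_integral_sin_coeff has_integral_cos_coeff cf cf')
  have "sin_coeff m f' + real m * cos_coeff m f = 0"
    using has_integral_unique[OF s2 s1] s by simp
  then have ss: "sin_coeff m f' = - real m * cos_coeff m f" by simp
  show "mode_c ph m f' = real m * mode_s ph m f" "mode_s ph m f' = - real m * mode_c ph m f"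
    by (simp_all add: mode_c_def mode_s_def cc ss)
qed

context fs_data begin

abbreviation J :: "real set" where "J \<equiv> {-T..T}"

definition cont2 :: "(real \<Rightarrow> real \<Rightarrow> real) \<Rightarrow> bool" where
  "cont2 g \<longleftrightarrow> continuous_on (J \<times> UNIV) (\<lambda>p. g (fst p) (snd p))"

definition field_C1 :: "(real \<Rightarrow> real \<Rightarrow> real) \<Rightarrow> (real \<Rightarrow> real \<Rightarrow> real) \<Rightarrow> (real \<Rightarrow> real \<Rightarrow> real) \<Rightarrow> bool" where
  "field_C1 x xt x\<theta> \<longleftrightarrow> cont2 x \<and> cont2 xt \<and> cont2 x\<theta> \<and>
     (\<forall>t\<in>J. \<forall>\<theta>. ((\<lambda>t. x t \<theta>) has_real_derivative xt t \<theta>) (at t within J) \<and>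
        (x t has_real_derivative x\<theta> t \<theta>) (at \<theta>) \<and> x t (\<theta> + 2 * pi) = x t \<theta>)"

lemma cont2_slice: "cont2 g \<Longrightarrow> t \<in> J \<Longrightarrow> continuous_on S (g t)"
  unfolding cont2_def
  by (rule continuous_on_compose2[of _ "\<lambda>p. g (fst p) (snd p)" _ "\<lambda>\<theta>. (t, \<theta>)", simplified])
     (auto intro!: continuous_intros)

lemma cont2_integral:
  assumes "cont2 g" shows "continuous_on J (\<lambda>t. integral {0..2 * pi} (g t))"
proof -
  have "continuous_on (J \<times> cbox 0 (2 * pi)) (\<lambda>(t, \<theta>). g t \<theta>)"
    using assms unfolding cont2_def split_beta by (rule continuous_on_subset) auto
  from integral_continuous_on_param[OF this] show ?thesis by simp
qed

lemma cont2_intros: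
  "cont2 f \<Longrightarrow> cont2 g \<Longrightarrow> cont2 (\<lambda>t \<theta>. f t \<theta> + g t \<theta>)"
  "cont2 f \<Longrightarrow> cont2 g \<Longrightarrow> cont2 (\<lambda>t \<theta>. f t \<theta> - g t \<theta>)"
  "cont2 f \<Longrightarrow> cont2 g \<Longrightarrow> cont2 (\<lambda>t \<theta>. f t \<theta> * g t \<theta>)"
  "cont2 f \<Longrightarrow> cont2 (\<lambda>t \<theta>. (f t \<theta>)\<^sup>2)"
  "continuous_on UNIV a \<Longrightarrow> cont2 (\<lambda>t \<theta>. a t)"
  "continuous_on UNIV a \<Longrightarrow> cont2 (\<lambda>t \<theta>. a \<theta>)"
  unfolding cont2_def
  by (intro continuous_intros; assumption)+
     (auto intro!: continuous_intros continuous_on_compose2[of UNIV a])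

lemma cont2_coeff:
  assumes "cont2 g"
  shows "continuous_on J (\<lambda>t. mode_c ph m (g t))" "continuous_on J (\<lambda>t. mode_s ph m (g t))"
proof -
  have "continuous_on J (\<lambda>t. cos_coeff m (g t))" "continuous_on J (\<lambda>t. sin_coeff m (g t))"
    unfolding cos_coeff_def sin_coeff_def
    by (intro cont2_integral cont2_intros assms continuous_intros)+
  then show "continuous_on J (\<lambda>t. mode_c ph m (g t))" "continuous_on J (\<lambda>t. mode_s ph m (g t))"
    unfolding mode_c_def mode_s_def by (cases ph; auto intro!: continuous_intros)+
qed

lemma DERIV_coeff:
  assumes x: "field_C1 x xt x\<theta>" and t: "t \<in> J"
  shows "((\<lambda>t. mode_c ph m (x t)) has_real_derivative mode_c ph m (xt t)) (at t within J)"
    "((\<lambda>t. mode_s ph m (x t)) has_real_derivative mode_s ph m (xt t)) (at t within J)"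
proof -
  have cx: "cont2 x" "cont2 xt" using x by (auto simp: field_C1_def)
  have g: "((\<lambda>t. integral {0..2 * pi} (\<lambda>\<theta>. x t \<theta> * a \<theta>)) has_real_derivative
     integral {0..2 * pi} (\<lambda>\<theta>. xt t \<theta> * a \<theta>)) (at t within J)" if a: "continuous_on UNIV a" for a
  proof -
    have "continuous_on (J \<times> cbox 0 (2 * pi)) (\<lambda>(t, \<theta>). xt t \<theta> * a \<theta>)"
      using cont2_intros(3)[OF cx(2) cont2_intros(6)[OF a]]
      unfolding cont2_def split_beta by (rule continuous_on_subset) auto
    moreover have "(\<lambda>\<theta>. x t \<theta> * a \<theta>) integrable_on cbox 0 (2 * pi)" if "t \<in> J" for t
      using that unfolding box_real
      by (intro integrable_continuous_real continuous_intros cont2_slice[OF cx(1)] continuous_on_subset[OF a]) auto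
    moreover have "((\<lambda>t. x t \<theta> * a \<theta>) has_real_derivative xt t \<theta> * a \<theta>) (at t within J)" if "t \<in> J" for t \<theta>
      using x that by (auto simp: field_C1_def intro!: derivative_eq_intros)
    ultimately show ?thesis
      using leibniz_rule_field_derivative[of J 0 "2 * pi" "\<lambda>t \<theta>. x t \<theta> * a \<theta>" "\<lambda>t \<theta>. xt t \<theta> * a \<theta>" t] t
      by simp
  qed
  have "((\<lambda>t. cos_coeff m (x t)) has_real_derivative cos_coeff m (xt t)) (at t within J)"
    "((\<lambda>t. sin_coeff m (x t)) has_real_derivative sin_coeff m (xt t)) (at t within J)"
    unfolding cos_coeff_def sin_coeff_def by (intro g continuous_intros)+
  then show "((\<lambda>t. mode_c ph m (x t)) has_real_derivative mode_c ph m (xt t)) (at t within J)"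
    "((\<lambda>t. mode_s ph m (x t)) has_real_derivative mode_s ph m (xt t)) (at t within J)"
    unfolding mode_c_def mode_s_def by (cases ph; auto intro!: derivative_eq_intros)+
qed

lemma field_coeff_theta:
  assumes x: "field_C1 x xt x\<theta>" and t: "t \<in> J"
  shows "mode_c ph m (x\<theta> t) = real m * mode_s ph m (x t)" "mode_s ph m (x\<theta> t) = - real m * mode_c ph m (x t)"
  using x t coeff_deriv[of "x t" "x\<theta> t"] cont2_slice[of x\<theta> t UNIV] by (auto simp: field_C1_def)

text \<open>Pairs such as \<open>x1\<theta> - L * x2\<close> are the rotated components of the
  \<open>\<theta>\<close>-derivative of the unrotated field. No coefficient depends on
  \<open>\<theta>\<close>, which is why the modes decouple.\<close>

definition energy_dens where
  "energy_dens x1 x2 y1 y2 x1t x2t y1t y2t x1\<theta> x2\<theta> y1\<theta> y2\<theta> t \<theta> =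
    (x1t t \<theta>)\<^sup>2 + (x2t t \<theta>)\<^sup>2 + (y1t t \<theta>)\<^sup>2 + (y2t t \<theta>)\<^sup>2
    + (x1\<theta> t \<theta> - L * x2 t \<theta>)\<^sup>2 + (x2\<theta> t \<theta> + L * x1 t \<theta>)\<^sup>2
    + (y1\<theta> t \<theta> - K * y2 t \<theta>)\<^sup>2 + (y2\<theta> t \<theta> + K * y1 t \<theta>)\<^sup>2
    - mu2 t * ((srcF (\<lambda>t. x1 t \<theta>) (\<lambda>t. y1 t \<theta>) t)\<^sup>2 + (srcG (\<lambda>t. x2 t \<theta>) (\<lambda>t. y2 t \<theta>) t)\<^sup>2 :: real)"

lemma srcF_linear: "srcF x1 y1 t = (2 * L * sinh (L * t) / mu2 t) * x1 t + (2 * K * cosh (K * t) / mu2 t) * y1 t"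
  and srcG_linear: "srcG x2 y2 t = (2 * L * cosh (L * t) / mu2 t) * x2 t + (2 * K * sinh (K * t) / mu2 t) * y2 t"
  by (auto simp: srcF_def srcG_def field_simps)

lemma cont2_src:
  "cont2 x1 \<Longrightarrow> cont2 y1 \<Longrightarrow> cont2 (\<lambda>t \<theta>. srcF (\<lambda>t. x1 t \<theta>) (\<lambda>t. y1 t \<theta>) t)"
  "cont2 x2 \<Longrightarrow> cont2 y2 \<Longrightarrow> cont2 (\<lambda>t \<theta>. srcG (\<lambda>t. x2 t \<theta>) (\<lambda>t. y2 t \<theta>) t)"
  unfolding srcF_linear srcG_linear by (intro cont2_intros continuous_intros; simp)+

definition area_form where
  "area_form x1 x2 y1 y2 x1t x2t y1t y2t x1\<theta> x2\<theta> y1\<theta> y2\<theta> =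
    integral J (\<lambda>t. integral {0..2 * pi} (energy_dens x1 x2 y1 y2 x1t x2t y1t y2t x1\<theta> x2\<theta> y1\<theta> y2\<theta> t))
    - h * (\<Sum>t\<in>{-T, T}. integral {0..2 * pi} (\<lambda>\<theta>. (x1 t \<theta>)\<^sup>2 + (x2 t \<theta>)\<^sup>2 + (y1 t \<theta>)\<^sup>2 + (y2 t \<theta>)\<^sup>2))"

lemma bessel_modes:
  assumes "continuous_on {0..2 * pi} f"
  shows "modes_sum N (\<lambda>m ph. (mode_c ph m f)\<^sup>2) \<le> integral {0..2 * pi} (\<lambda>x. (f x)\<^sup>2)"
    "modes_sum N (\<lambda>m ph. (mode_s ph m f)\<^sup>2) \<le> integral {0..2 * pi} (\<lambda>x. (f x)\<^sup>2)"
  using bessel[OF assms] by (simp_all add: modes_sum_sq)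

lemma parseval_modes:
  assumes "N > 0" "\<And>x. (f has_real_derivative f' x) (at x)"
    "continuous_on UNIV f'" "\<And>x. f (x + 2 * pi) = f x"
  shows "integral {0..2 * pi} (\<lambda>x. (f x)\<^sup>2) \<le> modes_sum N (\<lambda>m ph. (mode_c ph m f)\<^sup>2)
      + fourier_tail N * integral {0..2 * pi} (\<lambda>x. (f' x)\<^sup>2)"
    "integral {0..2 * pi} (\<lambda>x. (f x)\<^sup>2) \<le> modes_sum N (\<lambda>m ph. (mode_s ph m f)\<^sup>2)
      + fourier_tail N * integral {0..2 * pi} (\<lambda>x. (f' x)\<^sup>2)"
  using parseval_upper[OF assms] by (simp_all add: modes_sum_sq)

lemma parseval_linear_modes:
  assumes x: "field_C1 x xt x\<theta>" and y: "field_C1 y yt y\<theta>" and t: "t \<in> J" and N: "N > 0"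
  shows "integral {0..2 * pi} (\<lambda>\<theta>. (a * x t \<theta> + b * y t \<theta>)\<^sup>2) \<le>
      modes_sum N (\<lambda>m ph. (a * mode_c ph m (x t) + b * mode_c ph m (y t))\<^sup>2)
      + fourier_tail N * integral {0..2 * pi} (\<lambda>\<theta>. (a * x\<theta> t \<theta> + b * y\<theta> t \<theta>)\<^sup>2)"
    "integral {0..2 * pi} (\<lambda>\<theta>. (a * x t \<theta> + b * y t \<theta>)\<^sup>2) \<le>
      modes_sum N (\<lambda>m ph. (a * mode_s ph m (x t) + b * mode_s ph m (y t))\<^sup>2)
      + fourier_tail N * integral {0..2 * pi} (\<lambda>\<theta>. (a * x\<theta> t \<theta> + b * y\<theta> t \<theta>)\<^sup>2)"
proof -
  have c: "continuous_on S (x t)" "continuous_on S (y t)" "continuous_on S (x\<theta> t)" "continuous_on S (y\<theta> t)" for S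
    using x y t by (auto simp: field_C1_def intro: cont2_slice)
  have d: "((\<lambda>\<theta>. a * x t \<theta> + b * y t \<theta>) has_real_derivative a * x\<theta> t \<theta> + b * y\<theta> t \<theta>) (at \<theta>)" for \<theta>
    using x y t by (intro DERIV_add DERIV_cmult) (auto simp: field_C1_def)
  have p: "a * x t (\<theta> + 2 * pi) + b * y t (\<theta> + 2 * pi) = a * x t \<theta> + b * y t \<theta>" for \<theta>
    using x y t by (simp add: field_C1_def)
  have cc: "continuous_on UNIV (\<lambda>\<theta>. a * x\<theta> t \<theta> + b * y\<theta> t \<theta>)"
    by (intro continuous_intros c)
  show "integral {0..2 * pi} (\<lambda>\<theta>. (a * x t \<theta> + b * y t \<theta>)\<^sup>2) \<le>
      modes_sum N (\<lambda>m ph. (a * mode_c ph m (x t) + b * mode_c ph m (y t))\<^sup>2)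
      + fourier_tail N * integral {0..2 * pi} (\<lambda>\<theta>. (a * x\<theta> t \<theta> + b * y\<theta> t \<theta>)\<^sup>2)"
    "integral {0..2 * pi} (\<lambda>\<theta>. (a * x t \<theta> + b * y t \<theta>)\<^sup>2) \<le>
      modes_sum N (\<lambda>m ph. (a * mode_s ph m (x t) + b * mode_s ph m (y t))\<^sup>2)
      + fourier_tail N * integral {0..2 * pi} (\<lambda>\<theta>. (a * x\<theta> t \<theta> + b * y\<theta> t \<theta>)\<^sup>2)"
    unfolding coeff_linear[OF c(1) c(2), symmetric] by (rule parseval_modes[OF N d cc p])+
qed

context
  fixes x1 x2 y1 y2 x1t x2t y1t y2t x1\<theta> x2\<theta> y1\<theta> y2\<theta> :: "real \<Rightarrow> real \<Rightarrow> real"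
  assumes X1: "field_C1 x1 x1t x1\<theta>" and X2: "field_C1 x2 x2t x2\<theta>"
    and Y1: "field_C1 y1 y1t y1\<theta>" and Y2: "field_C1 y2 y2t y2\<theta>"
begin

abbreviation "mX1 ph m t \<equiv> mode_c ph m (x1 t)"
abbreviation "mX2 ph m t \<equiv> mode_s ph m (x2 t)"
abbreviation "mY1 ph m t \<equiv> mode_c ph m (y1 t)"
abbreviation "mY2 ph m t \<equiv> mode_s ph m (y2 t)"

lemma cont2_fields:
  "cont2 x1" "cont2 x2" "cont2 y1" "cont2 y2" "cont2 x1t" "cont2 x2t" "cont2 y1t" "cont2 y2t"
  "cont2 x1\<theta>" "cont2 x2\<theta>" "cont2 y1\<theta>" "cont2 y2\<theta>"
  using X1 X2 Y1 Y2 by (auto simp: field_C1_def)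

definition mode_density :: "bool \<Rightarrow> nat \<Rightarrow> real \<Rightarrow> real" where
  "mode_density ph m t = mode_dens L K m (mX1 ph m t) (mX2 ph m t) (mY1 ph m t) (mY2 ph m t)
     (mode_c ph m (x1t t)) (mode_s ph m (x2t t)) (mode_c ph m (y1t t)) (mode_s ph m (y2t t))
   - mu2 t * ((srcF (mX1 ph m) (mY1 ph m) t)\<^sup>2 + (srcG (mX2 ph m) (mY2 ph m) t)\<^sup>2)"

definition src_theta :: "real \<Rightarrow> real" where
  "src_theta t = mu2 t *
     (integral {0..2 * pi} (\<lambda>\<theta>. (srcF (\<lambda>t. x1\<theta> t \<theta>) (\<lambda>t. y1\<theta> t \<theta>) t)\<^sup>2)
    + integral {0..2 * pi} (\<lambda>\<theta>. (srcG (\<lambda>t. x2\<theta> t \<theta>) (\<lambda>t. y2\<theta> t \<theta>) t)\<^sup>2))"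

lemma cont2_energy_dens: "cont2 (energy_dens x1 x2 y1 y2 x1t x2t y1t y2t x1\<theta> x2\<theta> y1\<theta> y2\<theta>)"
  unfolding energy_dens_def[abs_def]
  by (intro cont2_intros cont2_fields cont2_src continuous_intros)

text \<open>The eight squares of derivatives are bounded below by Bessel. The two source terms have
  a negative sign and are linear in the undifferentiated components with coefficients in
  \<open>t\<close>, so they are bounded above by the Parseval inequality with remainder.\<close>

lemma slice_bound:
  assumes t: "t \<in> J" and N: "N > 0"
  shows "modes_sum N (\<lambda>m ph. mode_density ph m t) - fourier_tail N * src_theta t
    \<le> integral {0..2 * pi} (energy_dens x1 x2 y1 y2 x1t x2t y1t y2t x1\<theta> x2\<theta> y1\<theta> y2\<theta> t)"
proof -
  let ?I = "\<lambda>f :: real \<Rightarrow> real. integral {0..2 * pi} (\<lambda>\<theta>. (f \<theta>)\<^sup>2)"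
  let ?F = "\<lambda>\<theta>. srcF (\<lambda>t. x1 t \<theta>) (\<lambda>t. y1 t \<theta>) t" and ?G = "\<lambda>\<theta>. srcG (\<lambda>t. x2 t \<theta>) (\<lambda>t. y2 t \<theta>) t"
  let ?F\<theta> = "\<lambda>\<theta>. srcF (\<lambda>t. x1\<theta> t \<theta>) (\<lambda>t. y1\<theta> t \<theta>) t" and ?G\<theta> = "\<lambda>\<theta>. srcG (\<lambda>t. x2\<theta> t \<theta>) (\<lambda>t. y2\<theta> t \<theta>) t"
  note cs = cont2_fields[THEN cont2_slice[OF _ t]]
  note csrc = cont2_src(1)[THEN cont2_slice[OF _ t]] cont2_src(2)[THEN cont2_slice[OF _ t]]
  have ci: "continuous_on {0..2 * pi} f \<Longrightarrow> (\<lambda>\<theta>. (f \<theta>)\<^sup>2) integrable_on {0..2 * pi}" for f :: "real \<Rightarrow> real"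
    by (intro integrable_continuous_real continuous_intros)
  have E: "integral {0..2 * pi} (energy_dens x1 x2 y1 y2 x1t x2t y1t y2t x1\<theta> x2\<theta> y1\<theta> y2\<theta> t) =
     ?I (x1t t) + ?I (x2t t) + ?I (y1t t) + ?I (y2t t)
     + ?I (\<lambda>\<theta>. 1 * x1\<theta> t \<theta> + (- L) * x2 t \<theta>) + ?I (\<lambda>\<theta>. 1 * x2\<theta> t \<theta> + L * x1 t \<theta>)
     + ?I (\<lambda>\<theta>. 1 * y1\<theta> t \<theta> + (- K) * y2 t \<theta>) + ?I (\<lambda>\<theta>. 1 * y2\<theta> t \<theta> + K * y1 t \<theta>)
     - mu2 t * (?I ?F + ?I ?G)"
  proof -
    have "((\<lambda>\<theta>. (x1t t \<theta>)\<^sup>2 + (x2t t \<theta>)\<^sup>2 + (y1t t \<theta>)\<^sup>2 + (y2t t \<theta>)\<^sup>2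
       + (1 * x1\<theta> t \<theta> + (- L) * x2 t \<theta>)\<^sup>2 + (1 * x2\<theta> t \<theta> + L * x1 t \<theta>)\<^sup>2
       + (1 * y1\<theta> t \<theta> + (- K) * y2 t \<theta>)\<^sup>2 + (1 * y2\<theta> t \<theta> + K * y1 t \<theta>)\<^sup>2
       - mu2 t * ((?F \<theta>)\<^sup>2 + (?G \<theta>)\<^sup>2)) has_integral
       (?I (x1t t) + ?I (x2t t) + ?I (y1t t) + ?I (y2t t)
     + ?I (\<lambda>\<theta>. 1 * x1\<theta> t \<theta> + (- L) * x2 t \<theta>) + ?I (\<lambda>\<theta>. 1 * x2\<theta> t \<theta> + L * x1 t \<theta>)
     + ?I (\<lambda>\<theta>. 1 * y1\<theta> t \<theta> + (- K) * y2 t \<theta>) + ?I (\<lambda>\<theta>. 1 * y2\<theta> t \<theta> + K * y1 t \<theta>)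
     - mu2 t * (?I ?F + ?I ?G))) {0..2 * pi}"
      by (intro has_integral_diff has_integral_add has_integral_mult_right integrable_integral ci
          continuous_intros cs csrc cont2_fields)
    then show ?thesis by (simp add: energy_dens_def[abs_def] integral_unique)
  qed
  note b = bessel_modes[where N = N]
  note lin = coeff_linear[OF cs(9) cs(2)] coeff_linear[OF cs(10) cs(1)] coeff_linear[OF cs(11) cs(4)]
    coeff_linear[OF cs(12) cs(3)]
  note th = field_coeff_theta[OF X1 t] field_coeff_theta[OF X2 t] field_coeff_theta[OF Y1 t] field_coeff_theta[OF Y2 t]
  have k: "modes_sum N (\<lambda>m ph. (real m * mX1 ph m t + L * mX2 ph m t)\<^sup>2) \<le> ?I (\<lambda>\<theta>. 1 * x1\<theta> t \<theta> + (- L) * x2 t \<theta>)"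
    "modes_sum N (\<lambda>m ph. (real m * mX2 ph m t + L * mX1 ph m t)\<^sup>2) \<le> ?I (\<lambda>\<theta>. 1 * x2\<theta> t \<theta> + L * x1 t \<theta>)"
    "modes_sum N (\<lambda>m ph. (real m * mY1 ph m t + K * mY2 ph m t)\<^sup>2) \<le> ?I (\<lambda>\<theta>. 1 * y1\<theta> t \<theta> + (- K) * y2 t \<theta>)"
    "modes_sum N (\<lambda>m ph. (real m * mY2 ph m t + K * mY1 ph m t)\<^sup>2) \<le> ?I (\<lambda>\<theta>. 1 * y2\<theta> t \<theta> + K * y1 t \<theta>)"
  proof -
    have sq: "(- (real m * a) - L * b)\<^sup>2 = (real m * a + L * b)\<^sup>2" for m a b L
      by (simp add: power2_eq_square algebra_simps)
    show "modes_sum N (\<lambda>m ph. (real m * mX1 ph m t + L * mX2 ph m t)\<^sup>2) \<le> ?I (\<lambda>\<theta>. 1 * x1\<theta> t \<theta> + (- L) * x2 t \<theta>)"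
      using b(2)[of "\<lambda>\<theta>. 1 * x1\<theta> t \<theta> + (- L) * x2 t \<theta>"] unfolding lin th
      by (simp add: sq continuous_intros cs)
    show "modes_sum N (\<lambda>m ph. (real m * mX2 ph m t + L * mX1 ph m t)\<^sup>2) \<le> ?I (\<lambda>\<theta>. 1 * x2\<theta> t \<theta> + L * x1 t \<theta>)"
      using b(1)[of "\<lambda>\<theta>. 1 * x2\<theta> t \<theta> + L * x1 t \<theta>"] unfolding lin th
      by (simp add: continuous_intros cs)
    show "modes_sum N (\<lambda>m ph. (real m * mY1 ph m t + K * mY2 ph m t)\<^sup>2) \<le> ?I (\<lambda>\<theta>. 1 * y1\<theta> t \<theta> + (- K) * y2 t \<theta>)"
      using b(2)[of "\<lambda>\<theta>. 1 * y1\<theta> t \<theta> + (- K) * y2 t \<theta>"] unfolding lin th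
      by (simp add: sq continuous_intros cs)
    show "modes_sum N (\<lambda>m ph. (real m * mY2 ph m t + K * mY1 ph m t)\<^sup>2) \<le> ?I (\<lambda>\<theta>. 1 * y2\<theta> t \<theta> + K * y1 t \<theta>)"
      using b(1)[of "\<lambda>\<theta>. 1 * y2\<theta> t \<theta> + K * y1 t \<theta>"] unfolding lin th
      by (simp add: continuous_intros cs)
  qed
  have F: "?I ?F \<le> modes_sum N (\<lambda>m ph. (srcF (mX1 ph m) (mY1 ph m) t)\<^sup>2) + fourier_tail N * ?I ?F\<theta>"
    unfolding srcF_linear by (rule parseval_linear_modes(1)[OF X1 Y1 t N])
  have G: "?I ?G \<le> modes_sum N (\<lambda>m ph. (srcG (mX2 ph m) (mY2 ph m) t)\<^sup>2) + fourier_tail N * ?I ?G\<theta>"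
    unfolding srcG_linear by (rule parseval_linear_modes(2)[OF X2 Y2 t N])
  have FG: "mu2 t * (?I ?F + ?I ?G) \<le> mu2 t * (modes_sum N (\<lambda>m ph. (srcF (mX1 ph m) (mY1 ph m) t)\<^sup>2)
     + modes_sum N (\<lambda>m ph. (srcG (mX2 ph m) (mY2 ph m) t)\<^sup>2)) + fourier_tail N * src_theta t"
  proof -
    have "mu2 t * (?I ?F + ?I ?G) \<le> mu2 t * (modes_sum N (\<lambda>m ph. (srcF (mX1 ph m) (mY1 ph m) t)\<^sup>2) + fourier_tail N * ?I ?F\<theta>
      + (modes_sum N (\<lambda>m ph. (srcG (mX2 ph m) (mY2 ph m) t)\<^sup>2) + fourier_tail N * ?I ?G\<theta>))"
      by (intro mult_left_mono add_mono F G less_imp_le mu2_pos)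
    then show ?thesis by (simp add: src_theta_def algebra_simps)
  qed
  have "modes_sum N (\<lambda>m ph. mode_density ph m t) =
     modes_sum N (\<lambda>m ph. (mode_c ph m (x1t t))\<^sup>2) + modes_sum N (\<lambda>m ph. (mode_s ph m (x2t t))\<^sup>2)
     + modes_sum N (\<lambda>m ph. (mode_c ph m (y1t t))\<^sup>2) + modes_sum N (\<lambda>m ph. (mode_s ph m (y2t t))\<^sup>2)
     + modes_sum N (\<lambda>m ph. (real m * mX1 ph m t + L * mX2 ph m t)\<^sup>2)
     + modes_sum N (\<lambda>m ph. (real m * mX2 ph m t + L * mX1 ph m t)\<^sup>2)
     + modes_sum N (\<lambda>m ph. (real m * mY1 ph m t + K * mY2 ph m t)\<^sup>2)
     + modes_sum N (\<lambda>m ph. (real m * mY2 ph m t + K * mY1 ph m t)\<^sup>2)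
     - mu2 t * (modes_sum N (\<lambda>m ph. (srcF (mX1 ph m) (mY1 ph m) t)\<^sup>2)
     + modes_sum N (\<lambda>m ph. (srcG (mX2 ph m) (mY2 ph m) t)\<^sup>2))"
    unfolding mode_density_def mode_dens_def modes_sum_add modes_sum_diff modes_sum_mult by simp
  then show ?thesis
    unfolding E using k FG b(1)[OF cs(5)] b(2)[OF cs(6)] b(1)[OF cs(7)] b(2)[OF cs(8)] by linarith
qed

lemma boundary_bound:
  assumes t: "t \<in> J" and N: "N > 0"
  shows "integral {0..2 * pi} (\<lambda>\<theta>. (x1 t \<theta>)\<^sup>2 + (x2 t \<theta>)\<^sup>2 + (y1 t \<theta>)\<^sup>2 + (y2 t \<theta>)\<^sup>2) \<le>
    modes_sum N (\<lambda>m ph. (mX1 ph m t)\<^sup>2 + (mX2 ph m t)\<^sup>2 + (mY1 ph m t)\<^sup>2 + (mY2 ph m t)\<^sup>2)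
    + fourier_tail N * integral {0..2 * pi} (\<lambda>\<theta>. (x1\<theta> t \<theta>)\<^sup>2 + (x2\<theta> t \<theta>)\<^sup>2 + (y1\<theta> t \<theta>)\<^sup>2 + (y2\<theta> t \<theta>)\<^sup>2)"
proof -
  let ?I = "\<lambda>f :: real \<Rightarrow> real. integral {0..2 * pi} (\<lambda>\<theta>. (f \<theta>)\<^sup>2)"
  note cs = cont2_fields[THEN cont2_slice[OF _ t]]
  have sp: "integral {0..2 * pi} (\<lambda>\<theta>. (f1 \<theta>)\<^sup>2 + (f2 \<theta>)\<^sup>2 + (f3 \<theta>)\<^sup>2 + (f4 \<theta>)\<^sup>2) = ?I f1 + ?I f2 + ?I f3 + ?I f4"
    if "continuous_on {0..2 * pi} f1" "continuous_on {0..2 * pi} f2" "continuous_on {0..2 * pi} f3"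
      "continuous_on {0..2 * pi} f4" for f1 f2 f3 f4 :: "real \<Rightarrow> real"
    by (rule integral_unique)
       (intro has_integral_add integrable_integral integrable_continuous_real continuous_intros that)
  have p: "?I (x1 t) \<le> modes_sum N (\<lambda>m ph. (mX1 ph m t)\<^sup>2) + fourier_tail N * ?I (x1\<theta> t)"
    "?I (x2 t) \<le> modes_sum N (\<lambda>m ph. (mX2 ph m t)\<^sup>2) + fourier_tail N * ?I (x2\<theta> t)"
    "?I (y1 t) \<le> modes_sum N (\<lambda>m ph. (mY1 ph m t)\<^sup>2) + fourier_tail N * ?I (y1\<theta> t)"
    "?I (y2 t) \<le> modes_sum N (\<lambda>m ph. (mY2 ph m t)\<^sup>2) + fourier_tail N * ?I (y2\<theta> t)"
    using X1 X2 Y1 Y2 t by (intro parseval_modes N cs; simp add: field_C1_def)+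
  show ?thesis
    unfolding sp[OF cs(1-4)] sp[OF cs(9-12)] modes_sum_add distrib_left using p by linarith
qed

text \<open>For each \<open>N\<close> the first \<open>N\<close> modes contribute a nonnegative
  amount, and the deficit is at most \<open>fourier_tail N\<close> times a fixed number. No exchange
  of limit and integral occurs.\<close>

theorem area_form_nonneg:
  assumes n1: "\<And>t \<theta>. t \<in> J \<Longrightarrow> x1 t \<theta> * cosh (L * t) + y1 t \<theta> * sinh (K * t) = 0"
    and n2: "\<And>t \<theta>. t \<in> J \<Longrightarrow> x2 t \<theta> * sinh (L * t) + y2 t \<theta> * cosh (K * t) = 0"
    and conds: "\<And>ph m c. cond_active (real m) c \<Longrightarrow>
      mode_functional (real m) c (mX1 ph m) (mX2 ph m) (mY1 ph m) (mY2 ph m) = 0"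
  shows "0 \<le> area_form x1 x2 y1 y2 x1t x2t y1t y2t x1\<theta> x2\<theta> y1\<theta> y2\<theta>"
proof -
  let ?A = "\<lambda>t. integral {0..2 * pi} (energy_dens x1 x2 y1 y2 x1t x2t y1t y2t x1\<theta> x2\<theta> y1\<theta> y2\<theta> t)"
  let ?b = "\<lambda>t. integral {0..2 * pi} (\<lambda>\<theta>. (x1 t \<theta>)\<^sup>2 + (x2 t \<theta>)\<^sup>2 + (y1 t \<theta>)\<^sup>2 + (y2 t \<theta>)\<^sup>2)"
  let ?b\<theta> = "\<lambda>t. integral {0..2 * pi} (\<lambda>\<theta>. (x1\<theta> t \<theta>)\<^sup>2 + (x2\<theta> t \<theta>)\<^sup>2 + (y1\<theta> t \<theta>)\<^sup>2 + (y2\<theta> t \<theta>)\<^sup>2)"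
  let ?bm = "\<lambda>t m ph. (mX1 ph m t)\<^sup>2 + (mX2 ph m t)\<^sup>2 + (mY1 ph m t)\<^sup>2 + (mY2 ph m t)\<^sup>2"
  \<comment> \<open>Collects the \<open>\<theta>\<close>-derivative norms from all Parseval errors;
    it is independent of \<open>N\<close>.\<close>
  define Z where "Z = integral J src_theta + h * (?b\<theta> T + ?b\<theta> (-T))"
  have TJ: "T \<in> J" "-T \<in> J" using T_pos by auto
  have form: "area_form x1 x2 y1 y2 x1t x2t y1t y2t x1\<theta> x2\<theta> y1\<theta> y2\<theta> = integral J ?A - h * (?b T + ?b (-T))"
    using T_pos by (simp add: area_form_def add.commute)
  have cm: "continuous_on J (mode_density ph m)" for ph m
    unfolding mode_density_def[abs_def] mode_dens_def
    by (intro continuous_intros continuous_src cont2_coeff cont2_fields)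
  have cs: "continuous_on J src_theta"
    unfolding src_theta_def[abs_def]
    by (intro continuous_intros cont2_integral cont2_intros cont2_src cont2_fields)
  have nn: "0 \<le> mode_form (real m) (mX1 ph m) (mX2 ph m) (mY1 ph m) (mY2 ph m) (\<lambda>t. mode_c ph m (x1t t))
     (\<lambda>t. mode_s ph m (x2t t)) (\<lambda>t. mode_c ph m (y1t t)) (\<lambda>t. mode_s ph m (y2t t))" for ph m
  proof (rule mode_form_nonneg)
    fix t assume t: "t \<in> J"
    note cs = cont2_fields[THEN cont2_slice[OF _ t]]
    have "mX1 ph m t * cosh (L * t) + mY1 ph m t * sinh (K * t) =
        mode_c ph m (\<lambda>\<theta>. cosh (L * t) * x1 t \<theta> + sinh (K * t) * y1 t \<theta>)"
      by (subst coeff_linear) (auto intro: cs)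
    also have "(\<lambda>\<theta>. cosh (L * t) * x1 t \<theta> + sinh (K * t) * y1 t \<theta>) = (\<lambda>\<theta>. 0)"
      using n1[OF t] by (simp add: mult.commute)
    finally show "mX1 ph m t * cosh (L * t) + mY1 ph m t * sinh (K * t) = 0"
      by (simp add: mode_c_def cos_coeff_def sin_coeff_def)
    have "mX2 ph m t * sinh (L * t) + mY2 ph m t * cosh (K * t) =
        mode_s ph m (\<lambda>\<theta>. sinh (L * t) * x2 t \<theta> + cosh (K * t) * y2 t \<theta>)"
      by (subst coeff_linear) (auto intro: cs)
    also have "(\<lambda>\<theta>. sinh (L * t) * x2 t \<theta> + cosh (K * t) * y2 t \<theta>) = (\<lambda>\<theta>. 0)"
      using n2[OF t] by (simp add: mult.commute)
    finally show "mX2 ph m t * sinh (L * t) + mY2 ph m t * cosh (K * t) = 0"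
      by (simp add: mode_s_def cos_coeff_def sin_coeff_def)
  qed (auto intro: DERIV_coeff[OF X1] DERIV_coeff[OF X2] DERIV_coeff[OF Y1] DERIV_coeff[OF Y2]
      cont2_coeff cont2_fields conds)
  have lower: "- (fourier_tail N * Z) \<le> integral J ?A - h * (?b T + ?b (-T))" if N: "N > 0" for N
  proof -
    have "((\<lambda>t. modes_sum N (\<lambda>m ph. mode_density ph m t) - fourier_tail N * src_theta t) has_integral
        (modes_sum N (\<lambda>m ph. integral J (mode_density ph m)) - fourier_tail N * integral J src_theta)) J"
      unfolding modes_sum_def
      by (intro has_integral_diff has_integral_sum has_integral_mult_right integrable_integral
          integrable_continuous_real cm cs) auto
    then have 1: "modes_sum N (\<lambda>m ph. integral J (mode_density ph m)) - fourier_tail N * integral J src_theta \<le> integral J ?A"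
      by (rule has_integral_le[OF _ integrable_integral])
         (auto intro!: integrable_continuous_real cont2_integral cont2_energy_dens slice_bound N)
    have 2: "h * (?b T + ?b (-T)) \<le> h * ((modes_sum N (?bm T) + fourier_tail N * ?b\<theta> T)
        + (modes_sum N (?bm (-T)) + fourier_tail N * ?b\<theta> (-T)))"
      using h_pos by (intro mult_left_mono add_mono boundary_bound TJ N) auto
    have "0 \<le> modes_sum N (\<lambda>m ph. integral J (mode_density ph m) - h * (?bm T m ph + ?bm (-T) m ph))"
      using nn by (intro modes_sum_nonneg) (simp add: mode_form_def mode_density_def[abs_def] add.assoc)
    also have "\<dots> = modes_sum N (\<lambda>m ph. integral J (mode_density ph m)) - h * (modes_sum N (?bm T) + modes_sum N (?bm (-T)))"
      unfolding modes_sum_diff modes_sum_mult modes_sum_add by simp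
    finally have 3: "0 \<le> modes_sum N (\<lambda>m ph. integral J (mode_density ph m)) - h * (modes_sum N (?bm T) + modes_sum N (?bm (-T)))" .
    have "fourier_tail N * Z = fourier_tail N * integral J src_theta + h * (fourier_tail N * ?b\<theta> T) + h * (fourier_tail N * ?b\<theta> (-T))"
      unfolding Z_def by (simp add: algebra_simps)
    then show ?thesis using 1 2 3 unfolding distrib_left by linarith
  qed
  have "(\<lambda>N. - (fourier_tail N * Z)) \<longlonglongrightarrow> - (0 * Z)"
    by (intro tendsto_intros fourier_tail_tendsto_0)
  then have "- (0 * Z) \<le> integral J ?A - h * (?b T + ?b (-T))"
    by (rule LIMSEQ_le_const2) (intro exI[of _ 1] allI impI lower, simp)
  then show ?thesis unfolding form by simp
qed

end

end

section \<open>The list of functionals\<close>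

context fs_data begin

lemma mode_functional_linear:
  assumes c: "continuous_on J x1" "continuous_on J x2" "continuous_on J y1" "continuous_on J y2"
      "continuous_on J u1" "continuous_on J u2" "continuous_on J v1" "continuous_on J v2"
    and z: "\<And>t. t \<in> J \<Longrightarrow> z1 t = a * x1 t + b * u1 t" "\<And>t. t \<in> J \<Longrightarrow> z2 t = a * x2 t + b * u2 t"
      "\<And>t. t \<in> J \<Longrightarrow> w1 t = a * y1 t + b * v1 t" "\<And>t. t \<in> J \<Longrightarrow> w2 t = a * y2 t + b * v2 t"
  shows "mode_functional m e z1 z2 w1 w2 =
    a * mode_functional m e x1 x2 y1 y2 + b * mode_functional m e u1 u2 v1 v2"
proof -
  have F: "srcF z1 w1 t = a * srcF x1 y1 t + b * srcF u1 v1 t" if "t \<in> J" for t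
    unfolding srcF_linear z(1)[OF that] z(3)[OF that] by (simp add: algebra_simps add_divide_distrib)
  have G: "srcG z2 w2 t = a * srcG x2 y2 t + b * srcG u2 v2 t" if "t \<in> J" for t
    unfolding srcG_linear z(2)[OF that] z(4)[OF that] by (simp add: algebra_simps add_divide_distrib)
  have "((\<lambda>t. a * (exp (- m * t) * (srcF x1 y1 t + srcG x2 y2 t)) + b * (exp (- m * t) * (srcF u1 v1 t + srcG u2 v2 t)))
     has_integral (a * moment_p m (srcF x1 y1) (srcG x2 y2) + b * moment_p m (srcF u1 v1) (srcG u2 v2))) J"
    unfolding moment_p_def
    by (intro has_integral_add has_integral_mult_right integrable_integral integrable_continuous_real
        continuous_intros continuous_src c)
  then have "((\<lambda>t. exp (- m * t) * (srcF z1 w1 t + srcG z2 w2 t))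
     has_integral (a * moment_p m (srcF x1 y1) (srcG x2 y2) + b * moment_p m (srcF u1 v1) (srcG u2 v2))) J"
    by (rule has_integral_eq[rotated]) (simp add: F G algebra_simps)
  then have I: "moment_p m (srcF z1 w1) (srcG z2 w2) =
      a * moment_p m (srcF x1 y1) (srcG x2 y2) + b * moment_p m (srcF u1 v1) (srcG u2 v2)"
    unfolding moment_p_def[of m "srcF z1 w1"] by (rule integral_unique)
  have "((\<lambda>t. a * (exp (m * t) * (srcF x1 y1 t - srcG x2 y2 t)) + b * (exp (m * t) * (srcF u1 v1 t - srcG u2 v2 t)))
     has_integral (a * moment_m m (srcF x1 y1) (srcG x2 y2) + b * moment_m m (srcF u1 v1) (srcG u2 v2))) J"
    unfolding moment_m_def
    by (intro has_integral_add has_integral_mult_right integrable_integral integrable_continuous_real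
        continuous_intros continuous_src c)
  then have "((\<lambda>t. exp (m * t) * (srcF z1 w1 t - srcG z2 w2 t))
     has_integral (a * moment_m m (srcF x1 y1) (srcG x2 y2) + b * moment_m m (srcF u1 v1) (srcG u2 v2))) J"
    by (rule has_integral_eq[rotated]) (simp add: F G algebra_simps)
  then have J': "moment_m m (srcF z1 w1) (srcG z2 w2) =
      a * moment_m m (srcF x1 y1) (srcG x2 y2) + b * moment_m m (srcF u1 v1) (srcG u2 v2)"
    unfolding moment_m_def[of m "srcF z1 w1"] by (rule integral_unique)
  have cr: "cr_const m (a * I1 + b * I2) (a * J1 + b * J2) = a * cr_const m I1 J1 + b * cr_const m I2 J2" for I1 I2 J1 J2
    by (simp add: cr_const_def algebra_simps add_divide_distrib diff_divide_distrib)
  have TJ: "T \<in> J" "-T \<in> J" using T_pos by auto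
  show ?thesis
    unfolding mode_functional_def Let_def I J' psi_left_def psi_right_def cr z[OF TJ(1)] z[OF TJ(2)]
    by (cases e) (simp_all add: algebra_simps)
qed

text \<open>In this phase of the zero mode \<open>srcF\<close> vanishes and the two moments are
  opposite. The cokernel is thus met by the other phase alone, which accounts for the single
  \<open>+ 1\<close> in the count.\<close>

lemma functional_solv_sine:
  assumes "x1 = (\<lambda>t. 0)" "y1 = (\<lambda>t. 0)"
  shows "mode_functional 0 Solv x1 x2 y1 y2 = 0"
  by (simp add: assms mode_functional_def moment_p_def moment_m_def srcF_def Let_def)

text \<open>At \<open>m = 0\<close> the frequencies \<open>L + m\<close> and \<open>L - m\<close>
  coincide, and in either phase only one of the two amplitudes survives, so the two conditions agree
  up to sign. In the phase with \<open>x2 = 0\<close> the solvability condition also makes the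
  correction vanish at both ends.\<close>

lemma functional_even1p_zero_mode:
  assumes "mode_functional 0 Even1m x1 x2 y1 y2 = 0"
    and "x1 = (\<lambda>t. 0) \<or> x2 = (\<lambda>t. 0) \<and> y2 = (\<lambda>t. 0) \<and> mode_functional 0 Solv x1 x2 y1 y2 = 0"
  shows "mode_functional 0 Even1p x1 x2 y1 y2 = 0"
  using assms(2)
proof
  assume "x1 = (\<lambda>t. 0)"
  then show ?thesis using assms(1) by (simp add: mode_functional_def Let_def)
next
  assume h: "x2 = (\<lambda>t. 0) \<and> y2 = (\<lambda>t. 0) \<and> mode_functional 0 Solv x1 x2 y1 y2 = 0"
  have "srcG x2 y2 = (\<lambda>t. 0)" using h by (auto simp: srcG_def)
  with h have "moment_p 0 (srcF x1 y1) (srcG x2 y2) = 0"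
    by (simp add: mode_functional_def moment_p_def moment_m_def Let_def)
  then show ?thesis using assms(1) h
    by (simp add: mode_functional_def Let_def psi_left_def psi_right_def cr_const_def)
qed

lemma integral_reflect_J: "integral J (\<lambda>t. f (- t)) = integral J f" for f :: "real \<Rightarrow> real"
  using Henstock_Kurzweil_Integration.integral_reflect_real[of T "-T" f] by simp

text \<open>Used with \<open>s = (-1) ^ m\<close>, the sign by which the deck transformation of the
  Moebius band acts on the mode. The sources have parity \<open>s\<close> and \<open>- s\<close>, so
  the second moment is \<open>s\<close> times the first and the correction satisfies
  \<open>\<psi> T = s * \<psi> (-T)\<close>; each listed functional then adds or subtracts equal
  quantities.\<close>

lemma functional_parity:
  assumes s: "s = 1 \<or> s = -1" and s0: "m = 0 \<Longrightarrow> s = 1"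
    and par: "\<And>t. t \<in> J \<Longrightarrow> x1 (- t) = - s * x1 t" "\<And>t. t \<in> J \<Longrightarrow> x2 (- t) = - s * x2 t"
      "\<And>t. t \<in> J \<Longrightarrow> y1 (- t) = s * y1 t" "\<And>t. t \<in> J \<Longrightarrow> y2 (- t) = s * y2 t"
    and m: "0 \<le> m" and solv: "m = 0 \<Longrightarrow> mode_functional m Solv x1 x2 y1 y2 = 0"
  shows "s = 1 \<Longrightarrow> mode_functional m Even1p x1 x2 y1 y2 = 0"
    "s = 1 \<Longrightarrow> mode_functional m Even1m x1 x2 y1 y2 = 0"
    "s = 1 \<Longrightarrow> mode_functional m Odd2m x1 x2 y1 y2 = 0"
    "s = -1 \<Longrightarrow> mode_functional m Even2m x1 x2 y1 y2 = 0"
    "s = -1 \<Longrightarrow> mode_functional m Odd1m x1 x2 y1 y2 = 0"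
proof -
  define I1 J1 where "I1 = moment_p m (srcF x1 y1) (srcG x2 y2)" and "J1 = moment_m m (srcF x1 y1) (srcG x2 y2)"
  have s2: "s * s = 1" using s by auto
  have mu: "mu2 (- t) = mu2 t" for t by (simp add: mu2_def)
  have F: "srcF x1 y1 (- t) = s * srcF x1 y1 t" if "t \<in> J" for t
    using that by (simp add: srcF_linear par mu algebra_simps)
  have G: "srcG x2 y2 (- t) = - s * srcG x2 y2 t" if "t \<in> J" for t
    using that by (simp add: srcG_linear par mu algebra_simps)
  have "J1 = integral J (\<lambda>t. exp (m * - t) * (srcF x1 y1 (- t) - srcG x2 y2 (- t)))"
    unfolding J1_def moment_m_def by (rule integral_reflect_J[symmetric])
  also have "\<dots> = integral J (\<lambda>t. s * (exp (- m * t) * (srcF x1 y1 t + srcG x2 y2 t)))"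
    by (rule integral_cong) (simp add: F G algebra_simps)
  finally have J1: "J1 = s * I1" by (simp add: I1_def moment_p_def)
  have psi: "psi_right m I1 J1 = s * psi_left m I1 J1"
  proof (cases "m = 0")
    \<comment> \<open>Here \<open>s = 1\<close>, so both moments are equal and the solvability
      condition kills them.\<close>
    case True
    then have "I1 + s * I1 = 0" using solv J1 by (simp add: mode_functional_def I1_def J1_def)
    then show ?thesis using True s0 J1 by (auto simp: psi_left_def psi_right_def cr_const_def)
  next
    case False
    define e where "e = exp (- m * T)"
    define E where "E = exp (m * T)"
    have e: "exp (- 3 * m * T) = e ^ 3"
      unfolding e_def using exp_of_nat_mult[of 3 "- m * T"] by (simp add: algebra_simps)
    have Ee: "E * e = 1" unfolding E_def e_def by (simp add: exp_add[symmetric])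
    have "E > 1" "e < 1" "0 < e" using m False T_pos by (simp_all add: E_def e_def)
    then have nz: "E - e ^ 3 \<noteq> 0" using power_le_one[of e 3] by simp
    define C where "C = cr_const m I1 J1"
    have "C = - (E * I1 + e * J1) / (E - e ^ 3)"
      unfolding C_def cr_const_def e E_def e_def by (rule refl)
    then have C: "C * (E - e ^ 3) = - (E * I1 + e * J1)" using nz by simp
    have "(E - e ^ 3) * (E * (C + I1) - s * (e * C)) = 0"
    proof -
      have "(E - e ^ 3) * (E * (C + I1) - s * (e * C))
        = (E - s * e) * (C * (E - e ^ 3)) + E * E * I1 - (E * e) * e\<^sup>2 * I1"
        by (simp add: algebra_simps power2_eq_square power3_eq_cube)
      also have "\<dots> = - (E * e) * s * I1 + (s * s) * e * e * I1 + s * (E * e) * I1 - (E * e) * e\<^sup>2 * I1"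
        unfolding C J1 by (simp add: algebra_simps)
      also have "\<dots> = 0" unfolding s2 Ee by (simp add: power2_eq_square)
      finally show ?thesis .
    qed
    then have "E * (C + I1) = s * (e * C)" using nz by simp
    then show ?thesis by (simp add: psi_left_def psi_right_def C_def E_def e_def)
  qed
  have TJ: "T \<in> J" using T_pos by auto
  note p = par[OF TJ]
  note d = mode_functional_def Let_def I1_def[symmetric] J1_def[symmetric]
  show "s = 1 \<Longrightarrow> mode_functional m Even1p x1 x2 y1 y2 = 0"
    "s = 1 \<Longrightarrow> mode_functional m Even1m x1 x2 y1 y2 = 0"
    "s = 1 \<Longrightarrow> mode_functional m Odd2m x1 x2 y1 y2 = 0"
    "s = -1 \<Longrightarrow> mode_functional m Even2m x1 x2 y1 y2 = 0"
    "s = -1 \<Longrightarrow> mode_functional m Odd1m x1 x2 y1 y2 = 0"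
    unfolding d p psi by simp_all
qed

end

text \<open>The integers for which the condition is active, except that \<open>Solv\<close> is
  listed separately and \<open>Even1p\<close> omits 0, where it repeats
  \<open>Even1m\<close>.\<close>

fun cond_modes :: "nat \<Rightarrow> nat \<Rightarrow> mode_cond \<Rightarrow> nat set" where
  "cond_modes l k Solv = {}"
| "cond_modes l k Even1p = {1..<k - l}"
| "cond_modes l k Even1m = {..<k + l}"
| "cond_modes l k Even2m = {1..<2 * k}"
| "cond_modes l k Odd1m = {1..<2 * l}"
| "cond_modes l k Odd2m = {k - l + 1..<k + l}"

text \<open>The modes in which the condition survives on the Moebius band; in the others
  \<open>functional_parity\<close> makes it automatic.\<close>

fun cond_parity :: "mode_cond \<Rightarrow> nat \<Rightarrow> bool" where
  "cond_parity Solv m \<longleftrightarrow> True"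
| "cond_parity Even1p m \<longleftrightarrow> odd m"
| "cond_parity Even1m m \<longleftrightarrow> odd m"
| "cond_parity Even2m m \<longleftrightarrow> even m"
| "cond_parity Odd1m m \<longleftrightarrow> even m"
| "cond_parity Odd2m m \<longleftrightarrow> odd m"

definition annulus_conds :: "nat \<Rightarrow> nat \<Rightarrow> (mode_cond \<times> bool \<times> nat) set" where
  "annulus_conds l k = insert (Solv, True, 0)
     (SIGMA c:{Even1p, Even1m, Even2m, Odd1m, Odd2m}. UNIV \<times> cond_modes l k c)"

definition moebius_conds :: "nat \<Rightarrow> nat \<Rightarrow> (mode_cond \<times> bool \<times> nat) set" where
  "moebius_conds l k = insert (Solv, True, 0)
     (SIGMA c:{Even1p, Even1m, Even2m, Odd1m, Odd2m}. UNIV \<times> {m \<in> cond_modes l k c. cond_parity c m})"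

lemma finite_cond_modes: "finite (cond_modes l k c)"
  by (cases c) auto

lemma finite_conds: "finite (annulus_conds l k)" "finite (moebius_conds l k)"
  by (auto simp: annulus_conds_def moebius_conds_def finite_cond_modes)

text \<open>The five ranges have \<open>k - l - 1\<close>, \<open>k + l\<close>,
  \<open>2 * k - 1\<close>, \<open>2 * l - 1\<close> and \<open>2 * l - 1\<close> elements, together
  \<open>4 * (k + l) - 4\<close>. The two phases double this and \<open>Solv\<close> adds
  one.\<close>

lemma card_annulus_conds:
  assumes "0 < l" "l < k"
  shows "card (annulus_conds l k) = 8 * (k + l) - 7"
proof -
  have "card (annulus_conds l k) = Suc (\<Sum>c\<in>{Even1p, Even1m, Even2m, Odd1m, Odd2m}. card (UNIV \<times> cond_modes l k c :: (bool \<times> nat) set))"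
    unfolding annulus_conds_def by (subst card_insert_disjoint) (auto simp: finite_cond_modes card_SigmaI)
  also have "\<dots> = 8 * (k + l) - 7"
    using assms by (simp add: card_cartesian_product UNIV_bool)
  finally show ?thesis .
qed

lemma card_odd_less: "card {m \<in> {..<n}. odd m} = n div 2" for n :: nat
proof (induction n)
  case (Suc n)
  have "{m \<in> {..<Suc n}. odd m} = (if odd n then insert n {m \<in> {..<n}. odd m} else {m \<in> {..<n}. odd m})"
    by (auto simp: less_Suc_eq)
  then show ?case using Suc by (auto elim!: oddE)
qed simp

lemma card_even_less: "card {m \<in> {..<n}. even m} = (n + 1) div 2" for n :: nat
proof (induction n)
  case (Suc n)
  have "{m \<in> {..<Suc n}. even m} = (if even n then insert n {m \<in> {..<n}. even m} else {m \<in> {..<n}. even m})"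
    by (auto simp: less_Suc_eq)
  then show ?case using Suc by (auto elim!: oddE)
qed simp

lemma card_parity_interval:
  assumes "a \<le> b"
  shows "card {m \<in> {a..<b}. odd m} = b div 2 - a div 2"
    and "card {m \<in> {a..<b}. even m} = (b + 1) div 2 - (a + 1) div 2"
proof -
  have "{m \<in> {a..<b}. odd m} = {m \<in> {..<b}. odd m} - {m \<in> {..<a}. odd m}" by auto
  moreover have "{m \<in> {..<a}. odd m} \<subseteq> {m \<in> {..<b}. odd m}" using assms by auto
  ultimately show "card {m \<in> {a..<b}. odd m} = b div 2 - a div 2"
    by (simp only: card_Diff_subset card_odd_less finite_Collect_conjI finite_lessThan Collect_mem_eq disjI1)
  have "{m \<in> {a..<b}. even m} = {m \<in> {..<b}. even m} - {m \<in> {..<a}. even m}" by auto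
  moreover have "{m \<in> {..<a}. even m} \<subseteq> {m \<in> {..<b}. even m}" using assms by auto
  ultimately show "card {m \<in> {a..<b}. even m} = (b + 1) div 2 - (a + 1) div 2"
    by (simp only: card_Diff_subset card_even_less finite_Collect_conjI finite_lessThan Collect_mem_eq disjI1)
qed

lemma card_moebius_conds:
  assumes "0 < l" "l < k" "even k" "odd l"
  shows "card (moebius_conds l k) = 4 * (k + l) - 7"
proof -
  obtain a where a: "k = 2 * a" using \<open>even k\<close> by (elim evenE)
  obtain b where b: "l = 2 * b + 1" using \<open>odd l\<close> by (elim oddE)
  have ab: "b < a" using assms a b by simp
  have "card (moebius_conds l k) = Suc (\<Sum>c\<in>{Even1p, Even1m, Even2m, Odd1m, Odd2m}.
      card (UNIV \<times> {m \<in> cond_modes l k c. cond_parity c m} :: (bool \<times> nat) set))"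
    unfolding moebius_conds_def by (subst card_insert_disjoint) (auto simp: finite_cond_modes card_SigmaI)
  also have "\<dots> = Suc (2 * (\<Sum>c\<in>{Even1p, Even1m, Even2m, Odd1m, Odd2m}. card {m \<in> cond_modes l k c. cond_parity c m}))"
    unfolding card_cartesian_product by (simp add: UNIV_bool)
  also have "(\<Sum>c\<in>{Even1p, Even1m, Even2m, Odd1m, Odd2m}. card {m \<in> cond_modes l k c. cond_parity c m}) =
     card {m \<in> {1..<k - l}. odd m} + card {m \<in> {..<k + l}. odd m} + card {m \<in> {1..<2 * k}. even m}
     + card {m \<in> {1..<2 * l}. even m} + card {m \<in> {k - l + 1..<k + l}. odd m}"
    by simp
  \<comment> \<open>The five counts are \<open>a - b - 1\<close>, \<open>a + b\<close>,
    \<open>2 * a - 1\<close>, \<open>2 * b\<close> and \<open>2 * b\<close>.\<close>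
  also have "\<dots> = 4 * a + 4 * b - 2"
  proof -
    have "1 \<le> k - l" "1 \<le> 2 * k" "1 \<le> 2 * l" "k - l + 1 \<le> k + l" using assms by auto
    moreover have "k - l = Suc (2 * (a - b - 1))" using ab a b by simp
    ultimately show ?thesis using ab
      by (simp only: card_parity_interval card_odd_less) (simp add: a b)
  qed
  also have "Suc (2 * (4 * a + 4 * b - 2)) = 4 * (k + l) - 7"
    using ab by (simp add: a b)
  finally show ?thesis .
qed

section \<open>Finitely many conditions imply all active ones\<close>

locale fs_int = fs_data "real l" "real k" T h for l k :: nat and T h :: real
begin

lemma l_less_k: "0 < l" "l < k" using L_pos L_less_K by auto

definition field_functional ::
  "(real \<Rightarrow> real \<Rightarrow> real) \<Rightarrow> (real \<Rightarrow> real \<Rightarrow> real) \<Rightarrow> (real \<Rightarrow> real \<Rightarrow> real) \<Rightarrow> (real \<Rightarrow> real \<Rightarrow> real)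
    \<Rightarrow> mode_cond \<times> bool \<times> nat \<Rightarrow> real" where
  "field_functional x1 x2 y1 y2 = (\<lambda>(c, ph, m). mode_functional (real m) c
     (\<lambda>t. mode_c ph m (x1 t)) (\<lambda>t. mode_s ph m (x2 t)) (\<lambda>t. mode_c ph m (y1 t)) (\<lambda>t. mode_s ph m (y2 t)))"

lemma active_modes:
  assumes "cond_active (real m) c" "c \<noteq> Solv" "\<not> (c = Even1p \<and> m = 0)"
  shows "m \<in> cond_modes l k c" "c \<in> {Even1p, Even1m, Even2m, Odd1m, Odd2m}"
  using assms l_less_k by (cases c; auto)+

lemma zero_mode_functionals:
  assumes z: "field_functional x1 x2 y1 y2 (Solv, True, 0) = 0"
  shows "field_functional x1 x2 y1 y2 (Solv, ph, 0) = 0"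
    and "field_functional x1 x2 y1 y2 (Even1m, ph, 0) = 0 \<Longrightarrow> field_functional x1 x2 y1 y2 (Even1p, ph, 0) = 0"
proof -
  show s: "field_functional x1 x2 y1 y2 (Solv, ph, 0) = 0"
    using z by (cases ph) (simp_all add: field_functional_def mode_c_def functional_solv_sine)
  show "field_functional x1 x2 y1 y2 (Even1m, ph, 0) = 0 \<Longrightarrow> field_functional x1 x2 y1 y2 (Even1p, ph, 0) = 0"
    using s unfolding field_functional_def
    by (cases ph) (auto simp: mode_c_def mode_s_def intro!: functional_even1p_zero_mode)
qed

lemma annulus_functionals:
  assumes z: "\<And>i. i \<in> annulus_conds l k \<Longrightarrow> field_functional x1 x2 y1 y2 i = 0"
    and act: "cond_active (real m) c"
  shows "field_functional x1 x2 y1 y2 (c, ph, m) = 0"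
proof -
  have z0: "field_functional x1 x2 y1 y2 (Solv, True, 0) = 0" by (rule z) (simp add: annulus_conds_def)
  consider "c = Solv" | "c = Even1p" "m = 0" | "c \<noteq> Solv" "\<not> (c = Even1p \<and> m = 0)" by blast
  then show ?thesis
  proof cases
    case 1
    then show ?thesis using act zero_mode_functionals(1)[OF z0] by simp
  next
    case 2
    have "field_functional x1 x2 y1 y2 (Even1m, ph, 0) = 0"
      using l_less_k by (intro z) (simp add: annulus_conds_def)
    then show ?thesis using 2 zero_mode_functionals(2)[OF z0] by simp
  next
    case 3
    then show ?thesis using active_modes[OF act] by (intro z) (simp add: annulus_conds_def)
  qed
qed

text \<open>A condition of the wrong parity holds by \<open>functional_parity\<close>; one of the
  right parity is listed in \<open>moebius_conds\<close>, apart from the solvability condition in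
  the automatic phase.\<close>

lemma moebius_functionals:
  assumes z: "\<And>i. i \<in> moebius_conds l k \<Longrightarrow> field_functional x1 x2 y1 y2 i = 0"
    and par: "\<And>t. t \<in> J \<Longrightarrow> mode_c ph m (x1 (- t)) = - ((- 1) ^ m) * mode_c ph m (x1 t)"
      "\<And>t. t \<in> J \<Longrightarrow> mode_s ph m (x2 (- t)) = - ((- 1) ^ m) * mode_s ph m (x2 t)"
      "\<And>t. t \<in> J \<Longrightarrow> mode_c ph m (y1 (- t)) = (- 1) ^ m * mode_c ph m (y1 t)"
      "\<And>t. t \<in> J \<Longrightarrow> mode_s ph m (y2 (- t)) = (- 1) ^ m * mode_s ph m (y2 t)"
    and act: "cond_active (real m) c"
  shows "field_functional x1 x2 y1 y2 (c, ph, m) = 0"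
proof -
  have z0: "field_functional x1 x2 y1 y2 (Solv, True, 0) = 0" by (rule z) (simp add: moebius_conds_def)
  have s: "(- 1 :: real) ^ m = 1 \<or> (- 1 :: real) ^ m = - 1" by (cases "even m") auto
  have solv: "real m = 0 \<Longrightarrow> mode_functional (real m) Solv (\<lambda>t. mode_c ph m (x1 t)) (\<lambda>t. mode_s ph m (x2 t))
     (\<lambda>t. mode_c ph m (y1 t)) (\<lambda>t. mode_s ph m (y2 t)) = 0"
    using zero_mode_functionals(1)[OF z0, of ph] by (simp add: field_functional_def)
  note fp = functional_parity[OF s _ par _ solv, simplified]
  show ?thesis
  proof (cases "cond_parity c m")
    case False
    then show ?thesis unfolding field_functional_def
      by (cases c) (auto intro!: fp)
  next
    case True
    show ?thesis
    proof (cases "c = Solv")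
      case True
      then show ?thesis using act zero_mode_functionals(1)[OF z0] by simp
    next
      case False
      moreover have "\<not> (c = Even1p \<and> m = 0)" using True by (cases m) auto
      ultimately show ?thesis using active_modes[OF act] True by (intro z) (simp add: moebius_conds_def)
    qed
  qed
qed

end

text \<open>Multiplied by \<open>tanh (l * t) / k\<close>, the equation reads
  \<open>g t = l / k\<close>, where \<open>g\<close> is a product of two hyperbolic tangents:
  strictly increasing from 0 towards 1, while \<open>l / k\<close> lies strictly between.\<close>

lemma fs_T_ex1:
  assumes "0 < l" "l < k"
  shows "\<exists>!t. t > 0 \<and> real_of_int k * tanh (real_of_int k * t) =
        real_of_int l * (cosh (real_of_int l * t) / sinh (real_of_int l * t))"
proof -
  let ?K = "real_of_int k" and ?L = "real_of_int l"
  have pos: "0 < ?L" "?L < ?K" "0 < ?K" using assms by auto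
  define g where "g t = tanh (?K * t) * tanh (?L * t)" for t
  have eq: "?K * tanh (?K * t) = ?L * (cosh (?L * t) / sinh (?L * t)) \<longleftrightarrow> g t = ?L / ?K" if "t > 0" for t
  proof -
    have "(K * a = L * (c / s)) = (a * (s / c) = L / K)" if "s \<noteq> 0" "c \<noteq> 0" "K \<noteq> 0" for K L a c s :: real
      using that by (auto simp: field_simps)
    then show ?thesis using pos that cosh_real_nonzero[of "?L * t"]
      unfolding g_def tanh_def[of "?L * t"] by simp
  qed
  have lim: "(g \<longlongrightarrow> 1 * 1) at_top"
    unfolding g_def
    by (intro tendsto_mult filterlim_compose[OF tanh_real_at_top]
        filterlim_tendsto_pos_mult_at_top[OF tendsto_const _ filterlim_ident] pos)
  have "\<forall>\<^sub>F t in at_top. g t > ?L / ?K \<and> t > 0"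
    using pos by (intro eventually_conj order_tendstoD(1)[OF lim] eventually_gt_at_top) simp
  then obtain t0 where t0: "g t0 > ?L / ?K" "t0 > 0"
    using eventually_happens[of _ "at_top :: real filter"] by auto
  have "\<exists>t. 0 \<le> t \<and> t \<le> t0 \<and> g t = ?L / ?K"
    using t0 pos by (intro IVT') (auto simp: g_def intro!: continuous_intros)
  then obtain t where t: "0 \<le> t" "g t = ?L / ?K" by blast
  have "t \<noteq> 0" using t pos by (auto simp: g_def)
  then have "t > 0" using t by simp
  moreover have "s = t'" if "s > 0" "t' > 0" "g s = g t'" for s t'
  proof -
    have mono: "g a < g b" if "0 < a" "a < b" for a b
      unfolding g_def using that pos by (intro mult_strict_mono) auto
    show ?thesis using mono[of s t'] mono[of t' s] that by (cases s t' rule: linorder_cases) auto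
  qed
  ultimately show ?thesis using eq t(2) by (intro ex1I[of _ t]) auto
qed

lemma fs_T_props:
  assumes "0 < l" "l < k"
  shows "fs_T k l > 0" "real_of_int k * tanh (real_of_int k * fs_T k l) =
        real_of_int l * (cosh (real_of_int l * fs_T k l) / sinh (real_of_int l * fs_T k l))"
  using theI'[OF fs_T_ex1[OF assms]] unfolding fs_T_def by auto

section \<open>Vectors in four-space, half turns, and conformal geometry on the strip\<close>

lemma vector_4:
  "(vector [a, b, c, d] :: 'a::zero^4) $ 1 = a" "(vector [a, b, c, d] :: 'a^4) $ 2 = b"
  "(vector [a, b, c, d] :: 'a^4) $ 3 = c" "(vector [a, b, c, d] :: 'a^4) $ 4 = d"
  unfolding vector_def by simp_all

definition vec4 :: "real \<Rightarrow> real \<Rightarrow> real \<Rightarrow> real \<Rightarrow> real^4" where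
  "vec4 a b c d = vector [a, b, c, d]"

lemma vec4_axis: "vec4 a b c d = a *\<^sub>R axis 1 1 + b *\<^sub>R axis 2 1 + c *\<^sub>R axis 3 1 + d *\<^sub>R axis 4 1"
  by (simp add: vec4_def vec_eq_iff forall_4 vector_4 axis_def)

lemma inner_vec4: "v \<bullet> vec4 a b c d = v$1 * a + v$2 * b + v$3 * c + v$4 * d"
  by (simp add: inner_vec_def sum_4 vec4_def vector_4)

lemma vec4_nth [simp]: "vec4 a b c d $ 1 = a" "vec4 a b c d $ 2 = b" "vec4 a b c d $ 3 = c" "vec4 a b c d $ 4 = d"
  by (simp_all add: vec4_def vector_4)

lemma has_vector_derivative_vec4:
  assumes "(a has_real_derivative a') F" "(b has_real_derivative b') F"
    "(c has_real_derivative c') F" "(d has_real_derivative d') F"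
  shows "((\<lambda>t. vec4 (a t) (b t) (c t) (d t)) has_vector_derivative vec4 a' b' c' d') F"
  unfolding vec4_axis using assms unfolding has_real_derivative_iff_has_vector_derivative
  by (intro has_vector_derivative_add bounded_linear.has_vector_derivative[OF bounded_linear_scaleR_left])

text \<open>A shift by \<open>pi\<close> multiplies the frequency \<open>m\<close> by
  \<open>(- 1) ^ m\<close>; \<open>c\<close> is the further sign from the rotating frame.\<close>

lemma integral_coeff_half_turn:
  assumes g: "continuous_on UNIV g" and per: "\<And>x. g (x + 2 * pi) = g x" and gf: "\<And>x. g (x + pi) = c * f x"
  shows "mode_c ph m g = (- 1) ^ m * c * mode_c ph m f" "mode_s ph m g = (- 1) ^ m * c * mode_s ph m f"
proof -
  have cs: "cos (real m * (x + pi)) = (- 1) ^ m * cos (real m * x)"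
    "sin (real m * (x + pi)) = (- 1) ^ m * sin (real m * x)"
    "cos (real m * (x + 2 * pi)) = cos (real m * x)" "sin (real m * (x + 2 * pi)) = sin (real m * x)" for x
    using sin_int_2pi[of "int m"] cos_int_2pi[of "int m"]
    by (simp_all add: distrib_left cos_add sin_add cos_npi sin_npi)
  have "cos_coeff m g = integral {0..2 * pi} (\<lambda>x. g (x + pi) * cos (real m * (x + pi)))"
    unfolding cos_coeff_def
    by (rule integral_periodic_shift[symmetric]) (auto intro!: continuous_intros g simp: per cs)
  also have "\<dots> = (- 1) ^ m * c * cos_coeff m f"
    unfolding cos_coeff_def cs gf integral_mult_right[symmetric] by (simp add: algebra_simps)
  finally have 1: "cos_coeff m g = (- 1) ^ m * c * cos_coeff m f" .
  have "sin_coeff m g = integral {0..2 * pi} (\<lambda>x. g (x + pi) * sin (real m * (x + pi)))"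
    unfolding sin_coeff_def
    by (rule integral_periodic_shift[symmetric]) (auto intro!: continuous_intros g simp: per cs)
  also have "\<dots> = (- 1) ^ m * c * sin_coeff m f"
    unfolding sin_coeff_def cs gf integral_mult_right[symmetric] by (simp add: algebra_simps)
  finally have 2: "sin_coeff m g = (- 1) ^ m * c * sin_coeff m f" .
  show "mode_c ph m g = (- 1) ^ m * c * mode_c ph m f" "mode_s ph m g = (- 1) ^ m * c * mode_s ph m f"
    using 1 2 by (simp_all add: mode_c_def mode_s_def)
qed

lemma matrix_inv_scalar_2:
  fixes A :: "real^2^2"
  assumes A: "\<And>i j. A $ i $ j = (if i = j then c else 0)" and c: "c \<noteq> 0"
  shows "matrix_inv A $ i $ j = (if i = j then 1 / c else 0)"
proof -
  have "matrix_inv A = (\<chi> i j. if i = j then 1 / c else 0)"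
    (is "_ = ?B")
  proof -
    have B: "A ** ?B = mat 1 \<and> ?B ** A = mat 1"
      using c by (auto simp: vec_eq_iff matrix_matrix_mult_def mat_def sum_2 A forall_2)
    then have "matrix_inv A ** A = mat 1"
      unfolding matrix_inv_def by (rule someI2) simp
    then have "(matrix_inv A ** A) ** ?B = ?B" by simp
    then show ?thesis using B by (simp add: matrix_mul_assoc[symmetric])
  qed
  then show ?thesis by simp
qed

lemma smooth_on_strip_C1:
  fixes X :: "real \<times> real \<Rightarrow> 'a::euclidean_space"
  assumes T: "T > 0" and X: "smooth_on_strip T X"
  obtains Xt X\<theta> where
    "\<And>t \<theta>. t \<in> {-T..T} \<Longrightarrow> ((\<lambda>s. X (s, \<theta>)) has_vector_derivative Xt (t, \<theta>)) (at t within {-T..T})"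
    "\<And>t \<theta>. t \<in> {-T..T} \<Longrightarrow> ((\<lambda>s. X (t, s)) has_vector_derivative X\<theta> (t, \<theta>)) (at \<theta>)"
    "continuous_on ({-T..T} \<times> UNIV) X" "continuous_on ({-T..T} \<times> UNIV) Xt" "continuous_on ({-T..T} \<times> UNIV) X\<theta>"
proof -
  obtain D where D0: "\<And>p. p \<in> strip T \<Longrightarrow> D 0 0 p = X p"
    and D: "\<And>i j p. p \<in> strip T \<Longrightarrow>
      (D i j has_derivative (\<lambda>h. fst h *\<^sub>R D (Suc i) j p + snd h *\<^sub>R D i (Suc j) p)) (at p within strip T)"
    using X unfolding smooth_on_strip_def by blast
  have cont: "continuous_on (strip T) (D i j)" for i j
    unfolding continuous_on_eq_continuous_within using has_derivative_continuous[OF D] by blast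
  have dX: "(X has_derivative (\<lambda>h. fst h *\<^sub>R D 1 0 p + snd h *\<^sub>R D 0 1 p)) (at p within strip T)" if "p \<in> strip T" for p
    using has_derivative_transform[OF that, of X "D 0 0"] D[OF that, of 0 0] D0 by simp
  show ?thesis
  proof (rule that[of "D 1 0" "D 0 1"])
    fix t \<theta> :: real assume t: "t \<in> {-T..T}"
    then have p: "(t, \<theta>) \<in> strip T" by (simp add: strip_def)
    have "((\<lambda>s. X (s, \<theta>)) has_derivative (\<lambda>s. fst (s, 0::real) *\<^sub>R D 1 0 (t, \<theta>) + snd (s, 0::real) *\<^sub>R D 0 1 (t, \<theta>)))
       (at t within {-T..T})"
      by (rule has_derivative_in_compose[where f = "\<lambda>s. (s, \<theta>)" and g = X, OF _ has_derivative_subset[OF dX[OF p]]])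
         (auto intro!: derivative_eq_intros simp: strip_def)
    then show "((\<lambda>s. X (s, \<theta>)) has_vector_derivative D 1 0 (t, \<theta>)) (at t within {-T..T})"
      by (simp add: has_vector_derivative_def)
    have "((\<lambda>s. X (t, s)) has_derivative (\<lambda>s. fst (0::real, s) *\<^sub>R D 1 0 (t, \<theta>) + snd (0::real, s) *\<^sub>R D 0 1 (t, \<theta>)))
       (at \<theta>)"
      by (rule has_derivative_in_compose[where f = "\<lambda>s. (t, s)" and g = X, OF _ has_derivative_subset[OF dX[OF p]]])
         (use t in \<open>auto intro!: derivative_eq_intros simp: strip_def\<close>)
    then show "((\<lambda>s. X (t, s)) has_vector_derivative D 0 1 (t, \<theta>)) (at \<theta>)"
      by (simp add: has_vector_derivative_def)
  next
    show "continuous_on ({-T..T} \<times> UNIV) X"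
      using cont[of 0 0] continuous_on_cong[of "strip T" "strip T" X "D 0 0"] D0 by (simp add: strip_def)
  qed (use cont in \<open>auto simp: strip_def\<close>)
qed

lemma inner_zero_derivative:
  fixes f g :: "real \<Rightarrow> 'a::real_inner"
  assumes "(f has_vector_derivative f') (at t within S)" "(g has_vector_derivative g') (at t within S)"
    and z: "\<And>s. s \<in> S \<Longrightarrow> f s \<bullet> g s = 0" and t: "t \<in> S" "at t within S \<noteq> bot"
  shows "f' \<bullet> g t = - (f t \<bullet> g')"
proof -
  have "((\<lambda>s. f s \<bullet> g s) has_vector_derivative (f t \<bullet> g' + f' \<bullet> g t)) (at t within S)"
    by (rule bounded_bilinear.has_vector_derivative[OF bounded_bilinear_inner assms(1,2)])
  moreover have "((\<lambda>s. f s \<bullet> g s) has_vector_derivative 0) (at t within S)"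
    unfolding has_vector_derivative_def
    by (rule has_derivative_transform[OF t(1) z]) (auto intro: derivative_eq_intros)
  ultimately have "f t \<bullet> g' + f' \<bullet> g t = 0" by (rule vector_derivative_unique_within[OF t(2)])
  then show ?thesis by linarith
qed

lemma pd_eqI:
  fixes X :: "real \<times> real \<Rightarrow> 'a::euclidean_space"
  assumes "T > 0" "t \<in> {-T..T}"
  shows "((\<lambda>s. X (s, \<theta>)) has_vector_derivative a) (at t within {-T..T}) \<Longrightarrow> pd T 1 X (t, \<theta>) = a"
    and "((\<lambda>s. X (t, s)) has_vector_derivative a) (at \<theta>) \<Longrightarrow> pd T 2 X (t, \<theta>) = a"
  using assms by (auto simp: pd_def intro!: vector_derivative_within_closed_interval vector_derivative_at)

text \<open>Differentiating the normality relations expresses the tangential part of the derivatives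
  of \<open>X\<close> through the second derivatives of \<open>u\<close>. Passing to the normal
  connection subtracts this part, and by harmonicity the curvature term subtracts the same amount
  again; hence 4 and not 2. The area density \<open>c\<close> cancels one inverse metric.\<close>

lemma conformal_stability_density:
  fixes u X :: "real \<times> real \<Rightarrow> 'a::euclidean_space"
  assumes conf: "pd T 1 u p \<bullet> pd T 1 u p = c" "pd T 2 u p \<bullet> pd T 2 u p = c" "pd T 1 u p \<bullet> pd T 2 u p = 0"
    and c: "c > 0"
    and sym: "pd T 2 (pd T 1 u) p = pd T 1 (pd T 2 u) p"
    and harm: "pd T 2 (pd T 2 u) p = - pd T 1 (pd T 1 u) p"
    and normal: "X p \<bullet> pd T 1 u p = 0" "X p \<bullet> pd T 2 u p = 0"
    and d: "pd T 1 X p \<bullet> pd T 1 u p = - (X p \<bullet> pd T 1 (pd T 1 u) p)"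
      "pd T 1 X p \<bullet> pd T 2 u p = - (X p \<bullet> pd T 1 (pd T 2 u) p)"
      "pd T 2 X p \<bullet> pd T 1 u p = - (X p \<bullet> pd T 2 (pd T 1 u) p)"
      "pd T 2 X p \<bullet> pd T 2 u p = - (X p \<bullet> pd T 2 (pd T 2 u) p)"
  shows "(norm_sq_normal_gradient T u X p - simons_op T u X p \<bullet> X p) * sqrt (det (metric T u p)) =
     (norm (pd T 1 X p))\<^sup>2 + (norm (pd T 2 X p))\<^sup>2
     - 4 / c * ((X p \<bullet> pd T 1 (pd T 1 u) p)\<^sup>2 + (X p \<bullet> pd T 1 (pd T 2 u) p)\<^sup>2)"
proof -
  define e1 e2 where "e1 = pd T 1 u p" and "e2 = pd T 2 u p"
  define A B where "A = pd T 1 (pd T 1 u) p" and "B = pd T 1 (pd T 2 u) p"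
  define X1 X2 where "X1 = pd T 1 X p" and "X2 = pd T 2 X p"
  note df = e1_def[symmetric] e2_def[symmetric] A_def[symmetric] B_def[symmetric] X1_def[symmetric] X2_def[symmetric]
  have conf': "e1 \<bullet> e1 = c" "e2 \<bullet> e2 = c" "e1 \<bullet> e2 = 0" "e2 \<bullet> e1 = 0"
    using conf by (simp_all add: e1_def e2_def inner_commute)
  have met: "metric T u p $ i $ j = (if i = j then c else 0)" for i j
    using exhaust_2[of i] exhaust_2[of j] conf' by (auto simp: metric_def df)
  have co: "matrix_inv (metric T u p) $ i $ j = (if i = j then 1 / c else 0)" for i j
    using matrix_inv_scalar_2[OF met] c by simp
  have sdet: "sqrt (det (metric T u p)) = c"
    unfolding det_2 met using c by simp
  have np: "normal_part T u p v = v - ((v \<bullet> e1) / c) *\<^sub>R e1 - ((v \<bullet> e2) / c) *\<^sub>R e2" for v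
    by (simp add: normal_part_def sum_2 co df algebra_simps)
  have npX: "normal_part T u p v \<bullet> X p = v \<bullet> X p" for v
    using normal by (simp add: np df inner_diff_left inner_diff_right inner_commute[of _ "X p"])
  have npn: "normal_part T u p v \<bullet> normal_part T u p v = v \<bullet> v - ((v \<bullet> e1)\<^sup>2 + (v \<bullet> e2)\<^sup>2) / c" for v
    using c by (simp add: np inner_diff_left inner_diff_right conf')
       (simp add: inner_commute[of _ v] power2_eq_square field_simps)
  have d': "X1 \<bullet> e1 = - (X p \<bullet> A)" "X1 \<bullet> e2 = - (X p \<bullet> B)" "X2 \<bullet> e1 = - (X p \<bullet> B)" "X2 \<bullet> e2 = X p \<bullet> A"
    using d by (simp_all add: df sym harm)
  have g: "norm_sq_normal_gradient T u X p =
     (X1 \<bullet> X1 + X2 \<bullet> X2 - 2 * ((X p \<bullet> A)\<^sup>2 + (X p \<bullet> B)\<^sup>2) / c) / c"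
    by (simp add: norm_sq_normal_gradient_def normal_connection_def sum_2 co df npn d')
       (simp add: diff_divide_distrib add_divide_distrib)
  have s: "simons_op T u X p \<bullet> X p = 2 * ((X p \<bullet> A)\<^sup>2 + (X p \<bullet> B)\<^sup>2) / c\<^sup>2"
    by (simp add: simons_op_def second_ff_def sum_2 co df sym harm inner_add_left inner_diff_left npX)
       (simp add: power2_eq_square inner_commute[of _ "X p"] add_divide_distrib)
  show ?thesis
    unfolding g s sdet power2_norm_eq_inner df using c by (simp add: power2_eq_square field_simps)
qed

section \<open>The Fraser--Sargent immersion\<close>

locale fs_surface = fs_int l k T h for l k :: nat and T h :: real +
  assumes T_eq: "T = fs_T (int k) (int l)"
begin

abbreviation u :: "real \<times> real \<Rightarrow> real^4" where "u \<equiv> fs_u (int k) (int l)"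

definition radius :: real where
  "radius = sqrt ((real k)\<^sup>2 * (sinh (real l * T))\<^sup>2 + (real l)\<^sup>2 * (cosh (real k * T))\<^sup>2)"

text \<open>Common factor of all first derivatives of \<open>u\<close>, since each coordinate
  function loses \<open>k\<close> or \<open>l\<close> on differentiation.\<close>

definition amp :: real where "amp = real k * real l / radius"

lemma radius_pos: "radius > 0"
  unfolding radius_def using l_less_k by (intro real_sqrt_gt_zero add_nonneg_pos) auto

lemma amp_pos: "amp > 0" using l_less_k radius_pos by (simp add: amp_def)

lemma u_eq: "u (t, \<theta>) = vec4 (amp / real l * sinh (real l * t) * cos (real l * \<theta>)) (amp / real l * sinh (real l * t) * sin (real l * \<theta>))
    (amp / real k * cosh (real k * t) * cos (real k * \<theta>)) (amp / real k * cosh (real k * t) * sin (real k * \<theta>))"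
  using l_less_k by (simp add: fs_u_def vec_eq_iff forall_4 vector_4 amp_def fs_r_def radius_def T_eq[symmetric] vec4_def)

definition u1 :: "real \<Rightarrow> real \<Rightarrow> real^4" where
  "u1 t \<theta> = vec4 (amp * cosh (real l * t) * cos (real l * \<theta>)) (amp * cosh (real l * t) * sin (real l * \<theta>))
    (amp * sinh (real k * t) * cos (real k * \<theta>)) (amp * sinh (real k * t) * sin (real k * \<theta>))"

definition u2 :: "real \<Rightarrow> real \<Rightarrow> real^4" where
  "u2 t \<theta> = vec4 (- (amp * sinh (real l * t) * sin (real l * \<theta>))) (amp * sinh (real l * t) * cos (real l * \<theta>))
    (- (amp * cosh (real k * t) * sin (real k * \<theta>))) (amp * cosh (real k * t) * cos (real k * \<theta>))"

definition u11 :: "real \<Rightarrow> real \<Rightarrow> real^4" where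
  "u11 t \<theta> = vec4 (amp * real l * sinh (real l * t) * cos (real l * \<theta>)) (amp * real l * sinh (real l * t) * sin (real l * \<theta>))
    (amp * real k * cosh (real k * t) * cos (real k * \<theta>)) (amp * real k * cosh (real k * t) * sin (real k * \<theta>))"

definition u12 :: "real \<Rightarrow> real \<Rightarrow> real^4" where
  "u12 t \<theta> = vec4 (- (amp * real l * cosh (real l * t) * sin (real l * \<theta>))) (amp * real l * cosh (real l * t) * cos (real l * \<theta>))
    (- (amp * real k * sinh (real k * t) * sin (real k * \<theta>))) (amp * real k * sinh (real k * t) * cos (real k * \<theta>))"

lemma u_derivs:
  "((\<lambda>s. u (s, \<theta>)) has_vector_derivative u1 t \<theta>) (at t within S)"
  "((\<lambda>s. u (t, s)) has_vector_derivative u2 t \<theta>) (at \<theta> within S)"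
  "((\<lambda>s. u1 s \<theta>) has_vector_derivative u11 t \<theta>) (at t within S)"
  "((\<lambda>s. u1 t s) has_vector_derivative u12 t \<theta>) (at \<theta> within S)"
  "((\<lambda>s. u2 s \<theta>) has_vector_derivative u12 t \<theta>) (at t within S)"
  "((\<lambda>s. u2 t s) has_vector_derivative (- u11 t \<theta>)) (at \<theta> within S)"
proof -
  have m: "- vec4 a b c d = vec4 (- a) (- b) (- c) (- d)" for a b c d
    by (simp add: vec4_axis)
  show
    "((\<lambda>s. u (s, \<theta>)) has_vector_derivative u1 t \<theta>) (at t within S)"
    "((\<lambda>s. u (t, s)) has_vector_derivative u2 t \<theta>) (at \<theta> within S)"
    "((\<lambda>s. u1 s \<theta>) has_vector_derivative u11 t \<theta>) (at t within S)"
    "((\<lambda>s. u1 t s) has_vector_derivative u12 t \<theta>) (at \<theta> within S)"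
    "((\<lambda>s. u2 s \<theta>) has_vector_derivative u12 t \<theta>) (at t within S)"
    "((\<lambda>s. u2 t s) has_vector_derivative (- u11 t \<theta>)) (at \<theta> within S)"
    unfolding u_eq u1_def u2_def u11_def u12_def m using l_less_k
    by (intro has_vector_derivative_vec4; auto intro!: derivative_eq_intros)+
qed

lemma pd_u:
  assumes "t \<in> J"
  shows "pd T 1 u (t, \<theta>) = u1 t \<theta>" "pd T 2 u (t, \<theta>) = u2 t \<theta>"
  using assms T_pos by (auto intro!: pd_eqI u_derivs)

lemma pd_pd_u:
  assumes t: "t \<in> J"
  shows "pd T 1 (pd T 1 u) (t, \<theta>) = u11 t \<theta>" "pd T 2 (pd T 1 u) (t, \<theta>) = u12 t \<theta>"
    "pd T 1 (pd T 2 u) (t, \<theta>) = u12 t \<theta>" "pd T 2 (pd T 2 u) (t, \<theta>) = - u11 t \<theta>"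
proof -
  have tr: "((\<lambda>s. pd T i u (s, \<theta>)) has_vector_derivative a) (at t within J)"
    if "((\<lambda>s. f s \<theta>) has_vector_derivative a) (at t within J)" "\<And>s. s \<in> J \<Longrightarrow> pd T i u (s, \<theta>) = f s \<theta>" for i f a
    using has_vector_derivative_transform[OF t that(2,1)] .
  show "pd T 1 (pd T 1 u) (t, \<theta>) = u11 t \<theta>"
    by (rule pd_eqI(1)[OF T_pos t tr[of u1]]) (auto intro: u_derivs pd_u)
  show "pd T 1 (pd T 2 u) (t, \<theta>) = u12 t \<theta>"
    by (rule pd_eqI(1)[OF T_pos t tr[of u2]]) (auto intro: u_derivs pd_u)
  show "pd T 2 (pd T 1 u) (t, \<theta>) = u12 t \<theta>"
    by (rule pd_eqI(2)[OF T_pos t]) (unfold pd_u[OF t], rule u_derivs)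
  show "pd T 2 (pd T 2 u) (t, \<theta>) = - u11 t \<theta>"
    by (rule pd_eqI(2)[OF T_pos t]) (unfold pd_u[OF t], rule u_derivs)
qed

text \<open>Coordinates in the frame rotating with the circle action
  \<open>(e\<^sup>i\<^sup>l\<^sup>\<theta>, e\<^sup>i\<^sup>k\<^sup>\<theta>)\<close> under which the surface is invariant.\<close>

definition rx1 where "rx1 \<theta> v = v $ 1 * cos (real l * \<theta>) + v $ 2 * sin (real l * \<theta>)" for \<theta> :: real and v :: "real^4"
definition rx2 where "rx2 \<theta> v = v $ 2 * cos (real l * \<theta>) - v $ 1 * sin (real l * \<theta>)" for \<theta> :: real and v :: "real^4"
definition ry1 where "ry1 \<theta> v = v $ 3 * cos (real k * \<theta>) + v $ 4 * sin (real k * \<theta>)" for \<theta> :: real and v :: "real^4"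
definition ry2 where "ry2 \<theta> v = v $ 4 * cos (real k * \<theta>) - v $ 3 * sin (real k * \<theta>)" for \<theta> :: real and v :: "real^4"

lemmas rot_defs = rx1_def rx2_def ry1_def ry2_def

lemma rot_norm: "(norm v)\<^sup>2 = (rx1 \<theta> v)\<^sup>2 + (rx2 \<theta> v)\<^sup>2 + (ry1 \<theta> v)\<^sup>2 + (ry2 \<theta> v)\<^sup>2"
proof -
  have r: "(a * c + b * s)\<^sup>2 + (b * c - a * s)\<^sup>2 = (a\<^sup>2 + b\<^sup>2) * (s\<^sup>2 + c\<^sup>2)" for a b c s :: real
    by (simp add: power2_eq_square algebra_simps)
  have "(norm v)\<^sup>2 = ((v$1)\<^sup>2 + (v$2)\<^sup>2) + ((v$3)\<^sup>2 + (v$4)\<^sup>2)"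
    unfolding power2_norm_eq_inner by (simp add: inner_vec_def sum_4 power2_eq_square)
  then show ?thesis
    using r[of "v$1" "cos (real l * \<theta>)" "v$2" "sin (real l * \<theta>)"] r[of "v$3" "cos (real k * \<theta>)" "v$4" "sin (real k * \<theta>)"]
    by (simp add: rot_defs)
qed

lemma rot_inner_u:
  "v \<bullet> u1 t \<theta> = amp * (rx1 \<theta> v * cosh (real l * t) + ry1 \<theta> v * sinh (real k * t))"
  "v \<bullet> u2 t \<theta> = amp * (rx2 \<theta> v * sinh (real l * t) + ry2 \<theta> v * cosh (real k * t))"
  "v \<bullet> u11 t \<theta> = amp * (real l * rx1 \<theta> v * sinh (real l * t) + real k * ry1 \<theta> v * cosh (real k * t))"
  "v \<bullet> u12 t \<theta> = amp * (real l * rx2 \<theta> v * cosh (real l * t) + real k * ry2 \<theta> v * sinh (real k * t))"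
  by (simp_all add: u1_def u2_def u11_def u12_def inner_vec4 rot_defs algebra_simps)

lemma u_conformal:
  "u1 t \<theta> \<bullet> u1 t \<theta> = amp\<^sup>2 * mu2 t" "u2 t \<theta> \<bullet> u2 t \<theta> = amp\<^sup>2 * mu2 t" "u1 t \<theta> \<bullet> u2 t \<theta> = 0"
proof -
  have r: "rx1 \<theta> (u1 t \<theta>) = amp * cosh (real l * t)" "ry1 \<theta> (u1 t \<theta>) = amp * sinh (real k * t)"
    "rx2 \<theta> (u1 t \<theta>) = 0" "ry2 \<theta> (u1 t \<theta>) = 0"
    "rx2 \<theta> (u2 t \<theta>) = amp * sinh (real l * t)" "ry2 \<theta> (u2 t \<theta>) = amp * cosh (real k * t)"
    using sin_cos_squared_add[of "real l * \<theta>"] sin_cos_squared_add[of "real k * \<theta>"]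
    by (simp_all add: rot_defs u1_def u2_def power2_eq_square mult.assoc flip: distrib_left)
  show "u1 t \<theta> \<bullet> u1 t \<theta> = amp\<^sup>2 * mu2 t" "u1 t \<theta> \<bullet> u2 t \<theta> = 0"
    unfolding rot_inner_u r by (simp_all add: mu2_def power2_eq_square algebra_simps)
  show "u2 t \<theta> \<bullet> u2 t \<theta> = amp\<^sup>2 * mu2 t"
    unfolding rot_inner_u r by (simp_all add: mu2_alt power2_eq_square algebra_simps)
qed

text \<open>The free boundary condition: on the boundary the conormal derivative of \<open>u\<close>
  in the flat metric is \<open>h\<close> times \<open>u\<close>, and \<open>u\<close> has unit
  length there, so the conformal length factor is \<open>h\<close>. This turns the boundary length
  integral into the Steklov weight.\<close>

lemma amp_mu_boundary: "amp * sqrt (mu2 T) = h"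
proof -
  have "h\<^sup>2 * radius\<^sup>2 = (real k * (h * sinh (real l * T)))\<^sup>2 + (real l * (h * cosh (real k * T)))\<^sup>2"
    by (simp add: radius_def power_mult_distrib algebra_simps)
  also have "\<dots> = (real k * real l)\<^sup>2 * mu2 T"
    unfolding hL[symmetric] hK[symmetric] by (simp add: mu2_def power_mult_distrib algebra_simps)
  finally have "(h * radius)\<^sup>2 = (real k * real l * sqrt (mu2 T))\<^sup>2"
    using mu2_pos[of T] by (simp add: power_mult_distrib)
  then have "h * radius = real k * real l * sqrt (mu2 T)"
    using h_pos radius_pos mu2_pos[of T] by (subst (asm) power2_eq_iff_nonneg) auto
  then show ?thesis using radius_pos by (simp add: amp_def field_simps)
qed

lemma cont2_rot:
  assumes Z: "continuous_on (J \<times> UNIV) Z"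
  shows "cont2 (\<lambda>t \<theta>. rx1 \<theta> (Z (t, \<theta>)))" "cont2 (\<lambda>t \<theta>. rx2 \<theta> (Z (t, \<theta>)))"
    "cont2 (\<lambda>t \<theta>. ry1 \<theta> (Z (t, \<theta>)))" "cont2 (\<lambda>t \<theta>. ry2 \<theta> (Z (t, \<theta>)))"
proof -
  have "cont2 (\<lambda>t \<theta>. Z (t, \<theta>) $ i)" for i
    unfolding cont2_def by (simp add: Z continuous_intros)
  then show "cont2 (\<lambda>t \<theta>. rx1 \<theta> (Z (t, \<theta>)))" "cont2 (\<lambda>t \<theta>. rx2 \<theta> (Z (t, \<theta>)))"
    "cont2 (\<lambda>t \<theta>. ry1 \<theta> (Z (t, \<theta>)))" "cont2 (\<lambda>t \<theta>. ry2 \<theta> (Z (t, \<theta>)))"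
    unfolding rot_defs by (intro cont2_intros continuous_intros; simp)+
qed

lemma rot_periodic: "rx1 (\<theta> + 2 * pi) v = rx1 \<theta> v" "rx2 (\<theta> + 2 * pi) v = rx2 \<theta> v"
  "ry1 (\<theta> + 2 * pi) v = ry1 \<theta> v" "ry2 (\<theta> + 2 * pi) v = ry2 \<theta> v"
  using sin_int_2pi[of "int l"] cos_int_2pi[of "int l"] sin_int_2pi[of "int k"] cos_int_2pi[of "int k"]
  by (simp_all add: rot_defs distrib_left cos_add sin_add)

abbreviation fields :: "(real \<times> real \<Rightarrow> real^4) set" where "fields \<equiv> annulus_normal_fields T u"

definition functional :: "(real \<times> real \<Rightarrow> real^4) \<Rightarrow> mode_cond \<times> bool \<times> nat \<Rightarrow> real" where
  "functional X = field_functional (\<lambda>t \<theta>. rx1 \<theta> (X (t, \<theta>))) (\<lambda>t \<theta>. rx2 \<theta> (X (t, \<theta>)))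
     (\<lambda>t \<theta>. ry1 \<theta> (X (t, \<theta>))) (\<lambda>t \<theta>. ry2 \<theta> (X (t, \<theta>)))"

context
  fixes X :: "real \<times> real \<Rightarrow> real^4"
  assumes X: "X \<in> fields"
begin

abbreviation "Xt \<equiv> pd T 1 X"
abbreviation "X\<theta> \<equiv> pd T 2 X"

lemma field_partials:
  "t \<in> J \<Longrightarrow> ((\<lambda>s. X (s, \<theta>)) has_vector_derivative Xt (t, \<theta>)) (at t within J)"
  "t \<in> J \<Longrightarrow> ((\<lambda>s. X (t, s)) has_vector_derivative X\<theta> (t, \<theta>)) (at \<theta>)"
  "continuous_on (J \<times> UNIV) X" "continuous_on (J \<times> UNIV) Xt" "continuous_on (J \<times> UNIV) X\<theta>"
proof -
  have "smooth_on_strip T X" using X by (simp add: annulus_normal_fields_def)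
  from smooth_on_strip_C1[OF T_pos this] obtain Y Z where
    d: "\<And>t \<theta>. t \<in> J \<Longrightarrow> ((\<lambda>s. X (s, \<theta>)) has_vector_derivative Y (t, \<theta>)) (at t within J)"
      "\<And>t \<theta>. t \<in> J \<Longrightarrow> ((\<lambda>s. X (t, s)) has_vector_derivative Z (t, \<theta>)) (at \<theta>)"
    and c: "continuous_on (J \<times> UNIV) X" "continuous_on (J \<times> UNIV) Y" "continuous_on (J \<times> UNIV) Z"
    by blast
  have Y: "Xt (t, \<theta>) = Y (t, \<theta>)" and Z: "X\<theta> (t, \<theta>) = Z (t, \<theta>)" if "t \<in> J" for t \<theta>
    using pd_eqI(1)[OF T_pos that d(1)[OF that]] pd_eqI(2)[OF T_pos that d(2)[OF that]] by auto
  show "t \<in> J \<Longrightarrow> ((\<lambda>s. X (s, \<theta>)) has_vector_derivative Xt (t, \<theta>)) (at t within J)"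
    "t \<in> J \<Longrightarrow> ((\<lambda>s. X (t, s)) has_vector_derivative X\<theta> (t, \<theta>)) (at \<theta>)"
    using d Y Z by auto
  show "continuous_on (J \<times> UNIV) X" by (rule c)
  show "continuous_on (J \<times> UNIV) Xt" using c(2) by (rule continuous_on_eq) (auto simp: Y)
  show "continuous_on (J \<times> UNIV) X\<theta>" using c(3) by (rule continuous_on_eq) (auto simp: Z)
qed

lemma X_components:
  assumes "t \<in> J"
  shows "((\<lambda>s. X (s, \<theta>) $ i) has_real_derivative Xt (t, \<theta>) $ i) (at t within J)"
    "((\<lambda>s. X (t, s) $ i) has_real_derivative X\<theta> (t, \<theta>) $ i) (at \<theta>)"
  unfolding has_real_derivative_iff_has_vector_derivative
  by (intro bounded_linear.has_vector_derivative[OF bounded_linear_vec_nth] field_partials assms)+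

lemma X_periodic: "X (t, \<theta> + 2 * pi) = X (t, \<theta>)"
  using X by (simp add: annulus_normal_fields_def)

lemma X_normal:
  assumes "t \<in> J"
  shows "X (t, \<theta>) \<bullet> u1 t \<theta> = 0" "X (t, \<theta>) \<bullet> u2 t \<theta> = 0"
proof -
  have "X (t, \<theta>) \<bullet> pd T i u (t, \<theta>) = 0" for i
    using X assms by (auto simp: annulus_normal_fields_def strip_def)
  then show "X (t, \<theta>) \<bullet> u1 t \<theta> = 0" "X (t, \<theta>) \<bullet> u2 t \<theta> = 0"
    using pd_u[OF assms] by metis+
qed

abbreviation "x1 t \<theta> \<equiv> rx1 \<theta> (X (t, \<theta>))"
abbreviation "x2 t \<theta> \<equiv> rx2 \<theta> (X (t, \<theta>))"
abbreviation "y1 t \<theta> \<equiv> ry1 \<theta> (X (t, \<theta>))"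
abbreviation "y2 t \<theta> \<equiv> ry2 \<theta> (X (t, \<theta>))"

lemma rot_field_C1:
  "field_C1 x1 (\<lambda>t \<theta>. rx1 \<theta> (Xt (t, \<theta>))) (\<lambda>t \<theta>. rx1 \<theta> (X\<theta> (t, \<theta>)) + real l * x2 t \<theta>)"
  "field_C1 x2 (\<lambda>t \<theta>. rx2 \<theta> (Xt (t, \<theta>))) (\<lambda>t \<theta>. rx2 \<theta> (X\<theta> (t, \<theta>)) - real l * x1 t \<theta>)"
  "field_C1 y1 (\<lambda>t \<theta>. ry1 \<theta> (Xt (t, \<theta>))) (\<lambda>t \<theta>. ry1 \<theta> (X\<theta> (t, \<theta>)) + real k * y2 t \<theta>)"
  "field_C1 y2 (\<lambda>t \<theta>. ry2 \<theta> (Xt (t, \<theta>))) (\<lambda>t \<theta>. ry2 \<theta> (X\<theta> (t, \<theta>)) - real k * y1 t \<theta>)"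
  unfolding field_C1_def X_periodic rot_periodic
  by (intro conjI ballI allI cont2_intros cont2_rot field_partials continuous_intros refl;
      (unfold rot_defs; auto intro!: derivative_eq_intros X_components simp: algebra_simps))+

abbreviation "rot_density \<equiv> energy_dens x1 x2 y1 y2 (\<lambda>t \<theta>. rx1 \<theta> (Xt (t, \<theta>))) (\<lambda>t \<theta>. rx2 \<theta> (Xt (t, \<theta>)))
     (\<lambda>t \<theta>. ry1 \<theta> (Xt (t, \<theta>))) (\<lambda>t \<theta>. ry2 \<theta> (Xt (t, \<theta>)))
     (\<lambda>t \<theta>. rx1 \<theta> (X\<theta> (t, \<theta>)) + real l * x2 t \<theta>) (\<lambda>t \<theta>. rx2 \<theta> (X\<theta> (t, \<theta>)) - real l * x1 t \<theta>)
     (\<lambda>t \<theta>. ry1 \<theta> (X\<theta> (t, \<theta>)) + real k * y2 t \<theta>) (\<lambda>t \<theta>. ry2 \<theta> (X\<theta> (t, \<theta>)) - real k * y1 t \<theta>)"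

lemma rot_density_eq: "rot_density t \<theta> = (norm (Xt (t, \<theta>)))\<^sup>2 + (norm (X\<theta> (t, \<theta>)))\<^sup>2
     - mu2 t * ((srcF (\<lambda>t. x1 t \<theta>) (\<lambda>t. y1 t \<theta>) t)\<^sup>2 + (srcG (\<lambda>t. x2 t \<theta>) (\<lambda>t. y2 t \<theta>) t)\<^sup>2)"
  unfolding energy_dens_def rot_norm[of _ \<theta>] by simp

lemma stability_density:
  assumes t: "t \<in> J"
  shows "(norm_sq_normal_gradient T u X (t, \<theta>) - simons_op T u X (t, \<theta>) \<bullet> X (t, \<theta>)) * sqrt (det (metric T u (t, \<theta>)))
    = rot_density t \<theta>"
proof -
  have nb: "at t within J \<noteq> bot" using t T_pos by (simp add: trivial_limit_within islimpt_Icc)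
  have d1: "Xt (t, \<theta>) \<bullet> u1 t \<theta> = - (X (t, \<theta>) \<bullet> u11 t \<theta>)" "Xt (t, \<theta>) \<bullet> u2 t \<theta> = - (X (t, \<theta>) \<bullet> u12 t \<theta>)"
    by (rule inner_zero_derivative[OF field_partials(1)[OF t] u_derivs(3) _ t nb], rule X_normal, assumption)
       (rule inner_zero_derivative[OF field_partials(1)[OF t] u_derivs(5) _ t nb], rule X_normal, assumption)
  have d2: "X\<theta> (t, \<theta>) \<bullet> u1 t \<theta> = - (X (t, \<theta>) \<bullet> u12 t \<theta>)" "X\<theta> (t, \<theta>) \<bullet> u2 t \<theta> = - (X (t, \<theta>) \<bullet> (- u11 t \<theta>))"
    using inner_zero_derivative[OF field_partials(2)[OF t] u_derivs(4), of t \<theta>]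
      inner_zero_derivative[OF field_partials(2)[OF t] u_derivs(6), of t \<theta>] X_normal[OF t] by simp_all
  have sp: "amp\<^sup>2 * mu2 t > 0" using amp_pos mu2_pos by simp
  have "(norm_sq_normal_gradient T u X (t, \<theta>) - simons_op T u X (t, \<theta>) \<bullet> X (t, \<theta>)) * sqrt (det (metric T u (t, \<theta>)))
    = (norm (Xt (t, \<theta>)))\<^sup>2 + (norm (X\<theta> (t, \<theta>)))\<^sup>2
     - 4 / (amp\<^sup>2 * mu2 t) * ((X (t, \<theta>) \<bullet> u11 t \<theta>)\<^sup>2 + (X (t, \<theta>) \<bullet> u12 t \<theta>)\<^sup>2)"
    using conformal_stability_density[of T u "(t, \<theta>)" "amp\<^sup>2 * mu2 t" X, unfolded pd_u[OF t] pd_pd_u[OF t],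
      OF u_conformal sp refl refl X_normal[OF t] d1 d2] .
  also have "4 / (amp\<^sup>2 * mu2 t) * ((X (t, \<theta>) \<bullet> u11 t \<theta>)\<^sup>2 + (X (t, \<theta>) \<bullet> u12 t \<theta>)\<^sup>2) =
     mu2 t * ((srcF (\<lambda>t. x1 t \<theta>) (\<lambda>t. y1 t \<theta>) t)\<^sup>2 + (srcG (\<lambda>t. x2 t \<theta>) (\<lambda>t. y2 t \<theta>) t)\<^sup>2)"
    using amp_pos unfolding rot_inner_u srcF_def srcG_def
    by (simp add: power_mult_distrib power_divide) (simp add: field_simps power2_eq_square)
  finally show ?thesis unfolding rot_density_eq .
qed

abbreviation "rot_form \<equiv> area_form x1 x2 y1 y2 (\<lambda>t \<theta>. rx1 \<theta> (Xt (t, \<theta>))) (\<lambda>t \<theta>. rx2 \<theta> (Xt (t, \<theta>)))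
     (\<lambda>t \<theta>. ry1 \<theta> (Xt (t, \<theta>))) (\<lambda>t \<theta>. ry2 \<theta> (Xt (t, \<theta>)))
     (\<lambda>t \<theta>. rx1 \<theta> (X\<theta> (t, \<theta>)) + real l * x2 t \<theta>) (\<lambda>t \<theta>. rx2 \<theta> (X\<theta> (t, \<theta>)) - real l * x1 t \<theta>)
     (\<lambda>t \<theta>. ry1 \<theta> (X\<theta> (t, \<theta>)) + real k * y2 t \<theta>) (\<lambda>t \<theta>. ry2 \<theta> (X\<theta> (t, \<theta>)) - real k * y1 t \<theta>)"

lemma cont2_rot_density: "cont2 rot_density"
  using cont2_energy_dens[OF rot_field_C1] .

text \<open>Stated for both fundamental domains: \<open>a = - T\<close> is the annulus and
  \<open>a = 0\<close> the half that represents the Moebius band.\<close>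

lemma second_variation_eq:
  assumes a: "a = 0 \<or> a = - T" and E: "E \<subseteq> {-T, T}"
  shows "second_variation ({a..T} \<times> {0..2 * pi}) E T u X =
    integral {a..T} (\<lambda>t. integral {0..2 * pi} (rot_density t))
    - h * (\<Sum>t\<in>E. integral {0..2 * pi} (\<lambda>\<theta>. (x1 t \<theta>)\<^sup>2 + (x2 t \<theta>)\<^sup>2 + (y1 t \<theta>)\<^sup>2 + (y2 t \<theta>)\<^sup>2))"
proof -
  have sub: "{a..T} \<subseteq> J" using a T_pos by auto
  have "integral ({a..T} \<times> {0..2 * pi}) (\<lambda>p. (norm_sq_normal_gradient T u X p - simons_op T u X p \<bullet> X p) * sqrt (det (metric T u p)))
     = integral ({a..T} \<times> {0..2 * pi}) (\<lambda>p. rot_density (fst p) (snd p))"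
    by (rule integral_cong) (use sub in \<open>auto simp: stability_density subset_eq\<close>)
  also have "\<dots> = integral (cbox (a, 0) (T, 2 * pi)) (\<lambda>p. rot_density (fst p) (snd p))"
    by (simp add: cbox_Pair_eq)
  also have "\<dots> = integral (cbox a T) (\<lambda>t. integral (cbox 0 (2 * pi)) (\<lambda>\<theta>. rot_density (fst (t, \<theta>)) (snd (t, \<theta>))))"
    by (rule integral_prod_continuous)
       (use cont2_rot_density sub in \<open>auto simp: cont2_def cbox_Pair_eq intro: continuous_on_subset\<close>)
  finally have 1: "integral ({a..T} \<times> {0..2 * pi}) (\<lambda>p. (norm_sq_normal_gradient T u X p - simons_op T u X p \<bullet> X p) * sqrt (det (metric T u p)))
     = integral {a..T} (\<lambda>t. integral {0..2 * pi} (rot_density t))" by simp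
  have 2: "integral {0..2 * pi} (\<lambda>\<theta>. (norm (X (t, \<theta>)))\<^sup>2 * norm (pd T 2 u (t, \<theta>))) =
     h * integral {0..2 * pi} (\<lambda>\<theta>. (x1 t \<theta>)\<^sup>2 + (x2 t \<theta>)\<^sup>2 + (y1 t \<theta>)\<^sup>2 + (y2 t \<theta>)\<^sup>2)" if "t \<in> E" for t
  proof -
    have t: "t \<in> J" "mu2 t = mu2 T" using that E T_pos by (auto simp: mu2_def)
    have "norm (pd T 2 u (t, \<theta>)) = h" for \<theta>
      unfolding pd_u[OF t(1)] norm_eq_sqrt_inner u_conformal t(2) amp_mu_boundary[symmetric]
      using amp_pos by (simp add: real_sqrt_mult)
    then have "integral {0..2 * pi} (\<lambda>\<theta>. (norm (X (t, \<theta>)))\<^sup>2 * norm (pd T 2 u (t, \<theta>))) =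
      integral {0..2 * pi} (\<lambda>\<theta>. h * ((x1 t \<theta>)\<^sup>2 + (x2 t \<theta>)\<^sup>2 + (y1 t \<theta>)\<^sup>2 + (y2 t \<theta>)\<^sup>2))"
      by (intro integral_cong) (simp add: rot_norm[symmetric] mult.commute)
    then show ?thesis by simp
  qed
  show ?thesis unfolding second_variation_def 1 sum_distrib_left using 2 by simp
qed

lemma annulus_second_variation: "second_variation ({-T..T} \<times> {0..2 * pi}) {-T, T} T u X = rot_form"
  by (subst second_variation_eq) (auto simp: area_form_def)

lemma rot_form_nonneg:
  assumes "\<And>ph m c. cond_active (real m) c \<Longrightarrow> functional X (c, ph, m) = 0"
  shows "0 \<le> rot_form"
proof (rule area_form_nonneg[OF rot_field_C1])
  fix t \<theta> assume "t \<in> J"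
  from X_normal[OF this, of \<theta>] show "x1 t \<theta> * cosh (real l * t) + y1 t \<theta> * sinh (real k * t) = 0"
    "x2 t \<theta> * sinh (real l * t) + y2 t \<theta> * cosh (real k * t) = 0"
    using amp_pos by (auto simp: rot_inner_u)
qed (use assms in \<open>simp add: functional_def field_functional_def\<close>)

lemma annulus_second_variation_nonneg:
  assumes "\<And>i. i \<in> annulus_conds l k \<Longrightarrow> functional X i = 0"
  shows "0 \<le> second_variation ({-T..T} \<times> {0..2 * pi}) {-T, T} T u X"
  unfolding annulus_second_variation
  by (rule rot_form_nonneg) (use assms in \<open>auto simp: functional_def intro: annulus_functionals\<close>)

end

end

section \<open>Index bounds\<close>

context fs_surface begin

lemma functional_linear:
  assumes X: "X \<in> fields" and Y: "Y \<in> fields"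
  shows "functional (\<lambda>p. a *\<^sub>R X p + b *\<^sub>R Y p) i = a * functional X i + b * functional Y i"
proof -
  obtain c ph m where i: "i = (c, ph, m)" by (cases i) auto
  note cX = cont2_rot[OF field_partials(3)[OF X]] and cY = cont2_rot[OF field_partials(3)[OF Y]]
  let ?Z = "\<lambda>p. a *\<^sub>R X p + b *\<^sub>R Y p"
  have lin: "rx1 \<theta> (a *\<^sub>R v + b *\<^sub>R w) = a * rx1 \<theta> v + b * rx1 \<theta> w"
    "rx2 \<theta> (a *\<^sub>R v + b *\<^sub>R w) = a * rx2 \<theta> v + b * rx2 \<theta> w"
    "ry1 \<theta> (a *\<^sub>R v + b *\<^sub>R w) = a * ry1 \<theta> v + b * ry1 \<theta> w"
    "ry2 \<theta> (a *\<^sub>R v + b *\<^sub>R w) = a * ry2 \<theta> v + b * ry2 \<theta> w" for \<theta> v w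
    by (simp_all add: rot_defs algebra_simps)
  show ?thesis
    unfolding functional_def field_functional_def i split lin
    by (intro mode_functional_linear cont2_coeff coeff_linear cX cY; rule cX[THEN cont2_slice] cY[THEN cont2_slice]; assumption)
qed

text \<open>On a negative definite subspace the joint kernel of the functionals is trivial, because
  \<open>Q\<close> is nonnegative on it.\<close>

lemma form_index_bound:
  assumes \<Gamma>: "\<Gamma> \<subseteq> fields" and I: "finite I"
    and nonneg: "\<And>X. X \<in> \<Gamma> \<Longrightarrow> (\<And>i. i \<in> I \<Longrightarrow> functional X i = 0) \<Longrightarrow> 0 \<le> Q X"
  shows "form_index \<Gamma> Q \<le> enat (card I)"
  unfolding form_index_def
proof (rule SUP_least)
  fix V assume "V \<in> {V. fun_vs.subspace V \<and> V \<subseteq> \<Gamma> \<and> (\<forall>X\<in>V. X \<noteq> 0 \<longrightarrow> Q X < 0)}"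
  then have V: "fun_vs.subspace V" "V \<subseteq> \<Gamma>" "\<And>X. X \<in> V \<Longrightarrow> X \<noteq> 0 \<Longrightarrow> Q X < 0" by auto
  show "edim V \<le> enat (card I)"
  proof (rule edim_le_card_functionals[where L = "\<lambda>i X. functional X i", OF I V(1)])
    fix i X Y assume "X \<in> V" "Y \<in> V"
    then show "functional (X + Y) i = functional X i + functional Y i"
      using functional_linear[of X Y 1 1 i] V(2) \<Gamma> by (auto simp: plus_fun_def)
  next
    fix i c X assume "X \<in> V"
    then show "functional (\<lambda>p. c *\<^sub>R X p) i = c * functional X i"
      using functional_linear[of X X c 0 i] V(2) \<Gamma> by auto
  next
    fix X assume X: "X \<in> V" "\<And>i. i \<in> I \<Longrightarrow> functional X i = 0"
    then have "0 \<le> Q X" using V(2) by (intro nonneg) auto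
    then show "X = 0" using V(3)[OF X(1)] by (meson not_less)
  qed
qed

theorem annulus_index_bound: "annulus_index T u \<le> enat (8 * (k + l) - 7)"
  unfolding annulus_index_def card_annulus_conds[OF l_less_k, symmetric]
  by (rule form_index_bound[OF order_refl finite_conds(1)])
     (rule annulus_second_variation_nonneg)

section \<open>Symmetry of fields on the Moebius band\<close>

context
  fixes X :: "real \<times> real \<Rightarrow> real^4"
  assumes even_k: "even k" and odd_l: "odd l" and XM: "X \<in> moebius_normal_fields T u"
begin

lemma moebius_field: "X \<in> fields" using XM by (simp add: moebius_normal_fields_def)

lemma X_half_turn: "X (- t, \<theta> + pi) = X (t, \<theta>)"
  using XM by (simp add: moebius_normal_fields_def)

lemma rot_half_turn: "rx1 (\<theta> + pi) v = - rx1 \<theta> v" "rx2 (\<theta> + pi) v = - rx2 \<theta> v"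
  "ry1 (\<theta> + pi) v = ry1 \<theta> v" "ry2 (\<theta> + pi) v = ry2 \<theta> v"
  using even_k odd_l by (simp_all add: rot_defs distrib_left cos_add sin_add cos_npi sin_npi)

lemma pd_half_turn:
  assumes t: "t \<in> J"
  shows "pd T 1 X (- t, \<theta> + pi) = - pd T 1 X (t, \<theta>)" "pd T 2 X (- t, \<theta> + pi) = pd T 2 X (t, \<theta>)"
proof -
  have mt: "- t \<in> J" using t by auto
  have nb: "at t within J \<noteq> bot" using t T_pos by (simp add: trivial_limit_within islimpt_Icc)
  have im: "uminus ` J = J" by simp
  have "((\<lambda>s. X (s, \<theta> + pi)) \<circ> uminus has_vector_derivative (- 1) *\<^sub>R pd T 1 X (- t, \<theta> + pi)) (at t within J)"
    using field_partials(1)[OF moebius_field mt, of "\<theta> + pi"]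
    by (intro vector_diff_chain_within) (auto simp: im intro!: derivative_eq_intros)
  then have "((\<lambda>s. X (s, \<theta>)) has_vector_derivative - pd T 1 X (- t, \<theta> + pi)) (at t within J)"
    by (simp add: o_def X_half_turn)
  from vector_derivative_unique_within[OF nb this field_partials(1)[OF moebius_field t]]
  show "pd T 1 X (- t, \<theta> + pi) = - pd T 1 X (t, \<theta>)" by (metis minus_minus)
  have "((\<lambda>s. X (- t, s)) \<circ> (\<lambda>s. s + pi) has_vector_derivative 1 *\<^sub>R pd T 2 X (- t, \<theta> + pi)) (at \<theta>)"
    using field_partials(2)[OF moebius_field mt, of "\<theta> + pi"]
    by (intro vector_diff_chain_at) (auto intro!: derivative_eq_intros)
  then have "((\<lambda>s. X (t, s)) has_vector_derivative pd T 2 X (- t, \<theta> + pi)) (at \<theta>)"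
    by (simp add: o_def X_half_turn)
  from vector_derivative_unique_at[OF this field_partials(2)[OF moebius_field t]]
  show "pd T 2 X (- t, \<theta> + pi) = pd T 2 X (t, \<theta>)" .
qed

lemma integral_half_turn:
  assumes g: "cont2 g" and sym: "\<And>t \<theta>. t \<in> J \<Longrightarrow> g (- t) (\<theta> + pi) = g t \<theta>" and t: "t \<in> J"
  shows "integral {0..2 * pi} (g (- t)) = integral {0..2 * pi} (g t)"
proof -
  have mt: "- t \<in> J" using t by auto
  have "g (- t) (\<theta> + 2 * pi) = g (- t) \<theta>" for \<theta>
    using sym[OF t, of "\<theta> + pi"] sym[OF mt, of \<theta>] by (simp add: add.assoc)
  then have "integral {0..2 * pi} (g (- t)) = integral {0..2 * pi} (\<lambda>\<theta>. g (- t) (\<theta> + pi))"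
    by (intro integral_periodic_shift[symmetric] cont2_slice[OF g mt]) auto
  also have "(\<lambda>\<theta>. g (- t) (\<theta> + pi)) = g t" using sym[OF t] by (rule ext)
  finally show ?thesis .
qed

lemma rot_density_half_turn:
  assumes t: "t \<in> J"
  shows "rot_density X (- t) (\<theta> + pi) = rot_density X t \<theta>"
proof -
  have mu: "mu2 (- t) = mu2 t" by (simp add: mu2_def)
  show ?thesis
    unfolding rot_density_eq[OF moebius_field] pd_half_turn[OF t] srcF_def srcG_def X_half_turn rot_half_turn mu
    by (simp add: power2_eq_square algebra_simps)
qed

text \<open>The half turn exchanges the two halves of the annulus and its two boundary circles and
  preserves both densities. Nonnegativity on the Moebius band is thus inherited from the
  annulus.\<close>

lemma moebius_second_variation:
  "rot_form X = 2 * second_variation ({0..T} \<times> {0..2 * pi}) {T} T u X"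
proof -
  let ?A = "\<lambda>t. integral {0..2 * pi} (rot_density X t)"
  let ?b = "\<lambda>t. integral {0..2 * pi} (\<lambda>\<theta>. (rx1 \<theta> (X (t, \<theta>)))\<^sup>2 + (rx2 \<theta> (X (t, \<theta>)))\<^sup>2
      + (ry1 \<theta> (X (t, \<theta>)))\<^sup>2 + (ry2 \<theta> (X (t, \<theta>)))\<^sup>2)"
  have cA: "continuous_on J ?A" by (rule cont2_integral[OF cont2_rot_density[OF moebius_field]])
  have A: "?A (- t) = ?A t" if "t \<in> J" for t
    using integral_half_turn[OF cont2_rot_density[OF moebius_field] rot_density_half_turn that] .
  have b: "?b (- T) = ?b T"
    using T_pos
    by (intro integral_half_turn cont2_intros cont2_rot field_partials(3)[OF moebius_field])
       (auto simp: X_half_turn rot_half_turn)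
  have "integral {- T..0} ?A = integral {- T..0} (\<lambda>t. ?A (- t))"
    by (rule integral_cong) (simp add: A T_pos)
  also have "\<dots> = integral {0..T} ?A"
    using Henstock_Kurzweil_Integration.integral_reflect_real[of T 0 ?A] by simp
  finally have "integral J ?A = 2 * integral {0..T} ?A"
    using Henstock_Kurzweil_Integration.integral_combine[of "- T" 0 T ?A] T_pos
      integrable_continuous_real[OF cA] by simp
  then show ?thesis
    using second_variation_eq[OF moebius_field, of 0 "{T}"] b T_pos by (simp add: area_form_def)
qed

lemma moebius_second_variation_nonneg:
  assumes z: "\<And>i. i \<in> moebius_conds l k \<Longrightarrow> functional X i = 0"
  shows "0 \<le> second_variation ({0..T} \<times> {0..2 * pi}) {T} T u X"
proof -
  have "0 \<le> rot_form X"
  proof (rule rot_form_nonneg[OF moebius_field])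
    fix ph m c assume act: "cond_active (real m) c"
    note cs = cont2_rot[OF field_partials(3)[OF moebius_field]]
    have per: "- t \<in> J" if "t \<in> J" for t using that by auto
    show "functional X (c, ph, m) = 0"
      unfolding functional_def
    proof (rule moebius_functionals[OF _ _ _ _ _ act])
      fix t assume t: "t \<in> J"
      note h = integral_coeff_half_turn[OF cs(1)[THEN cont2_slice[OF _ per[OF t]]], where c = "-1" and f = "\<lambda>\<theta>. rx1 \<theta> (X (t, \<theta>))"]
        integral_coeff_half_turn[OF cs(2)[THEN cont2_slice[OF _ per[OF t]]], where c = "-1" and f = "\<lambda>\<theta>. rx2 \<theta> (X (t, \<theta>))"]
        integral_coeff_half_turn[OF cs(3)[THEN cont2_slice[OF _ per[OF t]]], where c = 1 and f = "\<lambda>\<theta>. ry1 \<theta> (X (t, \<theta>))"]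
        integral_coeff_half_turn[OF cs(4)[THEN cont2_slice[OF _ per[OF t]]], where c = 1 and f = "\<lambda>\<theta>. ry2 \<theta> (X (t, \<theta>))"]
      show "mode_c ph m (\<lambda>\<theta>. rx1 \<theta> (X (- t, \<theta>))) = - ((- 1) ^ m) * mode_c ph m (\<lambda>\<theta>. rx1 \<theta> (X (t, \<theta>)))"
        "mode_s ph m (\<lambda>\<theta>. rx2 \<theta> (X (- t, \<theta>))) = - ((- 1) ^ m) * mode_s ph m (\<lambda>\<theta>. rx2 \<theta> (X (t, \<theta>)))"
        "mode_c ph m (\<lambda>\<theta>. ry1 \<theta> (X (- t, \<theta>))) = (- 1) ^ m * mode_c ph m (\<lambda>\<theta>. ry1 \<theta> (X (t, \<theta>)))"
        "mode_s ph m (\<lambda>\<theta>. ry2 \<theta> (X (- t, \<theta>))) = (- 1) ^ m * mode_s ph m (\<lambda>\<theta>. ry2 \<theta> (X (t, \<theta>)))"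
        using h by (simp_all add: X_periodic[OF moebius_field] rot_periodic X_half_turn rot_half_turn)
    qed (use z in \<open>simp add: functional_def\<close>)
  qed
  then show ?thesis unfolding moebius_second_variation by simp
qed

end

theorem moebius_index_bound:
  assumes "even k" "odd l"
  shows "moebius_index T u \<le> enat (4 * (k + l) - 7)"
  unfolding moebius_index_def card_moebius_conds[OF l_less_k assms, symmetric]
  by (rule form_index_bound[OF _ finite_conds(2)])
     (auto simp: moebius_normal_fields_def intro!: moebius_second_variation_nonneg assms)

end

theorem theorem1p5:
  fixes k l :: int
  assumes "coprime k l" and "k > l" and "l > 0"
  shows "Ind_IFS k l \<le>
           (if odd k then enat (nat (8 * (k + l) - 7)) else enat (nat (4 * (k + l) - 7)))"
proof -
  define T where "T = fs_T k l"
  define L K where "L = nat l" and "K = nat k"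
  have kl: "k = int K" "l = int L" "real K = of_int k" "real L = of_int l"
    using assms by (auto simp: L_def K_def)
  define h where "h = real K * tanh (real K * T)"
  have T: "T > 0" "real K * tanh (real K * T) = real L * (cosh (real L * T) / sinh (real L * T))"
    using fs_T_props[of l k] assms unfolding kl(3,4) T_def by auto
  have LK: "0 < real L" "real L < real K" using assms kl by auto
  have hL: "real L * cosh (real L * T) = h * sinh (real L * T)"
  proof -
    have "sinh (real L * T) > 0" using T(1) LK(1) by simp
    then have "sinh (real L * T) \<noteq> 0" by linarith
    then show ?thesis unfolding h_def T(2) by simp
  qed
  have hK: "real K * sinh (real K * T) = h * cosh (real K * T)"
    unfolding h_def tanh_def using cosh_real_nonzero[of "real K * T"] by simp
  interpret fs_surface L K T h
    using LK by unfold_locales (rule T(1) hL hK | simp | simp add: T_def kl(1,2))+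
  show ?thesis
  proof (cases "odd k")
    case True
    have "nat (8 * (k + l) - 7) = 8 * (K + L) - 7" using assms by (simp add: kl(1,2))
    then show ?thesis using True annulus_index_bound by (simp add: Ind_IFS_def T_def kl(1,2))
  next
    case False
    \<comment> \<open>Coprimality with an even \<open>k\<close> makes \<open>l\<close> odd, which
      fixes the signs with which a half turn acts on the rotating frame.\<close>
    then have "odd l" using assms(1) by (auto dest: coprime_common_divisor[of k l 2])
    then have "even K" "odd L" using False by (auto simp: kl(1,2))
    moreover have "nat (4 * (k + l) - 7) = 4 * (K + L) - 7" using assms by (simp add: kl(1,2))
    ultimately show ?thesis using False moebius_index_bound by (simp add: Ind_IFS_def T_def kl(1,2))
  qed
qed

end
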